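(* Let $n\geq 3$ and $d\geq 1$ be integers. The abelianization $\Gamma_d(n)/[\Gamma_d(n),\Gamma_d(n)]$ of $\Gamma_d(n)$ is isomorphic to $(\mathbb{Z}/d\mathbb{Z})^{n^2-1}$.
   Context: For integers $n\geq 1$ and $d\geq 2$, $\Gamma_d(n)=\{X\in \mathrm{SL}(n;\mathbb{Z}) \mid X\equiv I \pmod d\}$ is the level $d$ principal congruence subgroup, i.e. the kernel of the natural homomorphism $\mathrm{SL}(n;\mathbb{Z})\to \mathrm{SL}(n;\mathbb{Z}/d\mathbb{Z})$; and $\Gamma_1(n)=\mathrm{SL}(n;\mathbb{Z})$. *)

theory Defs
  imports
    "HOL-Algebra.Algebra"
    "HOL-Number_Theory.Cong"
    "Jordan_Normal_Form.Determinant"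
begin

definition SL_int :: "nat \<Rightarrow> int mat monoid" where
  "SL_int n = \<lparr>carrier = {A \<in> carrier_mat n n. det A = 1},
               monoid.mult = (*), one = 1\<^sub>m n\<rparr>"

(* For d = 1 the congruence condition is vacuous, so the first level is all of SL(n;Z). *)
definition congruence_subgroup :: "nat \<Rightarrow> nat \<Rightarrow> int mat set" where
  "congruence_subgroup d n =
     {A \<in> carrier (SL_int n). \<forall>i<n. \<forall>j<n. [A $$ (i, j) = 1\<^sub>m n $$ (i, j)] (mod int d)}"

definition congruence_group :: "nat \<Rightarrow> nat \<Rightarrow> int mat monoid" where
  "congruence_group d n = (SL_int n)\<lparr>carrier := congruence_subgroup d n\<rparr>"

definition abelianization :: "('a, 'b) monoid_scheme \<Rightarrow> 'a set monoid" where
  "abelianization G = G Mod (derived G (carrier G))"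

lemma group_SL_int: "group (SL_int n)"
proof (rule groupI)
  fix A assume "A \<in> carrier (SL_int n)"
  then have A: "A \<in> carrier_mat n n" "det A = 1"
    by (auto simp: SL_int_def)
  have "det (adj_mat A * A) = 1"
    using adj_mat(3)[OF A(1)] A(2) by simp
  then have "det (adj_mat A) = 1"
    using det_mult[OF adj_mat(1)[OF A(1)] A(1)] A(2) by simp
  then show "\<exists>B\<in>carrier (SL_int n). B \<otimes>\<^bsub>SL_int n\<^esub> A = \<one>\<^bsub>SL_int n\<^esub>"
    using adj_mat[OF A(1)] A(2) by (intro bexI[of _ "adj_mat A"]) (auto simp: SL_int_def)
qed (auto simp: SL_int_def det_mult)

lemma cong_mat_mult:
  fixes A A' B B' :: "int mat"
  assumes "A \<in> carrier_mat n n" "A' \<in> carrier_mat n n"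
    and "B \<in> carrier_mat n n" "B' \<in> carrier_mat n n"
    and "\<And>i j. i < n \<Longrightarrow> j < n \<Longrightarrow> [A $$ (i, j) = A' $$ (i, j)] (mod m)"
    and "\<And>i j. i < n \<Longrightarrow> j < n \<Longrightarrow> [B $$ (i, j) = B' $$ (i, j)] (mod m)"
    and "i < n" "j < n"
  shows "[(A * B) $$ (i, j) = (A' * B') $$ (i, j)] (mod m)"
proof -
  have "[(\<Sum>k = 0..<n. A $$ (i, k) * B $$ (k, j)) = (\<Sum>k = 0..<n. A' $$ (i, k) * B' $$ (k, j))] (mod m)"
    using assms by (intro cong_sum cong_mult) auto
  then show ?thesis
    using assms(1-4,7,8) by (simp add: scalar_prod_def)
qed

lemma subgroup_congruence_subgroup: "subgroup (congruence_subgroup d n) (SL_int n)"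
proof (rule group.subgroupI[OF group_SL_int])
  show "congruence_subgroup d n \<subseteq> carrier (SL_int n)"
    by (auto simp: congruence_subgroup_def)
  have "1\<^sub>m n \<in> congruence_subgroup d n"
    by (simp add: congruence_subgroup_def SL_int_def)
  then show "congruence_subgroup d n \<noteq> {}"
    by blast
next
  fix A B assume "A \<in> congruence_subgroup d n" "B \<in> congruence_subgroup d n"
  then have AB: "A \<in> carrier (SL_int n)" "B \<in> carrier (SL_int n)"
    and carr: "A \<in> carrier_mat n n" "B \<in> carrier_mat n n"
    and c: "\<And>i j. i < n \<Longrightarrow> j < n \<Longrightarrow> [A $$ (i, j) = 1\<^sub>m n $$ (i, j)] (mod int d)"
      "\<And>i j. i < n \<Longrightarrow> j < n \<Longrightarrow> [B $$ (i, j) = 1\<^sub>m n $$ (i, j)] (mod int d)"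
    by (auto simp: congruence_subgroup_def SL_int_def)
  have "[(A * B) $$ (i, j) = 1\<^sub>m n $$ (i, j)] (mod int d)" if "i < n" "j < n" for i j
    using cong_mat_mult[OF carr(1) one_carrier_mat carr(2) one_carrier_mat c that] by simp
  moreover have "A * B \<in> carrier (SL_int n)"
    using AB by (auto simp: SL_int_def det_mult)
  ultimately have "A * B \<in> congruence_subgroup d n"
    unfolding congruence_subgroup_def by blast
  then show "A \<otimes>\<^bsub>SL_int n\<^esub> B \<in> congruence_subgroup d n"
    by (simp add: SL_int_def)
next
  fix A assume "A \<in> congruence_subgroup d n"
  then have A: "A \<in> carrier (SL_int n)" and carr: "A \<in> carrier_mat n n"
    and c: "\<And>i j. i < n \<Longrightarrow> j < n \<Longrightarrow> [A $$ (i, j) = 1\<^sub>m n $$ (i, j)] (mod int d)"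
    by (auto simp: congruence_subgroup_def SL_int_def)
  define B where "B = inv\<^bsub>SL_int n\<^esub> A"
  have B: "B \<in> carrier (SL_int n)"
    unfolding B_def by (rule group.inv_closed[OF group_SL_int A])
  then have carrB: "B \<in> carrier_mat n n" by (simp add: SL_int_def)
  have "A * B = 1\<^sub>m n"
    using group.r_inv[OF group_SL_int A] by (simp add: B_def SL_int_def)
  then have "[B $$ (i, j) = 1\<^sub>m n $$ (i, j)] (mod int d)" if "i < n" "j < n" for i j
    using cong_mat_mult[OF carr one_carrier_mat carrB carrB c cong_refl that] carrB
    by (metis cong_sym left_mult_one_mat)
  then show "inv\<^bsub>SL_int n\<^esub> A \<in> congruence_subgroup d n"
    using B unfolding congruence_subgroup_def B_def by blast
qed

lemma group_congruence_group: "group (congruence_group d n)"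
  unfolding congruence_group_def
  by (rule group.subgroup_imp_group[OF group_SL_int subgroup_congruence_subgroup])

end

theory Submission
  imports Defs "HOL-Number_Theory.Number_Theory"
begin

text \<open>
  Write \<open>\<Gamma>\<close> for the congruence subgroup of level \<open>d\<close> of \<open>SL(n, \<int>)\<close> and \<open>N\<close> for its commutator subgroup.
  The map \<open>1 + d A \<mapsto> A mod d\<close> is a homomorphism from \<open>\<Gamma>\<close> to additive matrices. Its kernel is the
  congruence subgroup \<open>\<Lambda>\<close> of level \<open>d\<^sup>2\<close>, and its image consists of the matrices of trace 0: the
  determinant determines the last diagonal entry from the other ones, while elementary matrices and their
  conjugates realize all values of the other \<open>n\<^sup>2 - 1\<close> entries. So the theorem amounts to \<open>N = \<Lambda>\<close>. The
  inclusion of \<open>N\<close> in \<open>\<Lambda>\<close> is clear, and the work lies in the other one, \<open>\<Lambda>_subset_N\<close>, which is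
  essentially Mennicke's solution of the congruence subgroup problem for \<open>SL(n, \<int>)\<close>.

  Put \<open>m = d\<^sup>2\<close>. As \<open>n \<ge> 3\<close>, the elementary matrices with entry divisible by \<open>m\<close> are commutators and lie in
  \<open>N\<close>. Row and column operations with such entries, together with conjugation by arbitrary elementary matrices
  (\<open>N\<close> is normal in \<open>SL(n, \<int>)\<close>), reduce every element of \<open>\<Lambda>\<close> to a block with first row \<open>(a, b)\<close> of size 2,
  where \<open>a\<close> is 1 and \<open>b\<close> is 0 modulo \<open>m\<close>. Modulo \<open>N\<close> such a block commutes with the elementary matrices of
  the upper left corner of size 3, and its class depends only on \<open>a\<close> and \<open>b\<close>. This class is a Mennicke symbol:
  it is invariant under \<open>a \<mapsto> a + t b\<close>, \<open>b \<mapsto> b + t m a\<close> and \<open>b \<mapsto> -b\<close>, and it is multiplicative in \<open>a\<close>.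

  It remains to see that every Mennicke symbol over the integers vanishes, \<open>mennicke_symbol_trivial\<close>. The usual proof
  chooses primes in arithmetic progressions by Dirichlet's theorem. The proof below avoids them and treats the symbol
  like a power residue symbol that satisfies a reciprocity law. It is extended to a function \<open>W a b\<close> that is
  multiplicative in both arguments, for \<open>a\<close> prime to \<open>m\<close> and \<open>b\<close> prime to \<open>a\<close>, and depends only on \<open>b\<close>
  modulo \<open>a\<close>. The defect \<open>R a b = W a b - W b a\<close> depends only on the classes of \<open>a\<close> and \<open>b\<close> modulo a power
  of \<open>m\<close>. The trivial observation that \<open>W a (1 - a) = 0\<close> gives a Steinberg relation, and this relation splits \<open>R\<close>
  into components at the primes dividing \<open>m\<close>. At an odd prime the units modulo prime powers are cyclic and the component
  vanishes by an elementary argument on quadratic non-residues; at 2 it vanishes because \<open>R (-1) (-1) = 0\<close>. Hence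
  \<open>W a b = W b a\<close>, and an induction on primes in the style of Gauss and Tate shows that \<open>W\<close> is trivial: the
  residues modulo a prime are products of smaller primes, and reciprocity passes from a prime to a smaller one.
\<close>

text \<open>Primes are prime numbers here, not prime elements of a monoid with a carrier set.\<close>

hide_const (open) Divisibility.prime

section \<open>Symbols on the units modulo a prime power\<close>

lemma power_of_primitive_root:
  assumes "prime p" "odd p" "k > 0"
  obtains g :: int where "coprime g (int p)"
    "\<And>x. coprime x (int p) \<Longrightarrow> \<exists>i. [x = g ^ i] (mod int p ^ k)"
proof -
  obtain g where g: "\<forall>k>0. residue_primroot (p ^ k) g"
    using residue_primroot_odd_prime_power_exists assms by blast
  have p1: "p ^ k > 1" using assms prime_gt_1_nat by (metis one_less_power)
  have cop: "coprime p g" using g assms(3) by (auto simp: residue_primroot_def)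
  show thesis
  proof (rule that[of "int g"])
    show "coprime (int g) (int p)" using cop by (simp add: coprime_commute)
    fix x :: int assume x: "coprime x (int p)"
    define y where "y = nat (x mod int (p ^ k))"
    have y: "int y = x mod int (p ^ k)" using p1 unfolding y_def by (simp add: prime_gt_0_nat assms)
    have "coprime x (int (p ^ k))" using x by simp
    moreover have "int (p ^ k) \<noteq> 0" using p1 by linarith
    ultimately have "coprime (int y) (int (p ^ k))" unfolding y by (subst coprime_mod_left_iff)
    then have cy: "coprime y (p ^ k)" by (simp only: coprime_int_iff)
    moreover have "y > 0" using cy p1 by (intro Nat.gr0I) auto
    moreover have "y < p ^ k" using y p1 pos_mod_bound[of "int (p ^ k)" x] by (metis gr_implies_not_zero bot_nat_0.not_eq_extremum of_nat_0_less_iff of_nat_less_iff)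
    ultimately have "y \<in> totatives (p ^ k)" by (auto simp: totatives_def)
    then obtain i where "y = g ^ i mod (p ^ k)"
      using residue_primroot_is_generator[OF p1, of g] g assms(3) unfolding bij_betw_def by blast
    then have "int y = int g ^ i mod int (p ^ k)" by (simp add: zmod_int)
    then show "\<exists>i. [x = int g ^ i] (mod int p ^ k)"
      using y by (auto simp: cong_def intro!: exI[of _ i])
  qed
qed

text \<open>
  A symbol on the units modulo an odd prime power is determined by its value at a pair of primitive
  roots, and antisymmetry makes this value 2-torsion. So the symbol is the product of two quadratic
  characters, and it vanishes as soon as all positive integers prime to \<open>p\<close> pair trivially with the
  primitive root. This follows by induction: if \<open>n = a + b\<close> where \<open>a\<close> and \<open>b\<close> already pair trivially,
  the Steinberg relation for \<open>a / n + b / n = 1\<close> leaves only the value at \<open>(n, n)\<close>, and it detects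
  whether \<open>n\<close> is an even power of the root. In classical terms: the least non-residue \<open>n\<close> would give two
  non-residues \<open>1 / n\<close> and \<open>(n - 1) / n\<close> of sum 1.
\<close>

lemma odd_local_symbol_trivial:
  fixes L :: "int \<Rightarrow> int \<Rightarrow> 'g::ab_group_add"
  assumes p: "prime p" "odd p" and k: "k > 0"
    and add: "\<And>x y z. coprime x (int p) \<Longrightarrow> coprime y (int p) \<Longrightarrow> coprime z (int p) \<Longrightarrow>
               L x (y * z) = L x y + L x z"
    and cong: "\<And>x y z. coprime x (int p) \<Longrightarrow> coprime y (int p) \<Longrightarrow> [y = z] (mod int p ^ k) \<Longrightarrow> L x y = L x z"
    and antisym: "\<And>x y. coprime x (int p) \<Longrightarrow> coprime y (int p) \<Longrightarrow> L x y = - L y x"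
    and steinberg: "\<And>x y. coprime x (int p) \<Longrightarrow> coprime y (int p) \<Longrightarrow> [x + y = 1] (mod int p ^ k) \<Longrightarrow> L x y = 0"
    and xy: "coprime x (int p)" "coprime y (int p)"
  shows "L x y = 0"
proof -
  obtain g where g: "coprime g (int p)"
    and gen: "\<And>x. coprime x (int p) \<Longrightarrow> \<exists>i. [x = g ^ i] (mod int p ^ k)"
    using power_of_primitive_root[OF p k] by blast
  have p_dvd: "int p dvd int p ^ k" using k by (simp add: dvd_power)
  have cop_cong: "coprime z (int p)" if "[y = z] (mod int p ^ k)" "coprime y (int p)" for y z
    using that p_dvd by (meson cong_dvd_modulus cong_imp_coprime cong_sym)
  have one: "L x 1 = 0" if "coprime x (int p)" for x
    using add[OF that, of 1 1] by simp
  have addl: "L (x * y) z = L x z + L y z"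
    if "coprime x (int p)" "coprime y (int p)" "coprime z (int p)" for x y z
    using that antisym[of "x*y" z] antisym[of x z] antisym[of y z] add[of z x y] by simp
  have congl: "L x z = L y z" if "coprime x (int p)" "coprime z (int p)" "[x = y] (mod int p ^ k)" for x y z
    using that antisym[of x z] antisym[of y z] cong[of z x y] cop_cong[of x y] by simp
  have onel: "L 1 z = 0" if "coprime z (int p)" for z
    using addl[OF _ _ that, of 1 1] by simp
  have eps: "L g g + L g g = 0" using antisym[OF g g] by (metis add.right_inverse)
  have Lg_pow: "L g (g ^ i) = (if even i then 0 else L g g)" for i
    using g eps by (induction i) (auto simp: one add)
  have two: "L g v + L g v = 0" if v: "coprime v (int p)" for v
  proof -
    obtain i where i: "[v = g ^ i] (mod int p ^ k)" using gen v by blast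
    show ?thesis using cong[OF g v i] eps by (simp add: Lg_pow)
  qed
  have L_pow: "L (g ^ i) v = (if even i then 0 else L g v)" if v: "coprime v (int p)" for i v
    using g two[OF v] v by (induction i) (auto simp: onel addl)
  \<comment> \<open>since the units are powers of \<open>g\<close>, pairing trivially with \<open>g\<close> is pairing trivially with all units\<close>
  have triv: "L u v = 0" if t: "coprime u (int p)" "coprime v (int p)" "L g v = 0" for u v
  proof -
    obtain i where i: "[u = g ^ i] (mod int p ^ k)" using gen[OF t(1)] by blast
    show ?thesis using congl[OF t(1,2) i] t by (simp add: L_pow)
  qed
  have sq: "L g n = 0" if n: "coprime n (int p)" and nn: "L n n = 0" for n
  proof -
    obtain i where i: "[n = g ^ i] (mod int p ^ k)" using gen n by blast
    have "L n n = (if even i then 0 else L g n)" "L g n = (if even i then 0 else L g g)"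
      using congl[OF n n i] cong[OF g n i] n by (simp_all add: L_pow Lg_pow)
    then show ?thesis using nn by (auto split: if_splits)
  qed
  have pos: "L g (int n) = 0" if "n > 0" "coprime (int n) (int p)" for n
    using that
  proof (induction n rule: less_induct)
    case (less n)
    show ?case
    proof (cases "n = 1")
      case True then show ?thesis using one g by simp
    next
      case False
      have cop: "coprime (int r) (int p) \<longleftrightarrow> \<not> p dvd r" for r
        using p(1) prime_imp_coprime[OF p(1), of r] not_prime_unit[of p]
      by (auto simp: coprime_commute coprime_absorb_left)
      have "p > 2" using p by (metis even_numeral le_neq_implies_less prime_ge_2_nat)
      \<comment> \<open>usually \<open>n = 1 + (n - 1)\<close>, but not if \<open>p\<close> divides \<open>n - 1\<close>\<close>
      obtain a b where ab: "n = a + b" "a > 0" "b > 0" "\<not> p dvd a" "\<not> p dvd b"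
      proof (cases "p dvd n - 1")
        case d: False
        then show thesis using that[of 1 "n - 1"] False less.prems \<open>p > 2\<close> by auto
      next
        case True
        then have "p \<le> n - 1" using less.prems False by (intro dvd_imp_le) auto
        have "\<not> p dvd n - 2"
        proof
          assume "p dvd n - 2"
          then have "p dvd (n - 1) - (n - 2)" using True by (rule dvd_diff_nat[rotated])
          also have "(n - 1) - (n - 2) = 1" using \<open>p \<le> n - 1\<close> \<open>p > 2\<close> by simp
          finally show False using \<open>p > 2\<close> by simp
        qed
        moreover have "\<not> p dvd 2" using \<open>p > 2\<close> by (auto dest: dvd_imp_le)
        ultimately show thesis using that[of 2 "n - 2"] \<open>p \<le> n - 1\<close> \<open>p > 2\<close> by simp
      qed
      have "L g (int a) = 0" "L g (int b) = 0"
        using ab less.IH cop by auto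
      have ca: "coprime (int a) (int p)" "coprime (int b) (int p)" using ab cop by auto
      have cn: "coprime (int n) (int p)" by fact
      obtain v where v: "[int n * v = 1] (mod int p ^ k)"
        using cn by (metis cong_solve_coprime_int coprime_power_right_iff)
      then have cv: "coprime v (int p)" 
        using cop_cong[OF cong_sym[OF v]] by simp
      have "[int a * v + int b * v = 1] (mod int p ^ k)"
        using v ab by (simp add: algebra_simps)
      then have "L (int a * v) (int b * v) = 0"
        using ca cv by (intro steinberg) auto
      then have "L a b + L v b + L a v + L v v = 0"
        using ca cv by (simp add: add addl algebra_simps)
      moreover have "L a b = 0" "L v b = 0" "L v a = 0"
        using triv ca cv \<open>L g (int a) = 0\<close> \<open>L g (int b) = 0\<close> by auto
      moreover have "L a v = - L v a" using antisym ca cv by blast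
      ultimately have vv: "L v v = 0" by simp
      have "L v n = - L v v" 
        using cong[OF cv _ v] add[OF cv cn cv] cn cv one by (simp add: eq_neg_iff_add_eq_0)
      then have "L (int n) v = 0" using vv antisym[OF cn cv] by simp
      then have "L n n = 0"
        using cong[OF cn _ v] add[OF cn cn cv] cn cv one by simp
      then show ?thesis using sq cn by simp
    qed
  qed
  have "p ^ k > 0" using p prime_gt_0_nat by simp
  then obtain n where n: "n > 0" "[y = int n] (mod int p ^ k)"
    by (intro that[of "nat (y mod int p ^ k) + p ^ k"]) (auto simp: cong_def)
  have "L g y = 0"
    using pos[OF n(1)] cop_cong[OF n(2) xy(2)] cong[OF g xy(2) n(2)] by simp
  then show ?thesis using triv xy by simp
qed

lemma five_power_two_power:
  "\<exists>u::int. odd u \<and> 5 ^ (2 ^ j) = 1 + 2 ^ (j + 2) * u"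
proof (induction j)
  case 0
  show ?case by (intro exI[of _ 1]) simp
next
  case (Suc j)
  then obtain u :: int where u: "odd u" "5 ^ (2 ^ j) = 1 + 2 ^ (j + 2) * u" by blast
  have "(5::int) ^ (2 ^ Suc j) = (1 + 2 ^ (j + 2) * u) ^ 2"
    using u(2) by (simp only: power_Suc2 power_mult)
  also have "\<dots> = 1 + 2 ^ (Suc j + 2) * (u + 2 ^ (j + 1) * u ^ 2)"
    by (simp add: power2_eq_square algebra_simps power_add)
  finally show ?case using u(1) by (intro exI[of _ "u + 2 ^ (j + 1) * u ^ 2"]) simp
qed

lemma cong_power_of_five_aux:
  assumes "[x = 1] (mod (4::int))"
  shows "\<exists>i. [x = 5 ^ i] (mod 2 ^ (j + 2))"
proof (induction j)
  case 0
  show ?case using assms by (intro exI[of _ 0]) simp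
next
  case (Suc j)
  then obtain i where "[x = 5 ^ i] (mod 2 ^ (j + 2))" by blast
  then obtain c where c: "x = 5 ^ i + 2 ^ (j + 2) * c"
    by (metis cong_iff_lin cong_sym)
  show ?case
  proof (cases "even c")
    case True
    then have "[x = 5 ^ i] (mod 2 ^ (Suc j + 2))"
      using c by (auto elim!: evenE simp: cong_iff_dvd_diff)
    then show ?thesis by blast
  next
    case False
    obtain u :: int where u: "odd u" "5 ^ (2 ^ j) = 1 + 2 ^ (j + 2) * u"
      using five_power_two_power by blast
    have "(5::int) ^ (i + 2 ^ j) = 5 ^ i + 2 ^ (j + 2) * (5 ^ i * u)"
      using u(2) by (simp add: power_add algebra_simps)
    moreover have "even (c - 5 ^ i * u)" using False u(1) by simp
    then obtain v where "c - 5 ^ i * u = 2 * v" by (elim evenE)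
    ultimately have "x - 5 ^ (i + 2 ^ j) = 2 ^ (Suc j + 2) * v"
      using c by (simp add: algebra_simps)
    then show ?thesis by (metis cong_iff_dvd_diff dvd_triv_left)
  qed
qed

lemma cong_power_of_five:
  assumes "[x = 1] (mod (4::int))" "k \<ge> 2"
  shows "\<exists>i. [x = 5 ^ i] (mod 2 ^ k)"
  using cong_power_of_five_aux[OF assms(1), of "k - 2"] assms(2) by (simp only: le_add_diff_inverse2)

text \<open>
  At the prime 2 two units never have sum 1, so the Steinberg relation has to involve the value of the
  symbol at the prime 2 itself; \<open>T\<close> stands for \<open>x \<mapsto> (x, 2)\<close>. The units are generated by -1 and 5. The
  relations for 3, -3, 5, 1/5 and -1 express everything through the values at (-1, -1), which is assumed
  to vanish. That assumption is essential: the Hilbert symbol at 2 satisfies all the others.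
\<close>

lemma two_local_symbol_trivial:
  fixes L :: "int \<Rightarrow> int \<Rightarrow> 'g::ab_group_add" and T :: "int \<Rightarrow> 'g"
  assumes k: "k \<ge> 3"
    and add: "\<And>x y z. odd x \<Longrightarrow> odd y \<Longrightarrow> odd z \<Longrightarrow> L x (y * z) = L x y + L x z"
    and cong: "\<And>x y z. odd x \<Longrightarrow> odd y \<Longrightarrow> [y = z] (mod 2 ^ k) \<Longrightarrow> L x y = L x z"
    and antisym: "\<And>x y. odd x \<Longrightarrow> odd y \<Longrightarrow> L x y = - L y x"
    and T_add: "\<And>x y. odd x \<Longrightarrow> odd y \<Longrightarrow> T (x * y) = T x + T y"
    and T_cong: "\<And>x y. odd x \<Longrightarrow> [x = y] (mod 2 ^ k) \<Longrightarrow> T x = T y"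
    and steinberg2: "\<And>x y. odd x \<Longrightarrow> odd y \<Longrightarrow> [x + 2 * y = 1] (mod 2 ^ k) \<Longrightarrow> T x + L x y = 0"
    and steinberg4: "\<And>x y. odd x \<Longrightarrow> odd y \<Longrightarrow> [x + 4 * y = 1] (mod 2 ^ k) \<Longrightarrow> T x + T x + L x y = 0"
    and neg: "L (-1) (-1) = 0"
    and xy: "odd x" "odd y"
  shows "L x y = 0"
proof -
  have odd_cong: "odd z" if "[y = z] (mod 2 ^ k)" "odd y" for y z :: int
  proof -
    have "(2::int) dvd 2 ^ k" using k by (simp add: dvd_power)
    then show ?thesis using that cong_dvd_modulus cong_dvd_iff by blast
  qed
  have one: "L x 1 = 0" if "odd x" for x
    using add[OF that, of 1 1] by simp
  have addl: "L (x * y) z = L x z + L y z" if "odd x" "odd y" "odd z" for x y z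
    using that antisym[of "x*y" z] antisym[of x z] antisym[of y z] add[of z x y] by simp
  have congl: "L x z = L y z" if "odd x" "odd z" "[x = y] (mod 2 ^ k)" for x y z
    using that antisym[of x z] antisym[of y z] cong[of z x y] odd_cong[of x y] by simp
  have onel: "L 1 z = 0" if "odd z" for z
    using addl[OF _ _ that, of 1 1] by simp
  have X1: "T 1 = 0" using T_add[of 1 1] by simp
  define r where "r = L 5 (-1)"
  have rr: "r + r = 0" using add[of 5 "-1" "-1"] one[of 5] by (simp add: r_def)
  have Xr: "T 5 + T 5 + r = 0" using steinberg4[of 5 "-1"] by (simp add: r_def)
  have Xneg: "T (-1) = 0" using steinberg2[of "-1" 1] one[of "-1"] by simp
  have X3: "T (-3) + T (-3) = 0" using steinberg4[of "-3" 1] one[of "-3"] by simp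
  obtain i where i: "[-3 = 5 ^ i] (mod (2::int) ^ k)"
    using cong_power_of_five[of "-3" k] k by (auto simp: cong_def)
  \<comment> \<open>the even powers of 5 are 1 modulo 8, and -3 is not\<close>
  have "odd i"
  proof
    assume "even i"
    then have "[(5::int) ^ i = 1] (mod 8)"
      using cong_pow[of "25::int" 1 8 "i div 2"] by (auto simp: cong_def power_mult elim!: evenE)
    moreover have "(8::int) dvd 2 ^ k" using le_imp_power_dvd[OF k, of "2::int"] by simp
    then have "[-3 = 5 ^ i] (mod (8::int))" using i cong_dvd_modulus by blast
    ultimately have "[-3 = 1] (mod (8::int))" using cong_trans by blast
    then show False by (simp add: cong_def)
  qed
  have "L (5 ^ j) (-1) = (if even j then 0 else r)" for j
    using rr by (induction j) (auto simp: onel addl r_def)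
  then have "L (-3) (-1) = r" using congl[OF _ _ i, of "-1"] \<open>odd i\<close> by simp
  then have "L 3 (-1) = r" using addl[of "-3" "-1" "-1"] neg by simp
  then have "T 3 + r = 0" using steinberg2[of 3 "-1"] by simp
  moreover have "T 3 = T (-3)" using T_add[of "-3" "-1"] Xneg by simp
  moreover have rr': "T 5 + T 5 + (T 5 + T 5) = 0"
  proof -
    have "T 5 + T 5 = - r" using Xr by (simp only: eq_neg_iff_add_eq_0)
    then have "T 5 + T 5 + (T 5 + T 5) = - (r + r)" by simp
    then show ?thesis using rr by simp
  qed
  have "T (5 ^ j) + T (5 ^ j) = (if even j then 0 else T 5 + T 5)" for j
  proof (induction j)
    case (Suc j)
    have "T (5 ^ Suc j) + T (5 ^ Suc j) = (T 5 + T 5) + (T (5 ^ j) + T (5 ^ j))"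
      using T_add[of 5 "5 ^ j"] by (simp add: add_ac)
    then show ?case unfolding Suc.IH using rr' by simp
  qed (simp add: X1)
  then have "T (-3) + T (-3) = T 5 + T 5" using T_cong[OF _ i] \<open>odd i\<close> by simp
  ultimately have X5: "T 5 + T 5 = 0" and r0: "r = 0"
    using X3 Xr by simp_all
  obtain v :: int where v: "[5 * v = 1] (mod 2 ^ k)"
    using cong_solve_coprime_int[of 5 "2 ^ k"] by auto
  have ov: "odd v" using odd_cong[OF cong_sym[OF v]] by simp
  have "T 5 + T v = 0" using T_cong[OF _ v] T_add[of 5 v] ov X1 by simp
  then have "T v = - T 5" by (simp add: eq_neg_iff_add_eq_0 add.commute)
  then have "T v + T v = - (T 5 + T 5)" by simp
  then have Tv: "T v + T v = 0" using X5 by simp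
  have "[v + 4 * v = 1] (mod 2 ^ k)" using v by simp
  then have "L v v = 0" using steinberg4[OF ov ov] unfolding Tv by simp
  moreover have "L v 5 + L v v = 0"
    using cong[OF ov _ v] add[of v 5 v] one[OF ov] ov by simp
  moreover have "L 5 5 + L 5 v = 0"
    using cong[of 5, OF _ _ v] add[of 5 5 v] one[of 5] ov by simp
  moreover have "L v 5 = - L 5 v" by (rule antisym) (use ov in auto)
  ultimately have L55: "L 5 5 = 0" by simp
  have pow_form: "\<exists>i. [y = 5 ^ i] (mod 2 ^ k) \<or> [y = 5 ^ i * (-1)] (mod 2 ^ k)" if "odd y" for y :: int
  proof -
    have "y mod 4 = 1 \<or> (- y) mod 4 = 1" using that by presburger
    then obtain z where z: "[z = 1] (mod 4)" "z = y \<or> y = - z" by (force simp: cong_def)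
    then obtain i where "[z = 5 ^ i] (mod 2 ^ k)" using cong_power_of_five[of z k] k by auto
    then show ?thesis using z(2) cong_minus_minus_iff[of z "5^i"] by auto
  qed
  have extend: "L z y = 0" if z: "odd z" "L z 5 = 0" "L z (-1) = 0" and y: "odd y" for z y
  proof -
    have p: "L z (5 ^ i) = 0" for i
      by (induction i) (use z in \<open>auto simp: one add\<close>)
    have "L z (5 ^ i * (-1)) = 0" for i using add[of z "5 ^ i" "-1"] p z by simp
    then show ?thesis using pow_form[OF y] cong[OF z(1) y] p by auto
  qed
  have L5: "L 5 z = 0" and Lm: "L (-1) z = 0" if "odd z" for z
    using extend[of 5 z] extend[of "-1" z] that L55 r0 neg antisym[of "-1" 5] by (auto simp: r_def)
  show ?thesis
    using extend[OF xy(1) _ _ xy(2)] antisym[OF xy(1), of 5] antisym[OF xy(1), of "-1"] L5 Lm xy by simp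
qed

section \<open>Mennicke symbols\<close>

lemma coprime_of_cong_one: "[a = 1] (mod m) \<Longrightarrow> coprime a (m::int)"
  using cong_imp_coprime[of 1 a m] by (simp add: cong_sym)

lemma crt_int:
  fixes a b :: int
  assumes "coprime a b"
  obtains x where "[x = u] (mod a)" "[x = v] (mod b)"
  using binary_chinese_remainder_int[OF assms, of u v] by blast

lemma cong_imp_eq_add: "[a = b] (mod m) \<Longrightarrow> \<exists>t. a = b + t * (m::int)"
  by (metis cong_iff_lin cong_sym mult.commute)

lemma coprime_add_mult_iff: "coprime a (b + t * a) \<longleftrightarrow> coprime a (b::int)"
  by (metis add.commute coprime_iff_gcd_eq_1 gcd_add_mult mult.commute)

text \<open>
  A Mennicke symbol of level \<open>m\<close>, in additive notation: it depends on the first row \<open>(a, b)\<close> of a matrix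
  in the principal congruence subgroup of \<open>SL(2, \<int>)\<close>. Multiplicativity is required in the first
  argument only; for the second it will follow from a symmetry.
\<close>

locale mennicke_symbol =
  fixes m :: int and s :: "int \<Rightarrow> int \<Rightarrow> 'g::ab_group_add"
  assumes m_gt_1: "m > 1"
    and shift_first: "\<And>a b t. [a = 1] (mod m) \<Longrightarrow> m dvd b \<Longrightarrow> coprime a b \<Longrightarrow> s (a + t * b) b = s a b"
    and shift_second: "\<And>a b t. [a = 1] (mod m) \<Longrightarrow> m dvd b \<Longrightarrow> coprime a b \<Longrightarrow> s a (b + t * m * a) = s a b"
    and mult_first: "\<And>a a' b. [a = 1] (mod m) \<Longrightarrow> [a' = 1] (mod m) \<Longrightarrow> m dvd b \<Longrightarrow>
      coprime a b \<Longrightarrow> coprime a' b \<Longrightarrow> s (a * a') b = s a b + s a' b"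
    and neg_second: "\<And>a b. [a = 1] (mod m) \<Longrightarrow> m dvd b \<Longrightarrow> coprime a b \<Longrightarrow> s a (- b) = s a b"
begin

text \<open>
  The symbol for an arbitrary second argument prime to \<open>a\<close>: since \<open>a\<close> is prime to \<open>m\<close>, the residue class
  of \<open>b\<close> modulo \<open>a\<close> contains multiples of \<open>m\<close>, for instance \<open>b (1 - a)\<close>, and they all give the same value.
\<close>

definition B :: "int \<Rightarrow> int \<Rightarrow> 'g" where
  "B a b = s a (b * (1 - a))"

lemma one_minus: "[a = 1] (mod m) \<Longrightarrow> m dvd 1 - a"
  by (metis cong_iff_dvd_diff cong_sym)

lemma coprime_one_minus: "coprime a (1 - a)" for a :: int
  using coprime_add_mult_iff[of a 1 "-1"] by simp

lemma B_eq_s: "s a b = B a b" if "[a = 1] (mod m)" "m dvd b" "coprime a b"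
proof -
  obtain c where "b = m * c" using \<open>m dvd b\<close> by (elim dvdE)
  then have "b * (1 - a) = b + (- c) * m * a" by (simp add: algebra_simps)
  then show ?thesis unfolding B_def using shift_second[OF that, of "- c"] by simp
qed

lemma B_periodic:
  assumes "[a = 1] (mod m)" "coprime a b" "[b' = b] (mod a)"
  shows "B a b' = B a b"
proof -
  obtain t where t: "b' = b + a * t" using assms(3) by (metis cong_iff_lin cong_sym)
  obtain c where c: "1 - a = m * c" using one_minus[OF assms(1)] by (elim dvdE)
  have "b' * (1 - a) = b * (1 - a) + (t * c) * m * a" unfolding t c by (simp add: algebra_simps)
  then show ?thesis unfolding B_def
    using shift_second[OF assms(1), of "b * (1 - a)" "t * c"] assms coprime_one_minus one_minus by simp
qed

lemma B_neg: "[a = 1] (mod m) \<Longrightarrow> coprime a b \<Longrightarrow> B a (- b) = B a b"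
  using neg_second[of a "b * (1 - a)"] one_minus coprime_one_minus by (simp add: B_def)

lemma B_one_left: "B 1 b = 0"
  using mult_first[of 1 1 0] by (simp add: B_def)

text \<open>
  Both sides are equal to the symbol with second argument \<open>b - a\<close>, a multiple of \<open>m\<close>; adding it to the
  first argument exchanges \<open>a\<close> and \<open>b\<close>. The invariance under a change of sign absorbs the sign of \<open>a\<close>.
\<close>

lemma B_sym:
  assumes "[a = 1] (mod m)" "[b = 1] (mod m)" "coprime a b"
  shows "B a b = B b a"
proof -
  have d: "m dvd b - a" using assms by (metis cong_iff_dvd_diff cong_sym cong_trans)
  have c: "coprime a (b - a)" "coprime b (b - a)"
    using assms(3) coprime_add_mult_iff[of a b "-1"] coprime_add_mult_iff[of b "-a" "1"]
    by (simp_all add: coprime_commute)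
  have "B a b = B a (b - a)"
    by (rule B_periodic[OF assms(1) c(1)]) (simp add: cong_iff_dvd_diff)
  also have "\<dots> = s a (b - a)" by (rule B_eq_s[OF assms(1) d c(1), symmetric])
  also have "\<dots> = s (a + 1 * (b - a)) (b - a)" by (rule shift_first[OF assms(1) d c(1), symmetric])
  also have "\<dots> = s b (b - a)" by simp
  also have "\<dots> = B b (b - a)" by (rule B_eq_s[OF assms(2) d c(2)])
  also have "\<dots> = B b (- a)"
    by (rule B_periodic[OF assms(2)]) (use assms(3) in \<open>auto simp: coprime_commute cong_iff_dvd_diff\<close>)
  also have "\<dots> = B b a" by (rule B_neg[OF assms(2)]) (use assms(3) in \<open>simp add: coprime_commute\<close>)
  finally show ?thesis .
qed

lemma obtain_multiple:
  assumes "[a = 1] (mod m)"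
  obtains b' where "[b' = b] (mod a)" "m dvd b'"
proof (rule that[of "b * (1 - a)"])
  show "[b * (1 - a) = b] (mod a)" by (simp add: cong_iff_dvd_diff algebra_simps)
qed (use one_minus[OF assms] in simp)

lemma obtain_unit_rep:
  assumes "coprime a n"
  obtains b' where "[b' = b] (mod a)" "[b' = 1] (mod (n::int))"
  using crt_int[OF assms] by metis

lemma coprime_cong: "[b' = b] (mod a) \<Longrightarrow> coprime a b \<Longrightarrow> coprime a (b'::int)"
  by (metis cong_imp_coprime cong_sym coprime_commute)

lemma B_mult_left:
  assumes "[a = 1] (mod m)" "[a' = 1] (mod m)" "coprime a b" "coprime a' b"
  shows "B (a * a') b = B a b + B a' b"
proof -
  have aa: "[a * a' = 1] (mod m)" using cong_mult[OF assms(1,2)] by simp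
  obtain b' where b': "[b' = b] (mod a * a')" "m dvd b'" using obtain_multiple[OF aa] .
  have b1: "[b' = b] (mod a)" "[b' = b] (mod a')" by (rule cong_dvd_modulus[OF b'(1)]; simp)+
  have c: "coprime a b'" "coprime a' b'" using b1 assms coprime_cong by blast+
  have cc: "coprime (a * a') b" "coprime (a * a') b'" using assms c by simp_all
  have "B (a * a') b = B (a * a') b'" by (rule B_periodic[OF aa cc(1) b'(1), symmetric])
  also have "\<dots> = s (a * a') b'" by (rule B_eq_s[OF aa b'(2) cc(2), symmetric])
  also have "\<dots> = s a b' + s a' b'" by (rule mult_first[OF assms(1,2) b'(2) c])
  also have "s a b' = B a b'" by (rule B_eq_s[OF assms(1) b'(2) c(1)])
  also have "\<dots> = B a b" by (rule B_periodic[OF assms(1,3) b1(1)])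
  also have "s a' b' = B a' b'" by (rule B_eq_s[OF assms(2) b'(2) c(2)])
  also have "\<dots> = B a' b" by (rule B_periodic[OF assms(2,4) b1(2)])
  finally show ?thesis .
qed

text \<open>
  Every class modulo \<open>a\<close> has a representative congruent to 1 modulo \<open>m\<close>, for which the symmetry turns
  multiplicativity in the first argument into multiplicativity in the second.
\<close>

lemma B_mult_right:
  assumes "[a = 1] (mod m)" "coprime a b" "coprime a b'"
  shows "B a (b * b') = B a b + B a b'"
proof -
  have am: "coprime a m" using coprime_of_cong_one assms(1) .
  obtain c where c: "[c = b] (mod a)" "[c = 1] (mod m)" using obtain_unit_rep[OF am] .
  obtain c' where c': "[c' = b'] (mod a)" "[c' = 1] (mod m)" using obtain_unit_rep[OF am] .
  have ac: "coprime a c" "coprime a c'" using assms c c' coprime_cong by blast+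
  have cc: "[c * c' = 1] (mod m)" using cong_mult[OF c(2) c'(2)] by simp
  have "B a (b * b') = B a (c * c')"
    by (rule B_periodic[OF assms(1) _ cong_mult[OF c(1) c'(1)], symmetric]) (use assms in simp)
  also have "\<dots> = B (c * c') a" by (rule B_sym[OF assms(1) cc]) (use ac in simp)
  also have "\<dots> = B c a + B c' a"
    by (rule B_mult_left[OF c(2) c'(2)]) (use ac in \<open>simp_all add: coprime_commute\<close>)
  also have "B c a = B a c" by (rule B_sym[OF assms(1) c(2) ac(1), symmetric])
  also have "\<dots> = B a b" by (rule B_periodic[OF assms(1,2) c(1)])
  also have "B c' a = B a c'" by (rule B_sym[OF assms(1) c'(2) ac(2), symmetric])
  also have "\<dots> = B a b'" by (rule B_periodic[OF assms(1,3) c'(1)])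
  finally show ?thesis .
qed

lemma B_one_right: "[a = 1] (mod m) \<Longrightarrow> B a 1 = 0"
  using B_mult_right[of a 1 1] by simp

lemma B_level: "B a m = 0" if "[a = 1] (mod m)"
proof -
  have c: "coprime a m" using that coprime_of_cong_one by blast
  from cong_imp_eq_add[OF that] obtain t where t: "a = 1 + t * m" by blast
  have "B a m = s a m" by (rule B_eq_s[OF that _ c, symmetric]) simp
  also have "\<dots> = s 1 m" unfolding t by (rule shift_first) simp_all
  also have "\<dots> = B 1 m" by (rule B_eq_s) simp_all
  also have "\<dots> = 0" by (rule B_one_left)
  finally show ?thesis .
qed

text \<open>
  \<open>B a b\<close> and \<open>B a (b m)\<close> agree because \<open>B a m\<close> vanishes, and for the multiple \<open>b m\<close> of \<open>m\<close> this is a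
  defining property of the symbol.
\<close>

lemma B_shift_left:
  assumes "[a = 1] (mod m)" "coprime a b"
  shows "B (a + t * b * m) b = B a b"
proof -
  have am: "coprime a m" using assms coprime_of_cong_one by blast
  have a': "[a + t * b * m = 1] (mod m)" using assms(1) by (simp add: cong_def)
  have c: "coprime (a + t * b * m) b" 
    using coprime_add_mult_iff[of b a "t * m"] assms(2) by (simp add: coprime_commute mult_ac)
  have c': "coprime (a + t * b * m) m" using coprime_of_cong_one[OF a'] .
  have eq: "a + t * b * m = a + t * (b * m)" by simp
  have cm: "coprime a (b * m)" "coprime (a + t * b * m) (b * m)" using assms am c c' by simp_all
  have "B (a + t * b * m) (b * m) = s (a + t * b * m) (b * m)"
    by (rule B_eq_s[OF a' _ cm(2), symmetric]) simp
  also have "\<dots> = s a (b * m)" unfolding eq by (rule shift_first[OF assms(1) _ cm(1)]) simp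
  also have "\<dots> = B a (b * m)" by (rule B_eq_s[OF assms(1) _ cm(1)]) simp
  finally have "B (a + t * b * m) (b * m) = B a (b * m)" .
  then show ?thesis
    using B_mult_right[OF a' c c'] B_mult_right[OF assms am] B_level[OF a'] B_level[OF assms(1)] by simp
qed

text \<open>
  The cube leaves room for the three things that are needed below: symbols with first argument congruent
  to 1 modulo \<open>M\<close> still represent all symbols, the primes dividing \<open>m\<close> have trivial symbols for such an
  argument, and 8 divides \<open>M\<close> if 2 divides \<open>m\<close>.
\<close>

definition M :: int where "M = m ^ 3"

lemma m_dvd_M: "m dvd M" by (simp add: M_def)

lemma cong_M_imp_m: "[a = b] (mod M) \<Longrightarrow> [a = b] (mod m)"
  using cong_dvd_modulus m_dvd_M by blast

lemma coprime_M_iff: "coprime a M \<longleftrightarrow> coprime a m"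
  by (simp add: M_def)

lemma B_small_prime: "B a q = 0" if "[a = 1] (mod M)" "q dvd m"
proof -
  have "m * q dvd M" using that(2) by (simp add: M_def power3_eq_cube mult_dvd_mono)
  then have "[a = 1] (mod m * q)" using that cong_dvd_modulus by blast
  then obtain t where "a = 1 + t * (m * q)" using cong_imp_eq_add by blast
  then have "a = 1 + t * q * m" by simp
  then show ?thesis using B_shift_left[of 1 q t] B_one_left by simp
qed

end

section \<open>Extension to first arguments prime to the level\<close>

text \<open>
  Prescribe the value 1 modulo all primes that divide \<open>z\<close> but not \<open>n\<close>. This elementary fact replaces
  Dirichlet's theorem on primes in arithmetic progressions in the whole argument.
\<close>

lemma cong_class_coprime_rep:
  fixes u n z :: int
  assumes "coprime u n" "z \<noteq> 0"
  obtains x where "[x = u] (mod n)" "coprime x z"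
proof -
  define h where "h = \<Prod>{p \<in> prime_factors z. \<not> p dvd n}"
  have "coprime n h" unfolding h_def
    by (rule prod_coprime_right) (auto simp: coprime_commute intro!: prime_imp_coprime)
  then obtain x where x: "[x = u] (mod n)" "[x = 1] (mod h)" using crt_int by metis
  have "coprime x z"
  proof (rule ccontr)
    assume "\<not> coprime x z"
    then obtain c where c: "c dvd x" "c dvd z" "\<not> is_unit c" by (rule not_coprimeE)
    then have "c \<noteq> 0" using assms(2) by auto
    then obtain p where p0: "prime p" "p dvd c" using prime_divisor_exists c(3) by blast
    then have p: "prime p" "p dvd x" "p dvd z" using c dvd_trans by blast+
    show False
    proof (cases "p dvd n")
      case True
      then have "p dvd u" using p(2) cong_dvd_iff[OF cong_dvd_modulus[OF x(1) True]] by simp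
      then show False using assms(1) True p(1) not_coprimeI not_prime_unit by blast
    next
      case False
      then have "p dvd h" unfolding h_def
        using p assms(2) by (intro dvd_prod_eqI[where a = p]) (auto simp: prime_factors_dvd)
      then have "p dvd 1" using p(2) cong_dvd_iff[OF cong_dvd_modulus[OF x(2)]] by simp
      then show False using p(1) not_prime_unit by blast
    qed
  qed
  with x(1) show thesis by (rule that)
qed

lemma cong_mult_coprime: 
  fixes a b :: int
  shows "[x = y] (mod a) \<Longrightarrow> [x = y] (mod b) \<Longrightarrow> coprime a b \<Longrightarrow> [x = y] (mod a * b)"
  by (simp add: coprime_cong_mult)

context mennicke_symbol
begin

lemma unit_neq_0: "coprime a m \<Longrightarrow> a \<noteq> 0"
  using m_gt_1 by auto

lemma coprime_M: "coprime a m \<Longrightarrow> coprime a M"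
  by (simp add: coprime_M_iff)

lemma coprime_m_of_cong: "[a = b] (mod M) \<Longrightarrow> coprime b m \<Longrightarrow> coprime a m"
  using coprime_cong[of a b m] cong_M_imp_m by (simp add: coprime_commute)

lemma coprime_m_of_inverse: "[a * b = 1] (mod M) \<Longrightarrow> coprime b m"
  using coprime_of_cong_one[of "a * b" m] cong_M_imp_m by simp

definition W_witness :: "int \<Rightarrow> int \<Rightarrow> int \<Rightarrow> int \<Rightarrow> bool" where
  "W_witness a b a' b' \<longleftrightarrow> coprime a a' \<and> [a * a' = 1] (mod M) \<and> [b' = b] (mod a) \<and> [b' = 1] (mod a')"

text \<open>
  The symbol extended to all first arguments prime to \<open>m\<close>. The number \<open>a\<close> is completed by a factor \<open>a'\<close>
  to a product congruent to 1 modulo \<open>M\<close>, and the second argument is made congruent to 1 modulo \<open>a'\<close>, so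
  that only \<open>a\<close> contributes. If \<open>a\<close> is a prime, this is a character of the units modulo \<open>a\<close>.
\<close>

definition W :: "int \<Rightarrow> int \<Rightarrow> 'g" where
  "W a b = (SOME x. \<exists>a' b'. W_witness a b a' b' \<and> x = B (a * a') b')"

lemma inverse_exists:
  assumes "coprime a m" "coprime c a"
  obtains a' where "[a * a' = 1] (mod M)" "[a' = 1] (mod a)"
proof -
  obtain a0 where a0: "[a * a0 = 1] (mod M)"
    using cong_solve_coprime_int[of a M] coprime_M assms by blast
  obtain x where x: "[x = a0] (mod M)" "[x = 1] (mod a)"
    using crt_int[of M a] coprime_M assms(1) coprime_commute by metis
  show thesis
    by (rule that[OF _ x(2)]) (use cong_trans[OF cong_scalar_left[OF x(1)] a0] in simp)
qed

lemma W_witness_exists: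
  assumes "coprime a m"
  obtains a' b' where "W_witness a b a' b'"
proof -
  obtain a' where a': "[a * a' = 1] (mod M)" "[a' = 1] (mod a)"
    using inverse_exists[of a 1] assms by auto
  have c: "coprime a a'" using coprime_of_cong_one[OF a'(2)] by (simp add: coprime_commute)
  obtain b' where "[b' = b] (mod a)" "[b' = 1] (mod a')" using crt_int[OF c] by metis
  then show thesis using that a' c unfolding W_witness_def by blast
qed

text \<open>
  Two completing factors are compared through a third factor \<open>e\<close> in the class of \<open>a\<close>, prime to all of them.
\<close>

lemma W_witness_unique:
  assumes a: "coprime a m" "coprime a b" and w: "W_witness a b a' b'" "W_witness a b a'' b''"
  shows "B (a * a') b' = B (a * a'') b''"
proof -
  note w1 = w(1)[unfolded W_witness_def] and w2 = w(2)[unfolded W_witness_def]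
  have u: "coprime a' m" "coprime a'' m" using w1 w2 coprime_m_of_inverse by blast+
  have "a * a' * a'' \<noteq> 0" using a(1) u unit_neq_0 by simp
  \<comment> \<open>\<open>a a' (a'' e)\<close> and \<open>a a'' (a' e)\<close> are the same number, and \<open>a'' e\<close>, \<open>a' e\<close> contribute nothing\<close>
  then obtain e where e: "[e = a] (mod M)" "coprime e (a * a' * a'')"
    using cong_class_coprime_rep[OF coprime_M[OF a(1)]] by blast
  define f where "f = a' * a'' * e"
  have af: "coprime a f" using e(2) w1 w2 by (simp add: f_def coprime_commute)
  obtain x where x: "[x = b] (mod a)" "[x = 1] (mod f)" using crt_int[OF af] by metis
  have xf: "[x = 1] (mod a')" "[x = 1] (mod a'')" "[x = 1] (mod e)"
    by (rule cong_dvd_modulus[OF x(2)]; simp add: f_def)+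
  have half: "B (a * a' * (a'' * e)) x = B (a * a') b'"
    if v: "W_witness a b a' b'" and v2: "[a * a'' = 1] (mod M)" and e2: "coprime a'' e"
      and x2: "[x = 1] (mod a')" "[x = 1] (mod a'')" for a' a'' b'
  proof -
    note v' = v[unfolded W_witness_def]
    have c1: "[a * a' = 1] (mod m)" using v' cong_M_imp_m by blast
    have "[a'' * e = a'' * a] (mod M)" using e(1) by (rule cong_scalar_left)
    also have "[a'' * a = 1] (mod M)" using v2 by (simp add: mult.commute)
    finally have c2: "[a'' * e = 1] (mod m)" by (rule cong_M_imp_m)
    have x3: "[x = 1] (mod a'' * e)" using x2 xf(3) e2 by (intro cong_mult_coprime)
    have "[x = b] (mod a)" "[b = b'] (mod a)" using x(1) v' by (auto simp: cong_sym)
    then have xb: "[x = b'] (mod a)" by (rule cong_trans)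
    have "[x = b'] (mod a')" using x2(1) v' by (meson cong_sym cong_trans)
    with xb have x4: "[x = b'] (mod a * a')" using v' by (intro cong_mult_coprime) auto
    have cx: "coprime (a * a') x" "coprime (a * a') b'" 
    proof -
      have "coprime a x" using coprime_cong[OF x(1) a(2)] .
      moreover have "coprime a' x" using coprime_of_cong_one[OF x2(1)] by (simp add: coprime_commute)
      ultimately show "coprime (a * a') x" by simp
      then show "coprime (a * a') b'" using coprime_cong[OF cong_sym[OF x4]] by blast
    qed
    have cy: "coprime (a'' * e) x" using coprime_of_cong_one[OF x3] by (simp add: coprime_commute)
    have "B (a * a' * (a'' * e)) x = B (a * a') x + B (a'' * e) x"
      by (rule B_mult_left[OF c1 c2 cx(1) cy])
    also have "B (a * a') x = B (a * a') b'" by (rule B_periodic[OF c1 cx(2) x4])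
    also have "B (a'' * e) x = B (a'' * e) 1" by (rule B_periodic[OF c2 _ x3]) simp
    finally show ?thesis using B_one_right[OF c2] by simp
  qed
  have "coprime a'' e" "coprime a' e" using e(2) by (simp_all add: coprime_commute)
  then have "B (a * a' * (a'' * e)) x = B (a * a') b'" "B (a * a'' * (a' * e)) x = B (a * a'') b''"
    using half[OF w(1)] half[OF w(2)] w1 w2 xf by blast+
  moreover have "a * a' * (a'' * e) = a * a'' * (a' * e)" by simp
  ultimately show ?thesis by simp
qed

lemma W_eq:
  assumes "coprime a m" "coprime a b" "coprime a a'" "[a * a' = 1] (mod M)" "[b' = b] (mod a)" "[b' = 1] (mod a')"
  shows "W a b = B (a * a') b'"
proof -
  have w: "W_witness a b a' b'" using assms by (simp add: W_witness_def)
  have "\<exists>a' b'. W_witness a b a' b' \<and> W a b = B (a * a') b'"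
    unfolding W_def by (rule someI_ex) (use w in blast)
  then show ?thesis using W_witness_unique[OF assms(1,2) w] by metis
qed

lemma W_eq_B: "[a = 1] (mod M) \<Longrightarrow> coprime a b \<Longrightarrow> W a b = B a b"
  using W_eq[of a b 1 b] coprime_of_cong_one[OF cong_M_imp_m] by simp

lemma W_periodic:
  assumes "coprime a m" "coprime a b" "[b' = b] (mod a)"
  shows "W a b' = W a b"
proof -
  have c: "coprime a b'" using coprime_cong assms by blast
  obtain a' x where "W_witness a b a' x" using W_witness_exists assms by metis
  note w = this[unfolded W_witness_def]
  have "[x = b'] (mod a)" using w assms(3) by (meson cong_sym cong_trans)
  then show ?thesis using W_eq[of a b a' x] W_eq[of a b' a' x] w assms c by simp
qed

lemma W_mult_right:
  assumes "coprime a m" "coprime a b" "coprime a b'"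
  shows "W a (b * b') = W a b + W a b'"
proof -
  obtain a' where a': "[a * a' = 1] (mod M)" "[a' = 1] (mod a)"
    using inverse_exists[of a 1] assms by auto
  have c: "coprime a a'" using coprime_of_cong_one[OF a'(2)] by (simp add: coprime_commute)
  obtain x where x: "[x = b] (mod a)" "[x = 1] (mod a')" using crt_int[OF c] by metis
  obtain y where y: "[y = b'] (mod a)" "[y = 1] (mod a')" using crt_int[OF c] by metis
  have xy: "[x * y = b * b'] (mod a)" "[x * y = 1] (mod a')"
    using cong_mult[OF x(1) y(1)] cong_mult[OF x(2) y(2)] by simp_all
  have cx: "coprime (a * a') x" "coprime (a * a') y"
    using coprime_cong[OF x(1) assms(2)] coprime_cong[OF y(1) assms(3)]
      coprime_of_cong_one[OF x(2)] coprime_of_cong_one[OF y(2)] by (simp_all add: coprime_commute)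
  have "W a (b * b') = B (a * a') (x * y)"
    by (rule W_eq[OF assms(1) _ c a'(1) xy]) (use assms in simp)
  also have "\<dots> = B (a * a') x + B (a * a') y"
    by (rule B_mult_right[OF cong_M_imp_m[OF a'(1)] cx])
  also have "B (a * a') x = W a b" by (rule W_eq[OF assms(1,2) c a'(1) x, symmetric])
  also have "B (a * a') y = W a b'" by (rule W_eq[OF assms(1,3) c a'(1) y, symmetric])
  finally show ?thesis .
qed

lemma W_mult_left:
  assumes "coprime a m" "coprime b m" "coprime a x" "coprime b x"
  shows "W (a * b) x = W a x + W b x"
proof -
  have ab: "coprime (a * b) m" using assms by simp
  have nz: "a * b \<noteq> 0" using unit_neq_0[OF ab] .
  obtain a0 where a0: "[a * a0 = 1] (mod M)" using cong_solve_coprime_int[of a M] coprime_M assms by blast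
  obtain b0 where b0: "[b * b0 = 1] (mod M)" using cong_solve_coprime_int[of b M] coprime_M assms by blast
  have "coprime a0 M" "coprime b0 M" using coprime_m_of_inverse a0 b0 coprime_M by blast+
  then obtain a' b' where a': "[a' = a0] (mod M)" "coprime a' (a * b)" and b': "[b' = b0] (mod M)" "coprime b' (a * b)"
    using cong_class_coprime_rep nz by metis
  have aa: "[a * a' = 1] (mod M)" using cong_trans[OF cong_scalar_left[OF a'(1)] a0] .
  have bb: "[b * b' = 1] (mod M)" using cong_trans[OF cong_scalar_left[OF b'(1)] b0] .
  have "[(a * a') * (b * b') = 1 * 1] (mod M)" using aa bb by (rule cong_mult)
  then have abab: "[(a * b) * (a' * b') = 1] (mod M)" by (simp add: mult_ac)
  have c: "coprime (a * b) (a' * b')" using a' b' by (simp add: coprime_commute)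
  obtain y where y: "[y = x] (mod a * b)" "[y = 1] (mod a' * b')" using crt_int[OF c] by metis
  have ya: "[y = x] (mod a)" "[y = x] (mod b)" by (rule cong_dvd_modulus[OF y(1)]; simp)+
  have ya': "[y = 1] (mod a')" "[y = 1] (mod b')" by (rule cong_dvd_modulus[OF y(2)]; simp)+
  have cy: "coprime (a * a') y" "coprime (b * b') y"
    using coprime_cong[OF ya(1) assms(3)] coprime_cong[OF ya(2) assms(4)]
      coprime_of_cong_one[OF ya'(1)] coprime_of_cong_one[OF ya'(2)] by (simp_all add: coprime_commute)
  have "W (a * b) x = B ((a * b) * (a' * b')) y"
    by (rule W_eq[OF ab _ c abab y]) (use assms in simp)
  also have "(a * b) * (a' * b') = (a * a') * (b * b')" by simp
  also have "B \<dots> y = B (a * a') y + B (b * b') y"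
    by (rule B_mult_left[OF cong_M_imp_m[OF aa] cong_M_imp_m[OF bb] cy])
  also have "B (a * a') y = W a x"
    by (rule W_eq[OF assms(1,3) _ aa ya(1) ya'(1), symmetric]) (use a' in \<open>simp add: coprime_commute\<close>)
  also have "B (b * b') y = W b x"
    by (rule W_eq[OF assms(2,4) _ bb ya(2) ya'(2), symmetric]) (use b' in \<open>simp add: coprime_commute\<close>)
  finally show ?thesis .
qed

lemma W_one_right: "coprime a m \<Longrightarrow> W a 1 = 0"
  using W_mult_right[of a 1 1] by simp

lemma W_cong_one: "coprime a m \<Longrightarrow> [b = 1] (mod a) \<Longrightarrow> W a b = 0"
  using W_periodic[of a 1 b] W_one_right by simp

lemma W_unit_left: "is_unit a \<Longrightarrow> W a b = 0"
proof -
  assume a: "is_unit a"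
  then have c: "coprime a z" for z by (rule is_unit_left_imp_coprime)
  have "[b = 1] (mod a)" using a by (simp add: cong_iff_dvd_diff unit_imp_dvd)
  then show ?thesis by (rule W_cong_one[OF c])
qed

end

section \<open>The defect of reciprocity\<close>

context mennicke_symbol
begin

text \<open>
  Choose the auxiliary second argument congruent to 1 modulo \<open>M\<close> as well; then the symmetry of \<open>B\<close> applies,
  and the factor \<open>a'\<close> contributes the symbol of an argument that is 1 modulo \<open>a' M\<close>.
\<close>

lemma W_sym_one:
  assumes a: "coprime a m" and b: "[b = 1] (mod M)" and ab: "coprime a b"
  shows "W a b = W b a"
proof -
  obtain a' where a': "[a * a' = 1] (mod M)" "[a' = 1] (mod a)"
    using inverse_exists[of a 1] a by auto
  have c: "coprime a a'" using coprime_of_cong_one[OF a'(2)] by (simp add: coprime_commute)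
  have a'M: "coprime a' M" using coprime_M[OF coprime_m_of_inverse[OF a'(1)]] .
  then have "coprime (a * M) a'" using c by (simp add: coprime_commute)
  then obtain x where x: "[x = b] (mod a * M)" "[x = 1] (mod a')" using crt_int by metis
  have xa: "[x = b] (mod a)" by (rule cong_dvd_modulus[OF x(1)]) simp
  have "[x = b] (mod M)" by (rule cong_dvd_modulus[OF x(1)]) simp
  then have xM: "[x = 1] (mod M)" using b by (rule cong_trans)
  have cx: "coprime a x" "coprime a' x"
    using coprime_cong[OF xa ab] coprime_of_cong_one[OF x(2)] by (simp_all add: coprime_commute)
  note am = cong_M_imp_m[OF a'(1)] and xm = cong_M_imp_m[OF xM] and bm = cong_M_imp_m[OF b]
  have "W a b = B (a * a') x" by (rule W_eq[OF a ab c a'(1) xa x(2)])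
  also have "\<dots> = B x (a * a')" by (rule B_sym[OF am xm]) (use cx in simp)
  also have "\<dots> = B x a + B x a'"
    by (rule B_mult_right[OF xm]) (use cx in \<open>simp_all add: coprime_commute\<close>)
  also have "B x a = B b a"
  proof -
    obtain t where t: "x = b + t * (a * M)" using cong_imp_eq_add[OF x(1)] by blast
    have "x = b + (t * m ^ 2) * a * m" unfolding t by (simp add: M_def power2_eq_square power3_eq_cube)
    then show ?thesis using B_shift_left[OF bm, of a] ab by (simp add: coprime_commute)
  qed
  also have "\<dots> = W b a" by (rule W_eq_B[OF b, symmetric]) (use ab in \<open>simp add: coprime_commute\<close>)
  also have "B x a' = 0"
  proof -
    have "[x = 1] (mod a' * M)" using x(2) xM a'M by (rule cong_mult_coprime)
    from cong_imp_eq_add[OF this] obtain t where t: "x = 1 + t * (a' * M)" by blast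
    have "x = 1 + (t * m ^ 2) * a' * m" unfolding t by (simp add: M_def power2_eq_square power3_eq_cube)
    then show ?thesis using B_shift_left[of 1 a'] B_one_left by simp
  qed
  finally show ?thesis by simp
qed

text \<open>
  Multiplying \<open>b\<close> and \<open>b'\<close> by the same number \<open>e\<close> makes both congruent to 1 modulo \<open>M\<close>, where there is no
  defect; so both defects are the negative of that of \<open>e\<close>.
\<close>

lemma W_defect_cong:
  assumes a: "coprime a m" and b: "coprime b m" and bb: "[b' = b] (mod M)"
    and ab: "coprime a b" "coprime a b'"
  shows "W a b' - W b' a = W a b - W b a"
proof -
  obtain e0 where e0: "[b * e0 = 1] (mod M)" using cong_solve_coprime_int[of b M] coprime_M b by blast
  obtain e where e: "[e = e0] (mod M)" "coprime e a"
    using cong_class_coprime_rep[of e0 M a] coprime_M[OF coprime_m_of_inverse[OF e0]] unit_neq_0[OF a] by metis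
  have be: "[b * e = 1] (mod M)" using cong_trans[OF cong_scalar_left[OF e(1)] e0] .
  have b'e: "[b' * e = 1] (mod M)" using cong_trans[OF cong_scalar_right[OF bb] be] .
  have em: "coprime e m" using coprime_m_of_inverse[OF be] .
  have split: "W a c + W a e = W c a + W e a"
    if c: "coprime a c" "coprime c m" "[c * e = 1] (mod M)" for c
  proof -
    have "W a (c * e) = W (c * e) a"
      by (rule W_sym_one[OF a c(3)]) (use c e in \<open>simp add: coprime_commute\<close>)
    then show ?thesis
      using W_mult_right[OF a c(1), of e] W_mult_left[OF c(2) em, of a] c e by (simp add: coprime_commute)
  qed
  have "W a b + W a e = W b a + W e a" "W a b' + W a e = W b' a + W e a"
    using split ab b be b'e coprime_m_of_cong[OF bb b] by auto
  then have "W a b - W b a = W e a - W a e" "W a b' - W b' a = W e a - W a e"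
    by (metis add_diff_cancel_left' add_diff_cancel_right diff_add_eq diff_diff_eq2 add.commute)+
  then show ?thesis by simp
qed

text \<open>
  The failure of the reciprocity law \<open>W u v = W v u\<close>. By the previous lemma it depends only on the classes
  modulo \<open>M\<close>, which also gives it a meaning for \<open>u\<close> and \<open>v\<close> with a common factor. It plays the part of
  the product of the Hilbert symbols at the primes dividing \<open>m\<close>.
\<close>

definition R :: "int \<Rightarrow> int \<Rightarrow> 'g" where
  "R u v = (let v' = SOME v'. [v' = v] (mod M) \<and> coprime u v' in W u v' - W v' u)"

lemma rep_exists:
  assumes "coprime v m" "u \<noteq> 0"
  obtains v' where "[v' = v] (mod M)" "coprime u v'" "coprime v' m"
proof -
  obtain x where x: "[x = v] (mod M)" "coprime x u"
    using cong_class_coprime_rep[OF coprime_M[OF assms(1)] assms(2)] by blast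
  show thesis by (rule that[OF x(1)]) (use x coprime_m_of_cong[OF x(1) assms(1)] in \<open>simp_all add: coprime_commute\<close>)
qed

lemma R_eq:
  assumes "coprime u m" "coprime v m" "[v' = v] (mod M)" "coprime u v'"
  shows "R u v = W u v' - W v' u"
proof -
  define w where "w = (SOME v'. [v' = v] (mod M) \<and> coprime u v')"
  have w: "[w = v] (mod M) \<and> coprime u w"
    unfolding w_def by (rule someI_ex) (use assms in blast)
  have "[w = v'] (mod M)" using w assms(3) by (meson cong_sym cong_trans)
  then have "W u w - W w u = W u v' - W v' u"
    using W_defect_cong[of u v' w] assms w coprime_m_of_cong by simp
  then show ?thesis by (simp add: R_def w_def)
qed

lemma R_cong_right:
  assumes "coprime u m" "coprime v m" "[v' = v] (mod M)"
  shows "R u v' = R u v"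
proof -
  obtain x where x: "[x = v] (mod M)" "coprime u x"
    using rep_exists[OF assms(2) unit_neq_0[OF assms(1)]] by blast
  have "[x = v'] (mod M)" using x(1) assms(3) by (meson cong_sym cong_trans)
  then show ?thesis using R_eq[OF assms(1,2) x] R_eq[OF assms(1), of v' x] x coprime_m_of_cong assms by simp
qed

lemma R_cong_left:
  assumes "coprime u m" "coprime v m" "[u' = u] (mod M)"
  shows "R u' v = R u v"
proof -
  have u': "coprime u' m" using coprime_m_of_cong assms by blast
  obtain x where x: "[x = v] (mod M)" "coprime (u * u') x" "coprime x m"
    using rep_exists[OF assms(2), of "u * u'"] unit_neq_0 assms(1) u' by (metis mult_eq_0_iff)
  have c: "coprime u x" "coprime u' x" using x(2) by simp_all
  have "W x u' - W u' x = W x u - W u x"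
    by (rule W_defect_cong[OF x(3) assms(1,3)]) (use c in \<open>simp_all add: coprime_commute\<close>)
  then show ?thesis
    unfolding R_eq[OF assms(1,2) x(1) c(1)] R_eq[OF u' assms(2) x(1) c(2)]
    by (metis minus_diff_eq)
qed

lemma R_antisym:
  assumes "coprime u m" "coprime v m"
  shows "R u v = - R v u"
proof -
  obtain x where x: "[x = v] (mod M)" "coprime u x" "coprime x m"
    using rep_exists[OF assms(2) unit_neq_0[OF assms(1)]] by metis
  have "R v u = R x u" using R_cong_left[OF assms(2,1) x(1)] by simp
  also have "\<dots> = W x u - W u x" by (rule R_eq[OF x(3) assms(1)]) (use x in \<open>simp_all add: coprime_commute\<close>)
  finally show ?thesis using R_eq[OF assms x(1,2)] by simp
qed

lemma R_mult_right:
  assumes "coprime u m" "coprime v m" "coprime w m"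
  shows "R u (v * w) = R u v + R u w"
proof -
  obtain x where x: "[x = v] (mod M)" "coprime u x" "coprime x m"
    using rep_exists[OF assms(2) unit_neq_0[OF assms(1)]] by metis
  obtain y where y: "[y = w] (mod M)" "coprime u y" "coprime y m"
    using rep_exists[OF assms(3) unit_neq_0[OF assms(1)]] by metis
  have "R u (v * w) = W u (x * y) - W (x * y) u"
    by (rule R_eq[OF assms(1) _ cong_mult[OF x(1) y(1)]]) (use assms x y in simp_all)
  also have "\<dots> = (W u x + W u y) - (W x u + W y u)"
    using W_mult_right[OF assms(1) x(2) y(2)] W_mult_left[OF x(3) y(3), of u] x y by (simp add: coprime_commute)
  also have "\<dots> = R u v + R u w"
    unfolding R_eq[OF assms(1,2) x(1,2)] R_eq[OF assms(1,3) y(1,2)] by (simp add: algebra_simps)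
  finally show ?thesis .
qed

lemma R_mult_left:
  assumes "coprime u m" "coprime v m" "coprime w m"
  shows "R (v * w) u = R v u + R w u"
proof -
  have "R (v * w) u = - R u (v * w)" by (rule R_antisym) (use assms in simp_all)
  also have "\<dots> = - R u v + - R u w" by (simp add: R_mult_right assms)
  also have "- R u v = R v u" by (rule R_antisym[symmetric]) fact+
  also have "- R u w = R w u" by (rule R_antisym[symmetric]) fact+
  finally show ?thesis .
qed

definition smooth :: "int \<Rightarrow> bool" where
  "smooth D \<longleftrightarrow> D \<noteq> 0 \<and> (\<forall>p. prime p \<longrightarrow> p dvd D \<longrightarrow> p dvd m)"

lemma smooth_mult [simp]: "smooth (D * E) \<longleftrightarrow> smooth D \<and> smooth E"
  by (auto simp: smooth_def prime_dvd_mult_iff)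

lemma smooth_one [simp]: "smooth 1" and smooth_minus_one [simp]: "smooth (-1)"
  using not_prime_unit by (auto simp: smooth_def)

lemma smooth_prime: "prime p \<Longrightarrow> p dvd m \<Longrightarrow> smooth p"
  by (auto simp: smooth_def dest: primes_dvd_imp_eq)

lemma smooth_power: "smooth D \<Longrightarrow> smooth (D ^ n)"
  by (induction n) auto

lemma smooth_dvd: "smooth D \<Longrightarrow> E dvd D \<Longrightarrow> smooth E"
  by (auto simp: smooth_def)

lemma smooth_M: "smooth M"
  using m_gt_1 by (auto simp: smooth_def M_def dest: prime_dvd_power)

lemma coprime_smooth:
  assumes "coprime a m" "smooth D" shows "coprime a D"
proof (rule ccontr)
  assume "\<not> coprime a D"
  then obtain c where c: "c dvd a" "c dvd D" "\<not> is_unit c" by (rule not_coprimeE)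
  then have "c \<noteq> 0" using assms(2) by (auto simp: smooth_def)
  then obtain p where p: "prime p" "p dvd c" using prime_divisor_exists c(3) by blast
  then have "p dvd m" "p dvd a" using c dvd_trans assms(2) by (auto simp: smooth_def)
  then show False using assms(1) p(1) not_coprimeI not_prime_unit by blast
qed

lemma W_smooth_trivial:
  assumes a: "[a = 1] (mod M)" and D: "smooth D"
  shows "W a D = 0"
proof -
  have am: "coprime a m" using coprime_of_cong_one[OF cong_M_imp_m[OF a]] .
  show ?thesis using D
  proof (induction D rule: prime_divisors_induct)
    case zero then show ?case by (simp add: smooth_def)
  next
    case (unit x)
    then have "x = 1 \<or> x = -1" by (auto simp: zdvd1_eq abs_if split: if_splits)
    then show ?case
      using W_one_right[OF am] W_eq_B[OF a, of "-1"] B_neg[OF cong_M_imp_m[OF a], of 1]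
        B_one_right[OF cong_M_imp_m[OF a]] by auto
  next
    case (factor p x)
    then have sm: "smooth p" "smooth x" by simp_all
    then have "p dvd m" using factor.hyps by (auto simp: smooth_def)
    have "W a p = B a p" by (rule W_eq_B[OF a coprime_smooth[OF am sm(1)]])
    also have "\<dots> = 0" by (rule B_small_prime[OF a \<open>p dvd m\<close>])
    finally show ?case using W_mult_right[OF am coprime_smooth[OF am sm(1)] coprime_smooth[OF am sm(2)]]
      factor.IH[OF sm(2)] by simp
  qed
qed

text \<open>
  For second arguments composed of primes dividing \<open>m\<close> the symbol is a character of the units modulo \<open>M\<close>:
  this is the analogue of the supplementary laws of quadratic reciprocity.
\<close>

lemma W_smooth_cong:
  assumes a: "coprime a m" "[a' = a] (mod M)" and D: "smooth D"
  shows "W a' D = W a D"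
proof -
  obtain e where e: "[a * e = 1] (mod M)" using cong_solve_coprime_int[of a M] coprime_M a by blast
  have e': "[a' * e = 1] (mod M)" using cong_trans[OF cong_scalar_right[OF a(2)] e] .
  have u: "coprime e m" "coprime a' m" using coprime_m_of_inverse[OF e] coprime_m_of_cong[OF a(2,1)] .
  have "W (a * e) D = 0" "W (a' * e) D = 0" using W_smooth_trivial e e' D by blast+
  then have "W a D + W e D = 0" "W a' D + W e D = 0"
    using W_mult_left[OF a(1) u(1), of D] W_mult_left[OF u(2,1), of D] coprime_smooth[OF _ D] a u by auto
  then show ?thesis by (metis add_right_cancel)
qed

text \<open>
  \<open>W a (D t)\<close> vanishes because \<open>D t\<close> is 1 modulo \<open>a\<close>, and \<open>W t a\<close> vanishes because \<open>a\<close> is 1 modulo \<open>t\<close>.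
\<close>

lemma steinberg_relation:
  assumes "a + D * t = 1" "coprime a m" "coprime t m" "smooth D"
  shows "W a D + R a t = 0"
proof -
  have D: "D * t = 1 - a" using assms(1) by simp
  have "coprime a (D * t)" unfolding D by (rule coprime_one_minus)
  then have c: "coprime a D" "coprime a t" by simp_all
  have "[D * t = 1] (mod a)" unfolding D by (simp add: cong_iff_dvd_diff)
  then have "W a D + W a t = 0" using W_cong_one[OF assms(2)] W_mult_right[OF assms(2) c] by simp
  moreover have "[a = 1] (mod t)" using assms(1) by (metis cong_iff_dvd_diff dvd_triv_right minus_diff_eq dvd_minus_iff D)
  then have "W t a = 0" by (rule W_cong_one[OF assms(3)])
  ultimately show ?thesis using R_eq[OF assms(2,3) cong_refl c(2)] by simp
qed

end

section \<open>Localization at the primes dividing the level\<close>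

context mennicke_symbol
begin

definition P :: "int \<Rightarrow> int" where "P p = p ^ multiplicity p M"
definition Q :: "int \<Rightarrow> int" where "Q p = M div P p"

text \<open>
  Units modulo \<open>M\<close> that are concentrated at the prime \<open>p\<close>: they are 1 modulo the part of \<open>M\<close> prime to \<open>p\<close>.
\<close>

definition local_unit :: "int \<Rightarrow> int \<Rightarrow> bool" where
  "local_unit p x \<longleftrightarrow> coprime x m \<and> [x = 1] (mod Q p)"

lemma M_pos: "M > 0" using m_gt_1 by (simp add: M_def)

lemma M_eq: "M = P p * Q p"
  unfolding P_def Q_def by (simp add: multiplicity_dvd)

lemma prime_coprime_Q: "prime p \<Longrightarrow> coprime p (Q p)"
proof -
  assume p: "prime p"
  have "\<not> p dvd Q p"
    unfolding Q_def P_def using p M_pos by (intro multiplicity_decompose) auto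
  then show ?thesis using p prime_imp_coprime by blast
qed

lemma coprime_P_Q: "prime p \<Longrightarrow> coprime (P p) (Q p)"
  using prime_coprime_Q by (simp add: P_def)

lemma coprime_Q_P: "prime p \<Longrightarrow> coprime (Q p) (P p)"
  using coprime_P_Q by (simp add: coprime_commute)

lemma smooth_Q: "smooth (Q p)"
  using smooth_dvd[OF smooth_M, of "Q p"] M_eq[of p] by (metis dvd_triv_right)

lemma multiplicity_M_ge_3: "prime p \<Longrightarrow> p dvd m \<Longrightarrow> multiplicity p M \<ge> 3"
proof -
  assume p: "prime p" "p dvd m"
  have "p ^ 3 dvd M" unfolding M_def using p(2) by (rule dvd_power_same)
  then show ?thesis using p M_pos by (intro multiplicity_geI) auto
qed

lemma prime_dvd_P: "prime p \<Longrightarrow> p dvd m \<Longrightarrow> p dvd P p"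
  using multiplicity_M_ge_3[of p] by (simp add: P_def dvd_power)

lemma coprime_P: "coprime y p \<Longrightarrow> coprime y (P p)"
  by (simp add: P_def)

lemma coprime_m_iff_local:
  assumes "prime p" "p dvd m"
  shows "coprime x m \<longleftrightarrow> coprime x p \<and> coprime x (Q p)"
proof -
  have "coprime x m \<longleftrightarrow> coprime x (P p * Q p)" using M_eq coprime_M_iff by metis
  moreover have "multiplicity p M > 0" using multiplicity_M_ge_3[OF assms] by simp
  ultimately show ?thesis by (simp add: P_def)
qed

lemma cong_M_iff:
  assumes "prime p"
  shows "[x = y] (mod M) \<longleftrightarrow> [x = y] (mod P p) \<and> [x = y] (mod Q p)"
  using cong_mult_coprime[of x y "P p" "Q p"] coprime_P_Q[OF assms] M_eq[of p] cong_dvd_modulus[of x y M]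
  by (metis dvd_triv_left dvd_triv_right)

lemma unit_with_residues:
  assumes p: "prime p" "p dvd m" and u: "coprime u p" and w: "coprime w (Q p)"
  obtains x where "[x = u] (mod P p)" "[x = w] (mod Q p)" "coprime x m"
proof -
  obtain x where x: "[x = u] (mod P p)" "[x = w] (mod Q p)" using crt_int[OF coprime_P_Q[OF p(1)]] by metis
  have "coprime p u" "coprime (Q p) w" using u w by (simp_all add: coprime_commute)
  moreover have "[x = u] (mod p)" using cong_dvd_modulus[OF x(1) prime_dvd_P[OF p]] .
  ultimately have "coprime p x" "coprime (Q p) x" using coprime_cong x(2) by blast+
  then have "coprime x m" unfolding coprime_m_iff_local[OF p] by (simp add: coprime_commute)
  with x show thesis by (rule that)
qed

lemma local_unit_exists:
  assumes "prime p" "p dvd m" "coprime u p"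
  obtains x where "[x = u] (mod P p)" "local_unit p x"
  using unit_with_residues[OF assms coprime_1_left] that unfolding local_unit_def by metis

lemma divided_unit_exists:
  assumes p: "prime p" "p dvd m" "coprime y p" and D: "coprime D p"
  obtains t where "[t * D = y] (mod P p)" "coprime t m"
proof -
  obtain e where e: "[D * e = 1] (mod P p)" using cong_solve_coprime_int[of D "P p"] coprime_P[OF D] by blast
  have "coprime e (P p)" using coprime_of_cong_one[OF e] by simp
  then have "coprime e p" using prime_dvd_P[OF p(1,2)] by (metis coprime_divisors dvd_refl)
  then have "coprime (e * y) p" using p(3) by simp
  then obtain t where t: "[t = e * y] (mod P p)" "local_unit p t" using local_unit_exists[OF p(1,2)] by blast
  have "[t * D = (e * y) * D] (mod P p)" using t(1) by (rule cong_scalar_right)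
  also have "(e * y) * D = (D * e) * y" by simp
  also have "[\<dots> = 1 * y] (mod P p)" using e by (rule cong_scalar_right)
  finally have "[t * D = y] (mod P p)" by simp
  then show thesis using that t(2) unfolding local_unit_def by blast
qed

text \<open>
  The class of a local unit \<open>x\<close> at \<open>p\<close> contains \<open>1 - p\<^sup>j D t\<close> for every \<open>D\<close> prime to \<open>p\<close> that is a
  multiple of the part of \<open>M\<close> prime to \<open>p\<close>, if \<open>t\<close> is chosen correctly at \<open>p\<close>; away from \<open>p\<close> it is arbitrary. This freedom in \<open>D\<close> and
  \<open>t\<close> is what separates the primes from each other.
\<close>

lemma local_relation:
  assumes p: "prime p" "p dvd m" and x: "local_unit p x"
    and xy: "[x = 1 - p ^ j * y] (mod P p)"
    and D: "smooth D" "Q p dvd D" and t: "coprime t m" "[t * D = y] (mod P p)"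
  shows "W x (p ^ j) + W x D + R x t = 0"
proof -
  have xm: "coprime x m" and x1: "[x = 1] (mod Q p)" using x by (simp_all add: local_unit_def)
  \<comment> \<open>replace \<open>x\<close> by an integer in its class for which the Steinberg relation is an exact identity\<close>
  define a where "a = 1 - p ^ j * D * t"
  have "[p ^ j * (t * D) = p ^ j * y] (mod P p)" using t(2) by (rule cong_scalar_left)
  then have "[1 - p ^ j * (t * D) = 1 - p ^ j * y] (mod P p)" by (intro cong_diff cong_refl)
  then have "[1 - p ^ j * (t * D) = x] (mod P p)" using xy by (meson cong_sym cong_trans)
  then have "[a = x] (mod P p)" by (simp add: a_def mult_ac)
  moreover have "[a = 1] (mod Q p)" using D(2) by (simp add: a_def cong_iff_dvd_diff)
  then have "[a = x] (mod Q p)" using x1 by (meson cong_sym cong_trans)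
  ultimately have ax: "[a = x] (mod M)" using cong_M_iff[OF p(1)] by blast
  have am: "coprime a m" using coprime_m_of_cong[OF ax xm] .
  have sp: "smooth (p ^ j)" using smooth_power[OF smooth_prime[OF p]] .
  have "W a (p ^ j * D) + R a t = 0"
    by (rule steinberg_relation) (use am t sp D in \<open>simp_all add: a_def\<close>)
  moreover have "W a (p ^ j * D) = W x (p ^ j * D)"
    by (rule W_smooth_cong[OF xm ax]) (use sp D in simp)
  moreover have "R a t = R x t" by (rule R_cong_left[OF xm t(1) ax])
  moreover have "W x (p ^ j * D) = W x (p ^ j) + W x D"
    by (rule W_mult_right[OF xm coprime_smooth[OF xm sp] coprime_smooth[OF xm D(1)]])
  ultimately show ?thesis by simp
qed

text \<open>
  If \<open>x\<close> is 1, take for \<open>j\<close> the full exponent of \<open>p\<close> in \<open>M\<close>; so the same formula covers this case.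
\<close>

lemma local_decomposition:
  assumes p: "prime p"
  obtains j y where "coprime y p" "[x = 1 - p ^ j * y] (mod P p)"
proof (cases "x = 1")
  case True
  show thesis by (rule that[of 1 "multiplicity p M"]) (simp_all add: True P_def cong_iff_dvd_diff)
next
  case False
  then have "1 - x \<noteq> 0" by simp
  moreover have "\<not> is_unit p" using p not_prime_unit by blast
  ultimately obtain y where y: "1 - x = p ^ multiplicity p (1 - x) * y" "\<not> p dvd y"
    by (rule multiplicity_decompose')
  have "x = 1 - p ^ multiplicity p (1 - x) * y" using y(1) by simp
  then show thesis
    using that[of y "multiplicity p (1 - x)"] prime_imp_coprime[OF p y(2)] by (simp add: coprime_commute)
qed

text \<open>
  In the local relation \<open>t\<close> is arbitrary away from \<open>p\<close>; comparing two choices shows that \<open>R x\<close> has no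
  component at the other primes.
\<close>

lemma R_local_one:
  assumes p: "prime p" "p dvd m" and x: "local_unit p x" and z: "coprime z m" "[z = 1] (mod P p)"
  shows "R x z = 0"
proof -
  have xm: "coprime x m" using x by (simp add: local_unit_def)
  obtain j y where jy: "coprime y p" "[x = 1 - p ^ j * y] (mod P p)" using local_decomposition[OF p(1)] .
  have "coprime (Q p) p" using prime_coprime_Q[OF p(1)] by (simp add: coprime_commute)
  then obtain t where t: "[t * Q p = y] (mod P p)" "coprime t m"
    using divided_unit_exists[OF p jy(1)] by blast
  have "[z * (t * Q p) = 1 * y] (mod P p)" using z(2) t(1) by (rule cong_mult)
  then have t': "[(t * z) * Q p = y] (mod P p)" by (simp add: mult_ac)
  have 1: "W x (p ^ j) + W x (Q p) + R x t = 0"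
    by (rule local_relation[OF p x jy(2) smooth_Q dvd_refl t(2,1)])
  have "R x z = (W x (p ^ j) + W x (Q p) + R x t) + R x z" unfolding 1 by simp
  also have "\<dots> = W x (p ^ j) + W x (Q p) + R x (t * z)"
    using R_mult_right[OF xm t(2) z(1)] by (simp add: add.assoc)
  also have "\<dots> = 0"
    by (rule local_relation[OF p x jy(2) smooth_Q dvd_refl _ t']) (use t z in simp)
  finally show ?thesis .
qed

lemma R_local_cong:
  assumes p: "prime p" "p dvd m" and x: "local_unit p x"
    and z: "coprime z m" "coprime z' m" "[z' = z] (mod P p)"
  shows "R x z' = R x z"
proof -
  have xm: "coprime x m" using x by (simp add: local_unit_def)
  obtain e where e: "[z * e = 1] (mod M)" using cong_solve_coprime_int[of z M] coprime_M z by blast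
  have em: "coprime e m" using coprime_m_of_inverse[OF e] .
  have zP: "[z * e = 1] (mod P p)" using e cong_M_iff[OF p(1)] by blast
  have z'P: "[z' * e = 1] (mod P p)" using cong_trans[OF cong_scalar_right[OF z(3)] zP] .
  have "R x (z * e) = 0" "R x (z' * e) = 0"
    using R_local_one[OF p x _ zP] R_local_one[OF p x _ z'P] z em by simp_all
  then have "R x z' + R x e = R x z + R x e"
    using R_mult_right[OF xm z(1) em] R_mult_right[OF xm z(2) em] by simp
  then show ?thesis by simp
qed

text \<open>
  The local relation contains the unwanted term \<open>W x (Q p)\<close>. Comparing the relation for \<open>D = Q p\<close> with the
  one for its square identifies this term with \<open>R x u\<close> for a unit \<open>u\<close> congruent to \<open>Q p\<close> at \<open>p\<close>, and then
  it cancels.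
\<close>

lemma local_steinberg:
  assumes p: "prime p" "p dvd m" and x: "local_unit p x" and y: "coprime y m" 
    and xy: "[x = 1 - p ^ j * y] (mod P p)"
  shows "W x (p ^ j) + R x y = 0"
proof -
  have xm: "coprime x m" using x by (simp add: local_unit_def)
  have yp: "coprime y p" using y coprime_m_iff_local[OF p] by simp
  have Qp: "coprime (Q p) p" using prime_coprime_Q[OF p(1)] by (simp add: coprime_commute)
  obtain u where u: "[u = Q p] (mod P p)" "local_unit p u" using local_unit_exists[OF p Qp] by blast
  have um: "coprime u m" using u by (simp add: local_unit_def)
  obtain t where t: "[t * (Q p * Q p) = y] (mod P p)" "coprime t m"
    using divided_unit_exists[OF p yp, of "Q p * Q p"] Qp by auto
  have tum: "coprime (t * u) m" "coprime (t * u * u) m" using t um by simp_all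
  have "[t * u * Q p = t * Q p * Q p] (mod P p)" using u(1) by (intro cong_mult cong_refl)
  also have "t * Q p * Q p = t * (Q p * Q p)" by simp
  also have "[\<dots> = y] (mod P p)" by (rule t(1))
  finally have tu: "[t * u * Q p = y] (mod P p)" .
  have "[t * u * u = t * u * Q p] (mod P p)" using u(1) by (intro cong_mult cong_refl)
  then have tuu: "[t * u * u = y] (mod P p)" using tu by (rule cong_trans)
  have QQ: "smooth (Q p * Q p)" "W x (Q p * Q p) = W x (Q p) + W x (Q p)"
    using smooth_Q W_mult_right[OF xm] coprime_smooth[OF xm smooth_Q] by auto
  have 1: "W x (p ^ j) + W x (Q p) + R x (t * u) = 0"
    by (rule local_relation[OF p x xy smooth_Q dvd_refl tum(1) tu])
  have 2: "W x (p ^ j) + W x (Q p * Q p) + R x t = 0"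
    by (rule local_relation[OF p x xy QQ(1) dvd_triv_left t(2,1)])
  have 3: "R x (t * u) = R x t + R x u" by (rule R_mult_right[OF xm t(2) um])
  have "W x (Q p) = R x u"
  proof -
    have "W x (p ^ j) + W x (Q p) + R x t + R x u = W x (p ^ j) + W x (Q p) + R x t + W x (Q p)"
      using 1 2 unfolding 3 QQ(2) by (simp add: algebra_simps)
    then show ?thesis by simp
  qed
  moreover have "R x y = R x (t * u * u)" by (rule R_local_cong[OF p x tum(2) y cong_sym[OF tuu]])
  moreover have "R x (t * u * u) = R x (t * u) + R x u" by (rule R_mult_right[OF xm tum(1) um])
  ultimately show ?thesis using 1 by (simp add: algebra_simps)
qed

text \<open>
  A unit that is 1 modulo \<open>M2\<close> is a product of local units at the primes dividing \<open>M1\<close>, by the Chinese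
  remainder theorem.
\<close>

lemma hom_trivial_from_local:
  fixes f :: "int \<Rightarrow> 'g"
  assumes add: "\<And>x y. coprime x m \<Longrightarrow> coprime y m \<Longrightarrow> f (x * y) = f x + f y"
    and cong: "\<And>x y. coprime x m \<Longrightarrow> [y = x] (mod M) \<Longrightarrow> f y = f x"
  shows "M = M1 * M2 \<Longrightarrow> coprime M1 M2 \<Longrightarrow> [x = 1] (mod M2) \<Longrightarrow> coprime x m \<Longrightarrow>
     (\<And>p z. prime p \<Longrightarrow> p dvd M1 \<Longrightarrow> local_unit p z \<Longrightarrow> f z = 0) \<Longrightarrow> f x = 0"
proof (induction "nat \<bar>M1\<bar>" arbitrary: M1 M2 x rule: less_induct)
  case less
  have f1: "f 1 = 0" using add[of 1 1] by simp
  have M1: "M1 \<noteq> 0" using less.prems(1) M_pos by auto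
  show ?case
  proof (cases "is_unit M1")
    case True
    then have "M dvd M2" using less.prems(1) by simp
    then have "[x = 1] (mod M)" using less.prems(3) by (rule cong_dvd_modulus[rotated])
    then show ?thesis using cong[of 1 x] f1 by simp
  next
    case False
    then obtain p where p: "prime p" "p dvd M1" using prime_divisor_exists M1 by blast
    then have pm: "p dvd m" using less.prems(1) prime_dvd_power by (metis M_def dvd_mult2)
    have "\<not> p dvd M2" using less.prems(2) p not_coprimeI not_prime_unit by blast
    then have "coprime (P p) M2" using prime_imp_coprime[OF p(1)] by (simp add: P_def)
    moreover have "P p dvd M1 * M2" using less.prems(1) M_eq by (metis dvd_triv_left)
    ultimately have "P p dvd M1" by (simp add: coprime_dvd_mult_left_iff)
    then obtain M1' where M1': "M1 = P p * M1'" by (elim dvdE)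
    have P0: "P p \<noteq> 0" using M1 M1' by auto
    have Q: "Q p = M1' * M2" using M_eq[of p] less.prems(1) P0 unfolding M1' by simp
    have xx: "coprime x p" "coprime x (Q p)" using less.prems(4) coprime_m_iff_local[OF p(1) pm] by auto
    obtain y where y: "[y = x] (mod P p)" "local_unit p y" using local_unit_exists[OF p(1) pm xx(1)] .
    obtain z where z: "[z = 1] (mod P p)" "[z = x] (mod Q p)" "coprime z m"
      using unit_with_residues[OF p(1) pm coprime_1_left xx(2)] .
    have ym: "coprime y m" "[y = 1] (mod Q p)" using y(2) by (auto simp: local_unit_def)
    have "[y * z = x * 1] (mod P p)" "[y * z = 1 * x] (mod Q p)"
      using cong_mult[OF y(1) z(1)] cong_mult[OF ym(2) z(2)] .
    then have "[y * z = x] (mod M)" using cong_M_iff[OF p(1)] by simp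
    from cong[OF less.prems(4) this] have "f x = f y + f z" using add[OF ym(1) z(3)] by simp
    also have "f y = 0" by (rule less.prems(5)[OF p y(2)])
    also have "f z = 0"
    proof (rule less.hyps[of M1' "M2 * P p"])
      have "\<not> is_unit (P p)" using p(1) prime_dvd_P[OF p(1) pm] dvd_trans not_prime_unit by blast
      then have "\<bar>P p\<bar> > 1" using P0 by (simp add: zdvd1_eq)
      moreover have "\<bar>M1'\<bar> > 0" using M1 M1' by simp
      ultimately have "\<bar>M1'\<bar> < \<bar>M1\<bar>" unfolding M1' abs_mult by simp
      then show "nat \<bar>M1'\<bar> < nat \<bar>M1\<bar>" by simp
      show "M = M1' * (M2 * P p)" using less.prems(1) M1' by simp
      have "coprime (P p) (M1' * M2)" using coprime_P_Q[OF p(1)] Q by simp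
      then show "coprime M1' (M2 * P p)" using less.prems(2) M1' by (simp add: coprime_commute)
      have "[z = x] (mod M2)" using z(2) unfolding Q by (rule cong_dvd_modulus) simp
      then have "[z = 1] (mod M2)" using less.prems(3) by (rule cong_trans)
      then show "[z = 1] (mod M2 * P p)" using z(1) \<open>coprime (P p) M2\<close>
        by (intro cong_mult_coprime) (simp_all add: coprime_commute)
      show "coprime z m" by fact
      show "f v = 0" if "prime q" "q dvd M1'" "local_unit q v" for q v
        using less.prems(5)[OF that(1) _ that(3)] that(2) M1' by simp
    qed
    finally show ?thesis by simp
  qed
qed

end

section \<open>Vanishing of the defect\<close>

context mennicke_symbol
begin

definition local_lift :: "int \<Rightarrow> int \<Rightarrow> int" where
  "local_lift p u = (SOME x. [x = u] (mod P p) \<and> [x = 1] (mod Q p))"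

lemma local_lift: 
  assumes "prime p" shows "[local_lift p u = u] (mod P p)" "[local_lift p u = 1] (mod Q p)"
proof -
  have "\<exists>x. [x = u] (mod P p) \<and> [x = 1] (mod Q p)" 
    using crt_int[OF coprime_P_Q[OF assms]] by metis
  from someI_ex[OF this] show "[local_lift p u = u] (mod P p)" "[local_lift p u = 1] (mod Q p)"
    by (simp_all add: local_lift_def)
qed

lemma local_lift_local_unit:
  assumes p: "prime p" "p dvd m" "coprime u p"
  shows "local_unit p (local_lift p u)" "coprime (local_lift p u) m"
proof -
  obtain x where x: "[x = u] (mod P p)" "[x = 1] (mod Q p)" "coprime x m"
    using unit_with_residues[OF p coprime_1_left] .
  have "[local_lift p u = x] (mod M)" unfolding cong_M_iff[OF p(1)]
    using local_lift[OF p(1), of u] x by (meson cong_sym cong_trans)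
  then show "coprime (local_lift p u) m" using coprime_m_of_cong x(3) by blast
  then show "local_unit p (local_lift p u)" using local_lift[OF p(1)] by (simp add: local_unit_def)
qed

lemma local_lift_cong: "prime p \<Longrightarrow> [u = v] (mod P p) \<Longrightarrow> [local_lift p u = local_lift p v] (mod M)"
  unfolding cong_M_iff using local_lift[of p u] local_lift[of p v] by (meson cong_sym cong_trans)

lemma local_lift_mult: 
  assumes "prime p" shows "[local_lift p (u * v) = local_lift p u * local_lift p v] (mod M)"
proof -
  note l = local_lift[OF assms]
  have "[local_lift p u * local_lift p v = u * v] (mod P p)" "[local_lift p u * local_lift p v = 1 * 1] (mod Q p)"
    by (intro cong_mult l)+
  then show ?thesis unfolding cong_M_iff[OF assms] using l[of "u * v"] by (simp; meson cong_sym cong_trans)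
qed

lemma local_lift_of_local_unit: "prime p \<Longrightarrow> local_unit p x \<Longrightarrow> [local_lift p x = x] (mod M)"
  unfolding cong_M_iff local_unit_def using local_lift[of p x] by (meson cong_sym cong_trans)

lemma R_local_reduce:
  assumes p: "prime p" "p dvd m" and x: "local_unit p x" and z: "coprime z m"
  shows "R x z = R (local_lift p x) (local_lift p z)"
proof -
  have xm: "coprime x m" using x by (simp add: local_unit_def)
  have zp: "coprime z p" using z coprime_m_iff_local[OF p] by simp
  note zl = local_lift_local_unit(2)[OF p zp]
  have "R (local_lift p x) (local_lift p z) = R x (local_lift p z)"
    by (rule R_cong_left[OF xm zl local_lift_of_local_unit[OF p(1) x]])
  also have "\<dots> = R x z" by (rule R_local_cong[OF p x z zl local_lift(1)[OF p(1)]])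
  finally show ?thesis by simp
qed

lemma local_lift_symbol:
  assumes p: "prime p" "p dvd m" and c: "coprime x p" "coprime y p" "coprime z p"
  shows "R (local_lift p x) (local_lift p (y * z)) = R (local_lift p x) (local_lift p y) + R (local_lift p x) (local_lift p z)"
    and "[y = w] (mod P p) \<Longrightarrow> R (local_lift p x) (local_lift p y) = R (local_lift p x) (local_lift p w)"
    and "R (local_lift p x) (local_lift p y) = - R (local_lift p y) (local_lift p x)"
    and "[x + p ^ j * y = 1] (mod P p) \<Longrightarrow> W (local_lift p x) (p ^ j) + R (local_lift p x) (local_lift p y) = 0"
proof -
  note u = local_lift_local_unit(2)[OF p]
  show "R (local_lift p x) (local_lift p (y * z)) = R (local_lift p x) (local_lift p y) + R (local_lift p x) (local_lift p z)"
    using R_cong_right[OF u[OF c(1)] _ local_lift_mult[OF p(1)], of y z] R_mult_right[OF u u u, OF c] u[OF c(2)] u[OF c(3)]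
    by simp
  show "R (local_lift p x) (local_lift p y) = R (local_lift p x) (local_lift p w)" if "[y = w] (mod P p)"
    by (rule R_cong_right[OF u[OF c(1)] u[OF c(2)] local_lift_cong[OF p(1) cong_sym[OF that]], symmetric])
  show "R (local_lift p x) (local_lift p y) = - R (local_lift p y) (local_lift p x)" by (rule R_antisym[OF u u, OF c(1,2)])
  assume a: "[x + p ^ j * y = 1] (mod P p)"
  have "[local_lift p x + p ^ j * local_lift p y = x + p ^ j * y] (mod P p)"
    by (intro cong_add cong_mult local_lift p cong_refl)
  then have "[local_lift p x + p ^ j * local_lift p y = 1] (mod P p)" using a by (rule cong_trans)
  then have "[local_lift p x = 1 - p ^ j * local_lift p y] (mod P p)"
    by (simp add: cong_iff_dvd_diff algebra_simps)
  then show "W (local_lift p x) (p ^ j) + R (local_lift p x) (local_lift p y) = 0"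
    by (rule local_steinberg[OF p local_lift_local_unit(1)[OF p c(1)] u[OF c(2)]])
qed

lemma R_odd_local:
  assumes p: "prime p" "p dvd m" "odd p" and x: "local_unit p x" and z: "coprime z m"
  shows "R x z = 0"
proof -
  obtain q where q: "p = int q" using prime_ge_0_int[OF p(1)] nonneg_int_cases by metis
  have PP: "P p = int q ^ multiplicity p M" by (simp add: P_def q)
  have xm: "coprime x m" using x by (simp add: local_unit_def)
  have c: "coprime x p" "coprime z p" using xm z coprime_m_iff_local[OF p(1,2)] by auto
  have "R (local_lift p x) (local_lift p z) = 0"
  proof (rule odd_local_symbol_trivial[where L = "\<lambda>u v. R (local_lift p u) (local_lift p v)" and p = q and k = "multiplicity p M"])
    show "prime q" using p(1) by (simp add: q)
    show "odd q" using p(3) by (simp add: q)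
    show "0 < multiplicity p M" using multiplicity_M_ge_3[OF p(1,2)] by simp
    show "R (local_lift p x) (local_lift p y) = 0" 
      if "coprime x (int q)" "coprime y (int q)" "[x + y = 1] (mod int q ^ multiplicity p M)" for x y
      using local_lift_symbol(4)[OF p(1,2), of x y 1 0] that W_one_right local_lift_local_unit(2)[OF p(1,2), of x]
      by (simp add: q P_def)
    show "R (local_lift p x) (local_lift p (y * z)) = R (local_lift p x) (local_lift p y) + R (local_lift p x) (local_lift p z)"
      if "coprime x (int q)" "coprime y (int q)" "coprime z (int q)" for x y z
      by (rule local_lift_symbol(1)[OF p(1,2)]) (use that q in simp_all)
    show "R (local_lift p x) (local_lift p y) = R (local_lift p x) (local_lift p z)"
      if "coprime x (int q)" "coprime y (int q)" "[y = z] (mod int q ^ multiplicity p M)" for x y z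
      by (rule local_lift_symbol(2)[OF p(1,2), where z = 1]) (use that q PP in simp_all)
    show "R (local_lift p x) (local_lift p y) = - R (local_lift p y) (local_lift p x)"
      if "coprime x (int q)" "coprime y (int q)" for x y
      by (rule local_lift_symbol(3)[OF p(1,2), where z = 1]) (use that q in simp_all)
  qed (use c q in simp_all)
  then show ?thesis using R_local_reduce[OF p(1,2) x z] by simp
qed

lemma R_minus_one_one: "R (-1) (-1) = 0"
  using R_eq[of "-1" "-1" "-1"] by simp

text \<open>
  The symbol at 2 is handled last, because its value at (-1, -1) is only known from the global identity
  \<open>R (-1) (-1) = 0\<close> once the components at the odd primes have been removed.
\<close>

lemma R_even_local:
  assumes "even m" and x: "local_unit 2 x" and z: "coprime z m"
  shows "R x z = 0"
proof -
  have p: "prime (2::int)" "2 dvd m" using assms by auto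
  note u = local_lift_local_unit[OF p]
  have PP: "P 2 = 2 ^ multiplicity 2 M" by (simp add: P_def)
  have xm: "coprime x m" using x by (simp add: local_unit_def)
  have c: "coprime x 2" "coprime z 2" using xm z coprime_m_iff_local[OF p] by auto
  have odd_iff: "odd y \<longleftrightarrow> coprime y 2" for y :: int by simp
  \<comment> \<open>the global value \<open>R (-1) (-1)\<close> vanishes, and so do its components at odd primes;
    hence the component at 2 vanishes\<close>
  have minus: "R (local_lift 2 (-1)) (local_lift 2 (-1)) = 0"
  proof -
    have ml: "local_unit 2 (local_lift 2 (-1))" "coprime (local_lift 2 (-1)) m" using u[of "-1"] by simp_all
    obtain y where y: "[y = 1] (mod P 2)" "[y = -1] (mod Q 2)" "coprime y m"
      using unit_with_residues[OF p coprime_1_left, of "-1"] by auto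
    have "R y (-1) = 0"
    proof (rule hom_trivial_from_local[where f = "\<lambda>y. R y (-1)" and ?M1.0 = "Q 2" and ?M2.0 = "P 2"])
      show "M = Q 2 * P 2" using M_eq[of 2] by simp
      show "coprime (Q 2) (P 2)" by (rule coprime_Q_P[OF p(1)])
      show "R v (-1) = 0" if "prime q" "q dvd Q 2" "local_unit q v" for q v
      proof (rule R_odd_local[OF that(1) _ _ that(3)])
        have "q dvd M" using that(2) M_eq by (metis dvd_mult)
        then show "q dvd m" using that(1) prime_dvd_power by (simp add: M_def) blast
        have "coprime 2 (Q 2)" by (rule prime_coprime_Q[OF p(1)])
        then show "odd q" using that(2) by (meson coprime_left_2_iff_odd dvd_trans)
      qed simp
    qed (use y in \<open>auto intro: R_mult_left R_cong_left\<close>)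
    moreover have "[local_lift 2 (-1) * y = -1] (mod M)"
      unfolding cong_M_iff[OF p(1)]
      using cong_mult[OF local_lift(1)[OF p(1), of "-1"] y(1)] cong_mult[OF local_lift(2)[OF p(1), of "-1"] y(2)] by simp
    then have "R (local_lift 2 (-1) * y) (-1) = R (-1) (-1)"
      by (intro R_cong_left) simp_all
    then have "R (local_lift 2 (-1)) (-1) + R y (-1) = 0"
      using R_mult_left[OF _ ml(2) y(3), of "-1"] R_minus_one_one by simp
    moreover have "R (local_lift 2 (-1)) (local_lift 2 (-1)) = R (local_lift 2 (-1)) (-1)"
      by (rule R_local_cong[OF p ml(1) _ ml(2) local_lift(1)[OF p(1)]]) simp
    ultimately show ?thesis by simp
  qed
  have "R (local_lift 2 x) (local_lift 2 z) = 0"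
  proof (rule two_local_symbol_trivial[where L = "\<lambda>u v. R (local_lift 2 u) (local_lift 2 v)" and k = "multiplicity 2 M" and T = "\<lambda>x. W (local_lift 2 x) 2"])
    show "3 \<le> multiplicity 2 M" by (rule multiplicity_M_ge_3[OF p])
    show "W (local_lift 2 (x * y)) 2 = W (local_lift 2 x) 2 + W (local_lift 2 y) 2" if "odd x" "odd y" for x y
    proof -
      have xy: "coprime (local_lift 2 x) m" "coprime (local_lift 2 y) m" using u that by simp_all
      have "W (local_lift 2 (x * y)) 2 = W (local_lift 2 x * local_lift 2 y) 2"
        by (rule W_smooth_cong[OF _ local_lift_mult[OF p(1)] smooth_prime[OF p]]) (use xy in simp)
      also have "\<dots> = W (local_lift 2 x) 2 + W (local_lift 2 y) 2"
        by (rule W_mult_left[OF xy]) (use coprime_smooth[OF _ smooth_prime[OF p]] xy in simp_all)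
      finally show ?thesis .
    qed
    show "W (local_lift 2 x) 2 = W (local_lift 2 y) 2" if "odd x" "[x = y] (mod 2 ^ multiplicity 2 M)" for x y
      by (rule W_smooth_cong[OF _ local_lift_cong[OF p(1)] smooth_prime[OF p], symmetric])
        (use that u in \<open>auto simp: P_def cong_sym\<close>)
    show "W (local_lift 2 x) 2 + R (local_lift 2 x) (local_lift 2 y) = 0"
      if "odd x" "odd y" "[x + 2 * y = 1] (mod 2 ^ multiplicity 2 M)" for x y
      using local_lift_symbol(4)[OF p, of x y 1 1] that by (simp add: P_def)
    show "W (local_lift 2 x) 2 + W (local_lift 2 x) 2 + R (local_lift 2 x) (local_lift 2 y) = 0"
      if "odd x" "odd y" "[x + 4 * y = 1] (mod 2 ^ multiplicity 2 M)" for x y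
    proof -
      have xm: "coprime (local_lift 2 x) m" using u that by simp
      have c2: "coprime (local_lift 2 x) 2" using coprime_smooth[OF xm smooth_prime[OF p]] .
      have "W (local_lift 2 x) (2 * 2) = W (local_lift 2 x) 2 + W (local_lift 2 x) 2" by (rule W_mult_right[OF xm c2 c2])
      then show ?thesis using local_lift_symbol(4)[OF p, of x y 1 2] that by (simp add: P_def)
    qed
    show "R (local_lift 2 (-1)) (local_lift 2 (-1)) = 0" by (rule minus)
    show "R (local_lift 2 x) (local_lift 2 (y * z)) = R (local_lift 2 x) (local_lift 2 y) + R (local_lift 2 x) (local_lift 2 z)"
      if "odd x" "odd y" "odd z" for x y z
      by (rule local_lift_symbol(1)[OF p]) (use that in simp_all)
    show "R (local_lift 2 x) (local_lift 2 y) = R (local_lift 2 x) (local_lift 2 z)"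
      if "odd x" "odd y" "[y = z] (mod 2 ^ multiplicity 2 M)" for x y z
      by (rule local_lift_symbol(2)[OF p, where z = 1]) (use that PP in simp_all)
    show "R (local_lift 2 x) (local_lift 2 y) = - R (local_lift 2 y) (local_lift 2 x)" if "odd x" "odd y" for x y
      by (rule local_lift_symbol(3)[OF p, where z = 1]) (use that in simp_all)
  qed (use c in simp_all)
  then show ?thesis using R_local_reduce[OF p x z] by simp
qed

lemma R_trivial:
  assumes "coprime u m" "coprime v m"
  shows "R u v = 0"
proof (rule hom_trivial_from_local[where f = "\<lambda>u. R u v" and ?M1.0 = M and ?M2.0 = 1])
  show "R z v = 0" if z: "prime p" "p dvd M" "local_unit p z" for p z
  proof -
    have pm: "p dvd m" using z by (simp add: M_def prime_dvd_power_iff)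
    show ?thesis
    proof (cases "odd p")
      case True then show ?thesis using R_odd_local z pm assms by blast
    next
      case False
      then have "p = 2" using z(1) primes_dvd_imp_eq[of 2 p] by simp
      then show ?thesis using R_even_local z pm assms by blast
    qed
  qed
qed (use assms in \<open>auto intro: R_mult_left R_cong_left\<close>)

end

section \<open>Vanishing of Mennicke symbols\<close>

lemma additive_trivial_of_primes:
  fixes f :: "int \<Rightarrow> 'g::ab_group_add"
  assumes r: "prime r"
    and add: "\<And>x y. coprime x r \<Longrightarrow> coprime y r \<Longrightarrow> f (x * y) = f x + f y"
    and primes: "\<And>l. prime l \<Longrightarrow> l < r \<Longrightarrow> f l = 0"
  shows "0 < n \<Longrightarrow> n < r \<Longrightarrow> f n = 0"
proof (induction "nat n" arbitrary: n rule: less_induct)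
  case less
  have cop: "coprime k r" if "0 < k" "k < r" for k
    using prime_imp_coprime[OF r, of k] zdvd_not_zless[OF that] by (simp add: coprime_commute)
  show ?case
  proof (cases "n = 1")
    case True then show ?thesis using add[of 1 1] by simp
  next
    case False
    then have "\<not> is_unit n" using less.prems by simp
    then obtain l where l: "prime l" "l dvd n" using prime_divisor_exists less.prems by (metis less_irrefl)
    then obtain k where k: "n = l * k" by (elim dvdE)
    have l1: "l > 1" using prime_gt_1_int[OF l(1)] .
    have k0: "k > 0" using less.prems k l1 by (simp add: zero_less_mult_iff)
    have "k < n" using k l1 k0 by simp
    moreover have "l \<le> n" using l(2) less.prems by (simp add: zdvd_imp_le)
    ultimately have "f l = 0" "f k = 0" using primes[OF l(1)] less.hyps[of k] less.prems k0 by auto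
    then show ?thesis using add[OF cop cop, of l k] k k0 l1 \<open>k < n\<close> \<open>l \<le> n\<close> less.prems by simp
  qed
qed

context mennicke_symbol
begin

lemma W_sym:
  assumes "coprime a m" "coprime b m" "coprime a b"
  shows "W a b = W b a"
  using R_eq[OF assms(1,2) cong_refl assms(3)] R_trivial[OF assms(1,2)] by simp

lemma W_minus_one: "coprime a m \<Longrightarrow> W a (-1) = 0"
  using W_sym[of a "-1"] W_unit_left[of "-1" a] by simp

lemma W_neg_right: "coprime a m \<Longrightarrow> coprime a b \<Longrightarrow> W a (- b) = W a b"
  using W_mult_right[of a "-1" b] W_minus_one by simp

text \<open>
  The local relation with and without the factor \<open>q\<close> in \<open>D\<close>, now that \<open>R\<close> has disappeared.
\<close>

lemma W_other_prime:
  assumes p: "prime p" "p dvd m" and q: "prime q" "q dvd m" "q \<noteq> p" and x: "local_unit p x"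
  shows "W x q = 0"
proof -
  have xm: "coprime x m" using x by (simp add: local_unit_def)
  obtain j y where jy: "coprime y p" "[x = 1 - p ^ j * y] (mod P p)" using local_decomposition[OF p(1)] .
  have Qp: "coprime (Q p) p" using prime_coprime_Q[OF p(1)] by (simp add: coprime_commute)
  have "coprime q p" using primes_coprime[OF q(1) p(1) q(3)] .
  then have Qq: "coprime (Q p * q) p" using Qp by simp
  obtain t where t: "[t * Q p = y] (mod P p)" "coprime t m"
    using divided_unit_exists[OF p jy(1) Qp] by blast
  obtain u where u: "[u * (Q p * q) = y] (mod P p)" "coprime u m"
    using divided_unit_exists[OF p jy(1) Qq] by blast
  have sq: "smooth q" "smooth (Q p * q)" using smooth_prime[OF q(1,2)] smooth_Q by simp_all
  have 1: "W x (p ^ j) + W x (Q p) = 0"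
    using local_relation[OF p x jy(2) smooth_Q dvd_refl t(2,1)] R_trivial[OF xm t(2)] by simp
  have "W x (p ^ j) + W x (Q p * q) = 0"
    using local_relation[OF p x jy(2) sq(2) dvd_triv_left u(2,1)] R_trivial[OF xm u(2)] by simp
  moreover have "W x (Q p * q) = W x (Q p) + W x q"
    by (rule W_mult_right[OF xm coprime_smooth[OF xm smooth_Q] coprime_smooth[OF xm sq(1)]])
  ultimately have "(W x (p ^ j) + W x (Q p)) + W x q = 0" by (simp add: add.assoc)
  then show ?thesis unfolding 1 by simp
qed

text \<open>
  The characters attached to the primes dividing \<open>m\<close> are tame: they are trivial on units congruent to 1
  modulo \<open>p\<close>, by the local Steinberg relation with \<open>j = 1\<close>.
\<close>

lemma W_own_prime:
  assumes p: "prime p" "p dvd m" and x: "local_unit p x" "[x = 1] (mod p)"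
  shows "W x p = 0"
proof -
  \<comment> \<open>the case in which \<open>p\<close> divides \<open>x - 1\<close> exactly once\<close>
  have tame: "W x p = 0" if x: "local_unit p x" and y: "coprime y p" "[x = 1 - p * y] (mod P p)" for x y
  proof -
    note l = local_lift_local_unit(2)[OF p y(1)]
    have xm: "coprime x m" using x by (simp add: local_unit_def)
    have "[p * y = p * local_lift p y] (mod P p)" by (intro cong_scalar_left cong_sym[OF local_lift(1)[OF p(1)]])
    then have "[1 - p * y = 1 - p ^ 1 * local_lift p y] (mod P p)" by (simp add: cong_diff)
    with y(2) have "[x = 1 - p ^ 1 * local_lift p y] (mod P p)" by (rule cong_trans)
    then have "W x (p ^ 1) + R x (local_lift p y) = 0" by (rule local_steinberg[OF p x l])
    then show ?thesis using R_trivial[OF xm l] by simp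
  qed
  obtain y where y: "x = 1 - p * y"
  proof -
    obtain t where "x = 1 + t * p" using cong_imp_eq_add[OF x(2)] by blast
    then show thesis using that[of "- t"] by simp
  qed
  show ?thesis
  proof (cases "p dvd y")
    case False
    then have "coprime y p" using prime_imp_coprime[OF p(1) False] by (simp add: coprime_commute)
    then show ?thesis using tame[OF x(1)] y by simp
  next
    case True
    have "coprime (1 - p) p" using coprime_one_minus[of p] by (simp add: coprime_commute)
    note l = local_lift_local_unit[OF p this]
    have xm: "coprime x m" using x by (simp add: local_unit_def)
    have "[local_lift p (1 - p) = 1 - p * 1] (mod P p)" using local_lift(1)[OF p(1), of "1 - p"] by simp
    \<comment> \<open>otherwise multiply by an element of the first kind to reach the first kind\<close>
    then have v: "W (local_lift p (1 - p)) p = 0" by (rule tame[OF l(1) coprime_1_left])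
    define z where "z = 1 + y - p * y"
    have "x * (1 - p) = 1 - p * z" unfolding y z_def by (simp add: algebra_simps)
    then have xz: "[x * local_lift p (1 - p) = 1 - p * z] (mod P p)"
      using cong_scalar_left[OF local_lift(1)[OF p(1), of "1 - p"], of x] by simp
    have "[z = 1] (mod p)" using True by (simp add: z_def cong_iff_dvd_diff)
    then have zp: "coprime z p" by (rule coprime_of_cong_one)
    have "[x * local_lift p (1 - p) = 1 * 1] (mod Q p)"
      using x(1) l(1) unfolding local_unit_def by (intro cong_mult) auto
    then have "local_unit p (x * local_lift p (1 - p))" using xm l(2) by (simp add: local_unit_def)
    then have "W (x * local_lift p (1 - p)) p = 0" by (rule tame[OF _ zp xz])
    then show ?thesis
      using W_mult_left[OF xm l(2), of p] v coprime_smooth[OF _ smooth_prime[OF p]] xm l(2) by simp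
  qed
qed

lemma W_prime_one:
  assumes p: "prime p" "p dvd m" and u: "coprime u m" "[u = 1] (mod p)"
  shows "W u p = 0"
proof -
  have up: "coprime u p" "coprime u (Q p)" using u coprime_m_iff_local[OF p] by auto
  note l = local_lift_local_unit[OF p up(1)]
  note cp = coprime_smooth[OF _ smooth_prime[OF p]]
  obtain z where z: "[z = 1] (mod P p)" "[z = u] (mod Q p)" "coprime z m"
    using unit_with_residues[OF p coprime_1_left up(2)] .
  have "[local_lift p u * z = u * 1] (mod P p)" "[local_lift p u * z = 1 * u] (mod Q p)"
    using cong_mult[OF local_lift(1)[OF p(1)] z(1)] cong_mult[OF local_lift(2)[OF p(1)] z(2)] .
  then have "[u = local_lift p u * z] (mod M)" using cong_M_iff[OF p(1)] by (simp add: cong_sym)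
  then have "W u p = W (local_lift p u * z) p"
    by (rule W_smooth_cong[OF _ _ smooth_prime[OF p], rotated]) (use l z in simp)
  also have "\<dots> = W (local_lift p u) p + W z p" by (rule W_mult_left[OF l(2) z(3) cp[OF l(2)] cp[OF z(3)]])
  also have "W (local_lift p u) p = 0"
  proof (rule W_own_prime[OF p l(1)])
    have "[local_lift p u = u] (mod p)" using cong_dvd_modulus[OF local_lift(1)[OF p(1)] prime_dvd_P[OF p]] .
    then show "[local_lift p u = 1] (mod p)" using u(2) by (rule cong_trans)
  qed
  also have "W z p = 0"
  proof (rule hom_trivial_from_local[where f = "\<lambda>z. W z p" and ?M1.0 = "Q p" and ?M2.0 = "P p"])
    show "M = Q p * P p" using M_eq[of p] by simp
    show "coprime (Q p) (P p)" by (rule coprime_Q_P[OF p(1)])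
    show "W (x * y) p = W x p + W y p" if "coprime x m" "coprime y m" for x y
      by (rule W_mult_left[OF that cp[OF that(1)] cp[OF that(2)]])
    show "W y p = W x p" if "coprime x m" "[y = x] (mod M)" for x y
      by (rule W_smooth_cong[OF that smooth_prime[OF p]])
    show "W v p = 0" if "prime q" "q dvd Q p" "local_unit q v" for q v
    proof (rule W_other_prime[OF that(1) _ p _ that(3)])
      have "q dvd m ^ 3" using that(2) M_eq[of p] by (simp add: M_def)
      then show "q dvd m" by (rule prime_dvd_power[OF that(1)])
      show "p \<noteq> q" using that(2) prime_coprime_Q[OF p(1)] p(1) not_prime_unit
        by (metis coprime_absorb_left)
    qed
  qed (use z in auto)
  finally show ?thesis by simp
qed

lemma W_prime_cong:
  assumes p: "prime p" "p dvd m" and a: "coprime a m" "coprime c m" "[a = c] (mod p)"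
  shows "W a p = W c p"
proof -
  note cp = coprime_smooth[OF _ smooth_prime[OF p]]
  obtain e where e: "[c * e = 1] (mod M)" using cong_solve_coprime_int[of c M] coprime_M a by blast
  have em: "coprime e m" using coprime_m_of_inverse[OF e] .
  have "p dvd M" using p(2) m_dvd_M dvd_trans by blast
  then have c1: "[c * e = 1] (mod p)" using e cong_dvd_modulus by blast
  have a1: "[a * e = 1] (mod p)" using cong_trans[OF cong_scalar_right[OF a(3)] c1] .
  have "W (c * e) p = 0" "W (a * e) p = 0"
    using W_prime_one[OF p _ c1] W_prime_one[OF p _ a1] a em by simp_all
  then have "W a p + W e p = W c p + W e p"
    using W_mult_left[OF a(1) em cp[OF a(1)] cp[OF em]] W_mult_left[OF a(2) em cp[OF a(2)] cp[OF em]] by simp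
  then show ?thesis by simp
qed

text \<open>
  Every prime \<open>r\<close> has a character of the units modulo \<open>r\<close>, to be shown trivial: it is \<open>W r\<close> if \<open>r\<close> does not
  divide \<open>m\<close>, and otherwise \<open>c \<mapsto> W c r\<close>, which by the previous lemma depends only on \<open>c\<close> modulo \<open>r\<close>.
\<close>

definition prime_trivial :: "int \<Rightarrow> bool" where
  "prime_trivial r \<longleftrightarrow> (if r dvd m then \<forall>c. coprime c m \<longrightarrow> W c r = 0 else \<forall>b. coprime r b \<longrightarrow> W r b = 0)"

lemma prime_unit: "prime r \<Longrightarrow> \<not> r dvd m \<Longrightarrow> coprime r m"
  by (rule prime_imp_coprime)

text \<open>
  Reciprocity moves the character of \<open>r\<close> at a smaller prime \<open>l\<close> to the character of \<open>l\<close>, and the residues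
  modulo \<open>r\<close> are products of primes smaller than \<open>r\<close>. This is Gauss's induction, as in Tate's computation of
  \<open>K\<^sub>2(\<rat>)\<close>.
\<close>

lemma prime_trivial_off_level:
  assumes r: "prime r" "\<not> r dvd m" and IH: "\<And>l. prime l \<Longrightarrow> l < r \<Longrightarrow> prime_trivial l"
  shows "prime_trivial r"
proof -
  have rm: "coprime r m" using prime_unit r .
  have small: "W r n = 0" if "0 < n" "n < r" for n
  proof (rule additive_trivial_of_primes[where f = "W r", OF r(1) _ _ that])
    show "W r (x * y) = W r x + W r y" if "coprime x r" "coprime y r" for x y
      by (rule W_mult_right[OF rm]) (use that in \<open>simp_all add: coprime_commute\<close>)
    fix l assume l: "prime l" "l < r"
    show "W r l = 0"
    proof (cases "l dvd m")
      case True then show ?thesis using IH[OF l] rm by (simp add: prime_trivial_def)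
    next
      case False
      have lr: "coprime r l" using primes_coprime[OF r(1) l(1)] l(2) by simp
      have "W r l = W l r" by (rule W_sym[OF rm prime_unit[OF l(1) False] lr])
      then show ?thesis using IH[OF l] False lr by (simp add: prime_trivial_def coprime_commute)
    qed
  qed
  have "W r b = 0" if b: "coprime r b" for b
  proof -
    have r1: "r > 1" using prime_gt_1_int[OF r(1)] .
    have "b mod r \<noteq> 0"
    proof
      assume "b mod r = 0"
      then have "r dvd b" by auto
      then show False using b r(1) not_prime_unit by (metis coprime_absorb_left)
    qed
    then have "0 < b mod r" "b mod r < r" using r1 pos_mod_sign[of r b] pos_mod_bound[of r b] by linarith+
    then have "W r (b mod r) = 0" by (rule small)
    then show ?thesis using W_periodic[OF rm b, of "b mod r"] by simp
  qed
  then show ?thesis using r(2) by (simp add: prime_trivial_def)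
qed

text \<open>
  The same induction for a prime \<open>r\<close> dividing \<open>m\<close>. If the smaller prime \<open>l\<close> divides \<open>m\<close> too, reciprocity
  between \<open>l\<close> and \<open>r\<close> has to be extracted from a unit \<open>x\<close> with \<open>x - l\<close> divisible by \<open>r\<close>.
\<close>

lemma prime_trivial_on_level:
  assumes r: "prime r" "r dvd m" and IH: "\<And>l. prime l \<Longrightarrow> l < r \<Longrightarrow> prime_trivial l"
  shows "prime_trivial r"
proof -
  note cr = coprime_smooth[OF _ smooth_prime[OF r]]
  have local_lift_r: "[local_lift r n = n] (mod r)" for n using cong_dvd_modulus[OF local_lift(1)[OF r(1)] prime_dvd_P[OF r]] .
  have small: "W (local_lift r n) r = 0" if "0 < n" "n < r" for n
  proof (rule additive_trivial_of_primes[where f = "\<lambda>n. W (local_lift r n) r", OF r(1) _ _ that])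
    show "W (local_lift r (x * y)) r = W (local_lift r x) r + W (local_lift r y) r" if c: "coprime x r" "coprime y r" for x y
    proof -
      note lx = local_lift_local_unit(2)[OF r c(1)] and ly = local_lift_local_unit(2)[OF r c(2)]
      have "W (local_lift r (x * y)) r = W (local_lift r x * local_lift r y) r"
        by (rule W_smooth_cong[OF _ local_lift_mult[OF r(1)] smooth_prime[OF r]]) (use lx ly in simp)
      also have "\<dots> = W (local_lift r x) r + W (local_lift r y) r" by (rule W_mult_left[OF lx ly cr[OF lx] cr[OF ly]])
      finally show ?thesis .
    qed
    fix l assume l: "prime l" "l < r"
    then have "l \<noteq> r" by simp
    have lr: "coprime l r" using primes_coprime[OF l(1) r(1)] l(2) by simp
    note ll = local_lift_local_unit(2)[OF r lr]
    show "W (local_lift r l) r = 0"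
    proof (cases "l dvd m")
      case False
      have lm: "coprime l m" by (rule prime_unit[OF l(1) False])
      have "W (local_lift r l) r = W l r" by (rule W_prime_cong[OF r ll lm local_lift_r])
      then show ?thesis using IH[OF l] False lr by (simp add: prime_trivial_def)
    next
      case True
      \<comment> \<open>\<open>x\<close> is congruent to \<open>l\<close> modulo \<open>r\<close> but not modulo the square of \<open>r\<close>; so \<open>r\<close> divides
        \<open>x - l\<close> exactly once and its symbol can be read off from those of \<open>l\<close> and of \<open>w = (x - l) / r\<close>\<close>
      define x where "x = local_lift r (l + r)"
      have "coprime (l + r) r" using lr coprime_add_mult_iff[of r l 1] by (simp add: coprime_commute)
      note xl = local_lift_local_unit[OF r this, folded x_def]
      have "r ^ 2 dvd P r"
        unfolding P_def using multiplicity_M_ge_3[OF r] by (intro le_imp_power_dvd) simp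
      moreover have "[x = l + r] (mod P r)" unfolding x_def by (rule local_lift(1)[OF r(1)])
      ultimately have "[x = l + r] (mod r ^ 2)" by (rule cong_dvd_modulus[rotated])
      from cong_imp_eq_add[OF this] obtain z where z: "x = l + r + z * r ^ 2" by blast
      define w where "w = 1 + z * r"
      have xw: "x = l + r * w" unfolding z w_def by (simp add: power2_eq_square algebra_simps)
      have wr: "\<not> r dvd w"
      proof
        assume "r dvd w"
        then have "r dvd w - z * r" by simp
        then have "is_unit r" by (simp add: w_def del: zdvd1_eq)
        then show False using r(1) not_prime_unit by blast
      qed
      then have w0: "w \<noteq> 0" by auto
      have xl': "coprime x l" by (rule coprime_smooth[OF xl(2) smooth_prime[OF l(1) True]])
      have "coprime x (r * w)"
        using xl' coprime_add_mult_iff[of x "- l" 1] xw by simp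
      then have cw: "coprime x r" "coprime x w" by simp_all
      have "v dvd w \<Longrightarrow> W x v = 0" for v
      proof (induction v rule: prime_divisors_induct)
        case zero then show ?case using w0 by simp
      next
        case (unit v)
        then have "v = 1 \<or> v = -1" by (auto simp: zdvd1_eq abs_if split: if_splits)
        then show ?case using W_one_right[OF xl(2)] W_minus_one[OF xl(2)] by auto
      next
        case (factor q v)
        have qw: "q dvd w" "v dvd w" using factor.prems by (auto dest: dvd_mult_left dvd_mult_right)
        have xq: "coprime x q" "coprime x v" using cw(2) qw by (meson coprime_divisors dvd_refl)+
        have "W x q = 0"
        proof (cases "q dvd m")
          case qm: True
          have "q \<noteq> r" using qw wr by auto
          then show ?thesis by (rule W_other_prime[OF r factor.hyps qm _ xl(1)])
        next
          case qm: False
          have "coprime q m" by (rule prime_unit[OF factor.hyps qm])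
          moreover have ql: "coprime q l" using primes_coprime[OF factor.hyps l(1)] qm True by auto
          moreover have "[x = l] (mod q)" using qw(1) by (simp add: xw cong_iff_dvd_diff)
          ultimately have "W x q = W q l"
            using W_sym[OF xl(2) _ xq(1)] W_periodic[of q l x] by simp
          also have "\<dots> = 0" using IH[OF l] True \<open>coprime q m\<close> by (simp add: prime_trivial_def)
          finally show ?thesis .
        qed
        then show ?case using W_mult_right[OF xl(2) xq] factor.IH[OF qw(2)] by simp
      qed
      then have Ww: "W x w = 0" by simp
      have "[r * w = - l] (mod x)" by (simp add: xw cong_iff_dvd_diff algebra_simps)
      then have "W x (r * w) = W x (- l)"
        by (rule W_periodic[OF xl(2), rotated]) (use xl' in simp)
      also have "\<dots> = W x l" by (rule W_neg_right[OF xl(2) xl'])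
      also have "\<dots> = 0" by (rule W_other_prime[OF r l(1) True \<open>l \<noteq> r\<close> xl(1)])
      finally have "W x r = 0" using W_mult_right[OF xl(2) cw] Ww by simp
      moreover have "[local_lift r l = x] (mod r)"
        using local_lift_r[of l] by (simp add: xw cong_def)
      then have "W (local_lift r l) r = W x r" by (rule W_prime_cong[OF r ll xl(2)])
      ultimately show ?thesis by simp
    qed
  qed
  have "W c r = 0" if c: "coprime c m" for c
  proof -
    have r1: "r > 1" using prime_gt_1_int[OF r(1)] .
    have cop: "coprime c r" by (rule cr[OF c])
    have "c mod r \<noteq> 0"
    proof
      assume "c mod r = 0"
      then have "r dvd c" by auto
      then show False using cop r(1) not_prime_unit by (metis coprime_absorb_right)
    qed
    then have "0 < c mod r" "c mod r < r" using r1 pos_mod_sign[of r c] pos_mod_bound[of r c] by linarith+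
    then have "W (local_lift r (c mod r)) r = 0" by (rule small)
    moreover have "coprime (c mod r) r" using cop r1 by simp
    note l = local_lift_local_unit(2)[OF r this]
    have "[c = local_lift r (c mod r)] (mod r)" using local_lift_r[of "c mod r"] by (simp add: cong_def)
    then have "W c r = W (local_lift r (c mod r)) r" by (rule W_prime_cong[OF r c l])
    ultimately show ?thesis by simp
  qed
  then show ?thesis using r(2) by (simp add: prime_trivial_def)
qed

lemma prime_trivial: "prime r \<Longrightarrow> prime_trivial r"
proof (induction "nat r" arbitrary: r rule: less_induct)
  case less
  have "prime_trivial l" if "prime l" "l < r" for l
    using less.hyps[of l] that prime_gt_0_int[OF that(1)] by simp
  then show ?case using prime_trivial_off_level prime_trivial_on_level less.prems by blast
qed

lemma W_trivial: "coprime a m \<Longrightarrow> coprime a b \<Longrightarrow> W a b = 0"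
proof (induction a rule: prime_divisors_induct)
  case zero then show ?case using unit_neq_0 by blast
next
  case (unit a) then show ?case by (intro W_unit_left)
next
  case (factor p a)
  then have c: "coprime p m" "coprime a m" "coprime p b" "coprime a b" by simp_all
  have "\<not> p dvd m" using c(1) factor.hyps not_prime_unit by (metis coprime_absorb_left)
  then have "W p b = 0" using prime_trivial[OF factor.hyps] c(3) by (simp add: prime_trivial_def)
  then show ?case using W_mult_left[OF c] factor.IH c by simp
qed

text \<open>
  The symbol \<open>(a, b)\<close> equals \<open>W x c\<close> for a suitable \<open>x\<close> congruent to 1 modulo \<open>M\<close>, and \<open>W\<close> vanishes.
\<close>

theorem symbol_trivial:
  assumes a: "[a = 1] (mod m)" and b: "m dvd b" and ab: "coprime a b"
  shows "s a b = 0"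
proof -
  have "coprime a (m ^ 2)" using coprime_of_cong_one[OF a] by simp
  then obtain c where c: "[c = b] (mod a)" "[c = 1] (mod m ^ 2)" using crt_int by metis
  obtain k where k: "a = 1 + k * m" using cong_imp_eq_add[OF a] by blast
  obtain j where j: "c = 1 + j * m ^ 2" using cong_imp_eq_add[OF c(2)] by blast
  have ac: "coprime a c" by (rule coprime_cong[OF c(1) ab])
  have am: "coprime a m" by (rule coprime_of_cong_one[OF a])
  \<comment> \<open>\<open>x = 1 + k m (1 - c)\<close>, and both \<open>m\<close> and \<open>1 - c\<close> contribute to its congruence to 1\<close>
  define x where "x = a + (- k) * c * m"
  have "x = 1 + (- k * j) * m ^ 3"
    unfolding x_def k j by (simp add: power2_eq_square power3_eq_cube algebra_simps)
  then have x1: "[x = 1] (mod M)" by (simp add: M_def cong_iff_dvd_diff)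
  have "coprime c (a + (- k * m) * c)" unfolding coprime_add_mult_iff using ac by (simp add: coprime_commute)
  moreover have "a + (- k * m) * c = x" by (simp add: x_def)
  ultimately have xc: "coprime x c" by (simp add: coprime_commute)
  have "s a b = B a b" by (rule B_eq_s[OF a b ab])
  also have "\<dots> = B a c" by (rule B_periodic[OF a ab c(1), symmetric])
  also have "\<dots> = B x c" unfolding x_def by (rule B_shift_left[OF a ac, symmetric])
  also have "\<dots> = W x c" by (rule W_eq_B[OF x1 xc, symmetric])
  also have "\<dots> = 0" by (rule W_trivial[OF coprime_of_cong_one[OF cong_M_imp_m[OF x1]] xc])
  finally show ?thesis .
qed

end

text \<open>
  A symbol of level 1 restricts to one of level 2, and every pair can be moved to an odd first and an even
  second argument.
\<close>

lemma mennicke_symbol_trivial: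
  fixes m :: int and s :: "int \<Rightarrow> int \<Rightarrow> 'g::ab_group_add"
  assumes m: "m > 0"
    and shift_first: "\<And>a b t. [a = 1] (mod m) \<Longrightarrow> m dvd b \<Longrightarrow> coprime a b \<Longrightarrow> s (a + t * b) b = s a b"
    and shift_second: "\<And>a b t. [a = 1] (mod m) \<Longrightarrow> m dvd b \<Longrightarrow> coprime a b \<Longrightarrow> s a (b + t * m * a) = s a b"
    and mult_first: "\<And>a a' b. [a = 1] (mod m) \<Longrightarrow> [a' = 1] (mod m) \<Longrightarrow> m dvd b \<Longrightarrow>
      coprime a b \<Longrightarrow> coprime a' b \<Longrightarrow> s (a * a') b = s a b + s a' b"
    and neg_second: "\<And>a b. [a = 1] (mod m) \<Longrightarrow> m dvd b \<Longrightarrow> coprime a b \<Longrightarrow> s a (- b) = s a b"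
    and ab: "[a = 1] (mod m)" "m dvd b" "coprime a b"
  shows "s a b = 0"
proof (cases "m = 1")
  case False
  then interpret mennicke_symbol m s
    using assms by unfold_locales auto
  show ?thesis by (rule symbol_trivial[OF ab])
next
  case True
  have shift1: "s (a + t * b) b = s a b" if "coprime a b" for a b t
    using shift_first[of a b t] that by (simp add: True)
  have shift2: "s a (b + t * a) = s a b" if "coprime a b" for a b t
    using shift_second[of a b t] that by (simp add: True)
  interpret two: mennicke_symbol 2 s
  proof
    show "s a (b + t * 2 * a) = s a b" if "coprime a b" for a b t
      using shift2[OF that, of "t * 2"] by simp
  qed (use shift_first mult_first neg_second in \<open>simp_all add: True\<close>)
  have odd_even: "s a b = 0" if "odd a" "even b" "coprime a b" for a b
    by (rule two.symbol_trivial) (use that in \<open>auto simp: cong_def odd_iff_mod_2_eq_one\<close>)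
  have odd_any: "s a b = 0" if a: "odd a" "coprime a b" for a b
  proof (cases "even b")
    case True then show ?thesis using odd_even a by blast
  next
    case False
    have "coprime a (b + 1 * a)" using a coprime_add_mult_iff by blast
    then have "s a (b + 1 * a) = 0" by (rule odd_even[rotated 2]) (use a False in simp_all)
    then show ?thesis using shift2[OF a(2), of 1] by simp
  qed
  show ?thesis
  proof (cases "even a")
    case False then show ?thesis using odd_any ab by blast
  next
    case True
    then have "odd b" using ab(3) coprime_common_divisor[of a b 2] by auto
    have "coprime (a + 1 * b) b" using ab(3) coprime_add_mult_iff[of b a 1] by (simp add: coprime_commute)
    then have "s (a + 1 * b) b = 0" by (rule odd_any[rotated]) (use True \<open>odd b\<close> in simp)
    then show ?thesis using shift1[OF ab(3), of 1] by simp
  qed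
qed

section \<open>Commutative groups inside a type class\<close>

lemma comm_group_monoid: "comm_group G \<Longrightarrow> monoid G"
  by (rule group.is_monoid[OF comm_group.axioms(2)])

text \<open>
  The product of all commutative groups whose elements have type \<open>'a\<close>. Unlike a single group with a
  carrier set, it is a type of class \<open>ab_group_add\<close>; a given group embeds into it as one of the factors.
  The value \<open>undefined\<close> at records that are not commutative groups makes the representation unique.
\<close>

typedef 'a abelian_product =
  "{f :: 'a monoid \<Rightarrow> 'a. \<forall>G. (comm_group G \<longrightarrow> f G \<in> carrier G) \<and> (\<not> comm_group G \<longrightarrow> f G = undefined)}"
  by (rule exI[of _ "\<lambda>G. if comm_group G then \<one>\<^bsub>G\<^esub> else undefined"])
    (simp add: monoid.one_closed comm_group_monoid)

setup_lifting type_definition_abelian_product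

instantiation abelian_product :: (type) ab_group_add
begin

lift_definition zero_abelian_product :: "'a abelian_product"
  is "\<lambda>G. if comm_group G then \<one>\<^bsub>G\<^esub> else undefined"
  by (simp add: monoid.one_closed comm_group_monoid)

lift_definition plus_abelian_product :: "'a abelian_product \<Rightarrow> 'a abelian_product \<Rightarrow> 'a abelian_product"
  is "\<lambda>f g G. if comm_group G then f G \<otimes>\<^bsub>G\<^esub> g G else undefined"
  by (simp add: monoid.m_closed comm_group_monoid)

lift_definition uminus_abelian_product :: "'a abelian_product \<Rightarrow> 'a abelian_product"
  is "\<lambda>f G. if comm_group G then inv\<^bsub>G\<^esub> f G else undefined"
  by (simp add: group.inv_closed comm_group.axioms(2))

definition minus_abelian_product :: "'a abelian_product \<Rightarrow> 'a abelian_product \<Rightarrow> 'a abelian_product"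
  where "minus_abelian_product x y = x + (- y)"

instance
proof
  fix a b c :: "'a abelian_product"
  show "a + b + c = a + (b + c)"
    by transfer (simp add: fun_eq_iff monoid.m_assoc comm_group_monoid)
  show "a + b = b + a"
    by transfer (simp add: fun_eq_iff comm_monoid.m_comm[OF comm_group.axioms(1)])
  show "0 + a = a"
    by transfer (simp add: fun_eq_iff monoid.l_one comm_group_monoid)
  show "- a + a = 0"
    by transfer (simp add: fun_eq_iff group.l_inv comm_group.axioms(2))
  show "a - b = a + (- b)" by (simp add: minus_abelian_product_def)
qed

end

lift_definition inject_factor :: "'a monoid \<Rightarrow> 'a \<Rightarrow> 'a abelian_product"
  is "\<lambda>G x H. if comm_group H then (if H = G \<and> x \<in> carrier G then x else \<one>\<^bsub>H\<^esub>) else undefined"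
  by (simp add: monoid.one_closed comm_group_monoid)

lemma inject_factor_mult:
  assumes "comm_group G" "x \<in> carrier G" "y \<in> carrier G"
  shows "inject_factor G (x \<otimes>\<^bsub>G\<^esub> y) = inject_factor G x + inject_factor G y"
  using assms
  by transfer (simp add: fun_eq_iff monoid.m_closed monoid.l_one monoid.one_closed comm_group_monoid)

lemma inject_factor_eq_0_iff:
  assumes "comm_group G" "x \<in> carrier G"
  shows "inject_factor G x = 0 \<longleftrightarrow> x = \<one>\<^bsub>G\<^esub>"
  using assms by transfer (simp add: fun_eq_iff)

section \<open>Elementary matrices and congruence subgroups\<close>

lemma SL_int_simps [simp]:
  "monoid.mult (SL_int n) = (*)" "one (SL_int n) = 1\<^sub>m n"
  "A \<in> carrier (SL_int n) \<longleftrightarrow> A \<in> carrier_mat n n \<and> det A = 1"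
  by (auto simp: SL_int_def)

lemma square_mult_closed: "A \<in> carrier_mat n n \<Longrightarrow> B \<in> carrier_mat n n \<Longrightarrow> A * B \<in> carrier_mat n n"
  by (rule mult_carrier_mat)

lemma square_mult_assoc: "A \<in> carrier_mat n n \<Longrightarrow> B \<in> carrier_mat n n \<Longrightarrow> C \<in> carrier_mat n n \<Longrightarrow>
  A * B * C = A * (B * C)"
  by (rule assoc_mult_mat)

lemma square_eqI: "A \<in> carrier_mat n n \<Longrightarrow> B \<in> carrier_mat n n \<Longrightarrow>
  (\<And>r c. r < n \<Longrightarrow> c < n \<Longrightarrow> A $$ (r, c) = B $$ (r, c)) \<Longrightarrow> A = B"
  by (intro eq_matI) auto

abbreviation E :: "nat \<Rightarrow> nat \<Rightarrow> nat \<Rightarrow> int \<Rightarrow> int mat" where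
  "E n i j t \<equiv> addrow_mat n t i j"

lemma mult_E_right:
  assumes "A \<in> carrier_mat n n" "i < n" "r < n" "c < n"
  shows "(A * E n i j t) $$ (r, c) = A $$ (r, c) + (if c = j then t * A $$ (r, i) else 0)"
  using assms by (subst addcol_mat[symmetric]) (auto simp: mat_addcol_def)

lemma mult_E_left:
  assumes "A \<in> carrier_mat n n" "j < n" "r < n" "c < n"
  shows "(E n i j t * A) $$ (r, c) = A $$ (r, c) + (if r = i then t * A $$ (j, c) else 0)"
  using assms by (subst addrow_mat[symmetric]) (auto simp: mat_addrow_def)

lemma E_SL: "i \<noteq> j \<Longrightarrow> E n i j t \<in> carrier (SL_int n)"
  by (simp add: det_addrow_mat)

lemma E_index: "r < n \<Longrightarrow> c < n \<Longrightarrow> i \<noteq> j \<Longrightarrow>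
  E n i j t $$ (r, c) = (if r = c then 1 else if r = i \<and> c = j then t else 0)"
  by auto

lemma E_mult_same:
  assumes "i < n" "j < n" "i \<noteq> j"
  shows "E n i j a * E n i j b = E n i j (a + b)"
proof (rule eq_matI)
  show "(E n i j a * E n i j b) $$ (r, c) = E n i j (a + b) $$ (r, c)"
    if "r < dim_row (E n i j (a + b))" "c < dim_col (E n i j (a + b))" for r c
    using that assms by (subst mult_E_right) (auto simp: E_index)
qed (use assms in auto)

lemma E_zero: "i \<noteq> j \<Longrightarrow> E n i j 0 = 1\<^sub>m n"
  by (intro eq_matI) (auto simp: E_index)

lemma E_inverse:
  assumes "i < n" "j < n" "i \<noteq> j"
  shows "E n i j t * E n i j (- t) = 1\<^sub>m n" "E n i j (- t) * E n i j t = 1\<^sub>m n"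
  using E_mult_same[OF assms, of t "- t"] E_mult_same[OF assms, of "- t" t] E_zero assms by auto

lemma inv_E:
  assumes "i < n" "j < n" "i \<noteq> j"
  shows "inv\<^bsub>SL_int n\<^esub> (E n i j t) = E n i j (- t)"
  by (rule group.inv_equality[OF group_SL_int]) (use E_inverse[OF assms] E_SL assms in auto)

lemma E_commutation:
  assumes "i < n" "j < n" "k < n" "i \<noteq> j" "i \<noteq> k" "j \<noteq> k"
  shows "E n i k a * E n k j b = E n i j (a * b) * E n k j b * E n i k a"
proof (rule square_eqI)
  have c: "E n i j (a * b) * E n k j b \<in> carrier_mat n n" by (intro square_mult_closed) simp_all
  show "(E n i k a * E n k j b) $$ (r, c) = (E n i j (a * b) * E n k j b * E n i k a) $$ (r, c)"
    if "r < n" "c < n" for r c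
    using that assms by (simp add: mult_E_right[OF c] mult_E_right E_index del: index_mat_addrow_mat index_mult_mat)
qed (intro square_mult_closed; simp)+

text \<open>
  The relation through which the square of \<open>d\<close> enters: for \<open>a\<close> and \<open>b\<close> divisible by \<open>d\<close> the left side is a
  commutator in the congruence subgroup of level \<open>d\<close>.
\<close>

lemma E_commutator:
  assumes "i < n" "j < n" "k < n" "i \<noteq> j" "i \<noteq> k" "j \<noteq> k"
  shows "E n i k a * E n k j b * E n i k (- a) * E n k j (- b) = E n i j (a * b)"
proof -
  have c: "E n p q t \<in> carrier_mat n n" for p q t by simp
  note mc = square_mult_closed[of _ n] and ma = square_mult_assoc[of _ n]
  have "E n i k a * E n k j b * E n i k (- a) * E n k j (- b) =
     E n i j (a * b) * E n k j b * E n i k a * E n i k (- a) * E n k j (- b)"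
    unfolding E_commutation[OF assms] ..
  also have "\<dots> = E n i j (a * b) * (E n k j b * ((E n i k a * E n i k (- a)) * E n k j (- b)))"
    by (simp add: ma mc)
  also have "\<dots> = E n i j (a * b)" using assms by (simp add: E_inverse)
  finally show ?thesis .
qed

lemma congruence_subgroup_iff:
  "A \<in> congruence_subgroup d n \<longleftrightarrow> A \<in> carrier (SL_int n) \<and>
     (\<forall>i<n. \<forall>j<n. [A $$ (i, j) = (if i = j then 1 else 0)] (mod int d))"
  by (auto simp: congruence_subgroup_def)

lemma E_congruence:
  assumes "i \<noteq> j"
  shows "E n i j (int d * t) \<in> congruence_subgroup d n"
  using E_SL[OF assms, of n "int d * t"] assms
  by (auto simp: congruence_subgroup_iff E_index cong_iff_dvd_diff simp del: index_mat_addrow_mat)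

lemma congruence_subgroup_normal: "congruence_subgroup d n \<lhd> SL_int n"
proof (rule group.normal_invI[OF group_SL_int subgroup_congruence_subgroup])
  interpret G: group "SL_int n" by (rule group_SL_int)
  fix x h assume x: "x \<in> carrier (SL_int n)" and h: "h \<in> congruence_subgroup d n"
  define y where "y = inv\<^bsub>SL_int n\<^esub> x"
  have y: "y \<in> carrier (SL_int n)" "x * y = 1\<^sub>m n"
    using G.inv_closed[OF x] G.r_inv[OF x] by (simp_all add: y_def)
  have hc: "h \<in> carrier (SL_int n)" using h by (simp add: congruence_subgroup_def)
  have carr: "x \<in> carrier_mat n n" "y \<in> carrier_mat n n" "h \<in> carrier_mat n n" using x y hc by auto
  have hone: "[h $$ (i, j) = 1\<^sub>m n $$ (i, j)] (mod int d)" if "i < n" "j < n" for i j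
    using h that by (simp add: congruence_subgroup_def)
  have 1: "[(x * h) $$ (i, j) = (x * 1\<^sub>m n) $$ (i, j)] (mod int d)" if "i < n" "j < n" for i j
    by (rule cong_mat_mult[OF carr(1,1,3) one_carrier_mat cong_refl hone that])
  have xh: "x * h \<in> carrier_mat n n" "x * 1\<^sub>m n \<in> carrier_mat n n"
    using carr by (auto intro: square_mult_closed)
  have xy: "x * 1\<^sub>m n * y = 1\<^sub>m n" using carr y by simp
  have "[(x * h * y) $$ (i, j) = (x * 1\<^sub>m n * y) $$ (i, j)] (mod int d)" if "i < n" "j < n" for i j
    by (rule cong_mat_mult[OF xh carr(2,2) 1 cong_refl that])
  then have "\<forall>i<n. \<forall>j<n. [(x * h * y) $$ (i, j) = 1\<^sub>m n $$ (i, j)] (mod int d)"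
    unfolding xy by blast
  moreover have "x * h * y \<in> carrier (SL_int n)"
    using G.m_closed[OF G.m_closed[OF x hc] y(1)] by simp
  ultimately show "x \<otimes>\<^bsub>SL_int n\<^esub> h \<otimes>\<^bsub>SL_int n\<^esub> inv\<^bsub>SL_int n\<^esub> x \<in> congruence_subgroup d n"
    unfolding congruence_subgroup_def y_def[symmetric] SL_int_simps(1) by blast
qed

section \<open>Matrices supported in a corner of size 3\<close>

text \<open>
  The matrices that differ from the identity in the upper left block of size 3 only; identities between
  them are checked entry by entry.
\<close>

definition corner :: "nat \<Rightarrow> int \<Rightarrow> int \<Rightarrow> int \<Rightarrow> int \<Rightarrow> int \<Rightarrow> int \<Rightarrow> int \<Rightarrow> int \<Rightarrow> int \<Rightarrow> int mat" where
  "corner n a b c d e f g h i = mat n n (\<lambda>(r, s).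
     if r < 3 \<and> s < 3 then [[a, b, c], [d, e, f], [g, h, i]] ! r ! s else if r = s then 1 else 0)"

lemma corner_carrier [simp]: "corner n a b c d e f g h i \<in> carrier_mat n n"
  by (simp add: corner_def)

lemma less_3_cases: "(r::nat) < 3 \<Longrightarrow> r = 0 \<or> r = 1 \<or> r = 2"
  by auto

lemma corner_mult:
  assumes n: "n \<ge> 3"
  shows "corner n a b c d e f g h i * corner n a' b' c' d' e' f' g' h' i' =
    corner n (a * a' + b * d' + c * g') (a * b' + b * e' + c * h') (a * c' + b * f' + c * i')
         (d * a' + e * d' + f * g') (d * b' + e * e' + f * h') (d * c' + e * f' + f * i')
         (g * a' + h * d' + i * g') (g * b' + h * e' + i * h') (g * c' + h * f' + i * i')"
  (is "?A * ?B = ?C")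
proof (rule square_eqI)
  show "?A * ?B \<in> carrier_mat n n" by (rule square_mult_closed) simp_all
  show "?C \<in> carrier_mat n n" by simp
  fix r s assume rs: "r < n" "s < n"
  have split: "{0..<n} = {0..<3} \<union> {3..<n}" using n by auto
  have "(?A * ?B) $$ (r, s) = (\<Sum>k = 0..<n. ?A $$ (r, k) * ?B $$ (k, s))"
    using rs by (simp add: scalar_prod_def corner_def)
  also have "\<dots> = (\<Sum>k = 0..<3. ?A $$ (r, k) * ?B $$ (k, s)) + (\<Sum>k = 3..<n. ?A $$ (r, k) * ?B $$ (k, s))"
    unfolding split by (rule sum.union_disjoint) auto
  also have "(\<Sum>k = 3..<n. ?A $$ (r, k) * ?B $$ (k, s)) = (\<Sum>k = 3..<n. if k = r then (if r = s then 1 else 0) else 0)"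
    using rs by (intro sum.cong) (auto simp: corner_def)
  also have "\<dots> = (if 3 \<le> r \<and> r = s then 1 else 0)" using rs by simp
  also have "(\<Sum>k = 0..<3. ?A $$ (r, k) * ?B $$ (k, s)) =
      ?A $$ (r, 0) * ?B $$ (0, s) + ?A $$ (r, 1) * ?B $$ (1, s) + ?A $$ (r, 2) * ?B $$ (2, s)"
    by (simp add: eval_nat_numeral)
  also have "\<dots> + (if 3 \<le> r \<and> r = s then 1 else 0) = ?C $$ (r, s)"
    using rs n less_3_cases[of r] less_3_cases[of s]
    by (cases "r < 3"; cases "s < 3") (auto simp: corner_def)
  finally show "(?A * ?B) $$ (r, s) = ?C $$ (r, s)" .
qed

lemma E_eq_corner:
  assumes n: "n \<ge> 3"
  shows "E n 0 1 t = corner n 1 t 0 0 1 0 0 0 1" "E n 0 2 t = corner n 1 0 t 0 1 0 0 0 1"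
    "E n 1 0 t = corner n 1 0 0 t 1 0 0 0 1" "E n 1 2 t = corner n 1 0 0 0 1 t 0 0 1"
    "E n 2 0 t = corner n 1 0 0 0 1 0 t 0 1" "E n 2 1 t = corner n 1 0 0 0 1 0 0 t 1"
proof -
  show "E n 0 1 t = corner n 1 t 0 0 1 0 0 0 1"
    by (rule square_eqI) (use n in \<open>auto simp: corner_def less_Suc_eq numeral_3_eq_3\<close>)
  show "E n 0 2 t = corner n 1 0 t 0 1 0 0 0 1"
    by (rule square_eqI) (use n in \<open>auto simp: corner_def less_Suc_eq numeral_3_eq_3\<close>)
  show "E n 1 0 t = corner n 1 0 0 t 1 0 0 0 1"
    by (rule square_eqI) (use n in \<open>auto simp: corner_def less_Suc_eq numeral_3_eq_3\<close>)
  show "E n 1 2 t = corner n 1 0 0 0 1 t 0 0 1"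
    by (rule square_eqI) (use n in \<open>auto simp: corner_def less_Suc_eq numeral_3_eq_3\<close>)
  show "E n 2 0 t = corner n 1 0 0 0 1 0 t 0 1"
    by (rule square_eqI) (use n in \<open>auto simp: corner_def less_Suc_eq numeral_3_eq_3\<close>)
  show "E n 2 1 t = corner n 1 0 0 0 1 0 0 t 1"
    by (rule square_eqI) (use n in \<open>auto simp: corner_def less_Suc_eq numeral_3_eq_3\<close>)
qed

lemma one_corner: "n \<ge> 3 \<Longrightarrow> 1\<^sub>m n = corner n 1 0 0 0 1 0 0 0 1"
  using E_zero[of 0 1 n] E_eq_corner(1)[of n 0] by simp

lemma det_2x2: "det (mat 2 2 f) = f (0, 0) * f (1, 1) - f (0, 1) * (f (1, 0) :: int)"
proof -
  have "det (mat 2 2 f) = (\<Sum>j<2. mat 2 2 f $$ (0, j) * cofactor (mat 2 2 f) 0 j)"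
    by (rule laplace_expansion_row[of _ 2]) auto
  also have "\<dots> = f (0, 0) * f (1, 1) - f (0, 1) * f (1, 0)"
    by (simp add: eval_nat_numeral cofactor_def det_single mat_delete_def)
  finally show ?thesis .
qed

lemma det_corner:
  assumes "n \<ge> 3"
  shows "det (corner n a b 0 c e 0 0 0 1) = a * e - b * c"
proof -
  define f where "f = (\<lambda>(r, s). [[a, b], [c, e]] ! r ! s)"
  have "corner n a b 0 c e 0 0 0 1 = four_block_mat (mat 2 2 f) (0\<^sub>m 2 (n - 2)) (0\<^sub>m (n - 2) 2) (1\<^sub>m (n - 2))"
    (is "_ = ?F")
  proof (rule square_eqI)
    have "?F \<in> carrier_mat (2 + (n - 2)) (2 + (n - 2))" by (rule four_block_carrier_mat) simp_all
    moreover have "2 + (n - 2) = n" using assms by simp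
    ultimately show "?F \<in> carrier_mat n n" by simp
    show "corner n a b 0 c e 0 0 0 1 $$ (r, s) = ?F $$ (r, s)" if "r < n" "s < n" for r s
      using that assms less_3_cases[of r] less_3_cases[of s]
      by (cases "r < 3"; cases "s < 3") (auto simp: corner_def f_def)
  qed simp
  moreover have "det ?F = det (mat 2 2 f) * det (1\<^sub>m (n - 2) :: int mat)"
    by (rule det_four_block_mat_upper_right_zero[of _ 2 _ "n - 2"]) auto
  ultimately show ?thesis by (simp add: det_2x2 f_def)
qed

lemma corner_cong: "a = a' \<Longrightarrow> b = b' \<Longrightarrow> c = c' \<Longrightarrow> d = d' \<Longrightarrow> e = e' \<Longrightarrow> f = f' \<Longrightarrow> g = g' \<Longrightarrow> h = h' \<Longrightarrow> i = i' \<Longrightarrow>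
  corner n a b c d e f g h i = corner n a' b' c' d' e' f' g' h' i'"
  by simp

section \<open>The Mennicke symbol with values in the abelianization\<close>

text \<open>
  The commutator subgroup \<open>N\<close> of the congruence subgroup \<open>\<Gamma>\<close> of level \<open>d\<close> is to be compared with the
  congruence subgroup of level \<open>m = d\<^sup>2\<close>.
\<close>

locale commutator_level =
  fixes n d :: nat
  assumes n3: "n \<ge> 3" and d1: "d \<ge> 1"
begin

abbreviation G where "G \<equiv> SL_int n"
abbreviation \<Gamma> where "\<Gamma> \<equiv> congruence_subgroup d n"
abbreviation N where "N \<equiv> derived (SL_int n) (congruence_subgroup d n)"
abbreviation m :: int where "m \<equiv> int d ^ 2"

interpretation G: group "SL_int n" by (rule group_SL_int)

lemma N_normal: "N \<lhd> SL_int n"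
  by (rule G.derived_is_normal[OF congruence_subgroup_normal])

interpretation N: normal N "SL_int n" by (rule N_normal)
interpretation Q: group "SL_int n Mod N" by (rule N.factorgroup_is_group)

lemma SL_mult: "A \<in> carrier G \<Longrightarrow> B \<in> carrier G \<Longrightarrow> A * B \<in> carrier G"
  using G.m_closed by simp

lemma SL_assoc: "A \<in> carrier G \<Longrightarrow> B \<in> carrier G \<Longrightarrow> C \<in> carrier G \<Longrightarrow> A * B * C = A * (B * C)"
  using G.m_assoc by simp

lemma N_SL: "A \<in> N \<Longrightarrow> A \<in> carrier G"
  using N.subset by blast

lemma N_mult: "A \<in> N \<Longrightarrow> B \<in> N \<Longrightarrow> A * B \<in> N"
  using N.m_closed by simp

lemma N_subset: "N \<subseteq> \<Gamma>"
  by (rule G.derived_incl[OF subset_refl subgroup_congruence_subgroup])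

lemma E_mem_SL: "i \<noteq> j \<Longrightarrow> E n i j t \<in> carrier G"
  by (rule E_SL)

lemma E_conj_N:
  assumes "A \<in> N" "i < n" "j < n" "i \<noteq> j"
  shows "E n i j t * A * E n i j (- t) \<in> N"
  using N.inv_op_closed2[OF E_mem_SL[OF assms(4)] assms(1), of t] inv_E[OF assms(2-4)] by simp

text \<open>
  The third index needed to write the elementary matrix as a commutator exists because \<open>n\<close> is at least 3.
\<close>

lemma E_mem_N:
  assumes "i < n" "j < n" "i \<noteq> j" "m dvd t"
  shows "E n i j t \<in> N"
proof -
  obtain u where "t = m * u" using assms(4) by (elim dvdE)
  then have u: "t = int d * (int d * u)" by (simp add: power2_eq_square)
  have "\<exists>k<3. k \<noteq> i \<and> k \<noteq> j" by presburger
  then obtain k where "k < 3" and k': "k \<noteq> i" "k \<noteq> j" by blast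
  with n3 have k: "k < n" "k \<noteq> i" "k \<noteq> j" by simp_all
  let ?A = "E n i k (int d * 1)" and ?B = "E n k j (int d * u)"
  have AB: "?A \<in> \<Gamma>" "?B \<in> \<Gamma>" using k by (intro E_congruence; simp)+
  have "E n i j t = E n i k (int d) * E n k j (int d * u) * E n i k (- int d) * E n k j (- (int d * u))"
    unfolding u using E_commutator[of i n j k "int d" "int d * u"] assms k by simp
  also have "\<dots> = ?A \<otimes>\<^bsub>G\<^esub> ?B \<otimes>\<^bsub>G\<^esub> inv\<^bsub>G\<^esub> ?A \<otimes>\<^bsub>G\<^esub> inv\<^bsub>G\<^esub> ?B"
    using inv_E[of i n k "int d"] inv_E[of k n j "int d * u"] assms k by simp
  also have "\<dots> \<in> derived_set G \<Gamma>" using AB by blast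
  finally show ?thesis unfolding derived_def by (rule generate.incl)
qed

text \<open>
  Computations modulo \<open>N\<close> take place in the quotient of the whole of \<open>SL(n, \<int>)\<close>, where conjugation by
  elementary matrices is available; on \<open>\<Gamma>\<close> the same cosets form the abelianization.
\<close>

definition q :: "int mat \<Rightarrow> int mat set" where "q A = N #>\<^bsub>G\<^esub> A"

lemma q_closed: "A \<in> carrier G \<Longrightarrow> q A \<in> carrier (G Mod N)"
  using N.r_coset_hom_Mod unfolding q_def hom_def by blast

lemma q_mult: "A \<in> carrier G \<Longrightarrow> B \<in> carrier G \<Longrightarrow> q (A * B) = q A \<otimes>\<^bsub>G Mod N\<^esub> q B"
  using N.r_coset_hom_Mod unfolding q_def hom_def by auto

lemma q_one_iff: "A \<in> carrier G \<Longrightarrow> q A = \<one>\<^bsub>G Mod N\<^esub> \<longleftrightarrow> A \<in> N"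
  unfolding q_def FactGroup_def
  using G.coset_join1[OF _ _ N.is_subgroup] G.coset_join2[OF _ N.is_subgroup] by auto

lemma q_absorb_left: "A \<in> N \<Longrightarrow> B \<in> carrier G \<Longrightarrow> q (A * B) = q B"
  using q_mult[OF N_SL] q_one_iff[OF N_SL] q_closed Q.l_one by metis

lemma q_absorb_right: "A \<in> carrier G \<Longrightarrow> B \<in> N \<Longrightarrow> q (A * B) = q A"
  using q_mult[OF _ N_SL] q_one_iff[OF N_SL] q_closed Q.r_one by metis

definition commute :: "int mat \<Rightarrow> int mat \<Rightarrow> bool" where
  "commute A B \<longleftrightarrow> q (A * B) = q (B * A)"

lemma commute_mult:
  assumes A: "A \<in> carrier G" and B: "B \<in> carrier G" and C: "C \<in> carrier G"
    and "commute A B" "commute A C"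
  shows "commute A (B * C)"
proof -
  have ab: "q A \<otimes>\<^bsub>G Mod N\<^esub> q B = q B \<otimes>\<^bsub>G Mod N\<^esub> q A"
    and ac: "q A \<otimes>\<^bsub>G Mod N\<^esub> q C = q C \<otimes>\<^bsub>G Mod N\<^esub> q A"
    using assms unfolding commute_def by (simp_all add: q_mult)
  note c = q_closed[OF A] q_closed[OF B] q_closed[OF C]
  have "q A \<otimes>\<^bsub>G Mod N\<^esub> (q B \<otimes>\<^bsub>G Mod N\<^esub> q C) = q B \<otimes>\<^bsub>G Mod N\<^esub> (q A \<otimes>\<^bsub>G Mod N\<^esub> q C)"
    using c ab by (metis Q.m_assoc)
  also have "\<dots> = q B \<otimes>\<^bsub>G Mod N\<^esub> q C \<otimes>\<^bsub>G Mod N\<^esub> q A"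
    unfolding ac using c by (simp only: Q.m_assoc)
  finally show ?thesis unfolding commute_def
    using A B C by (simp only: q_mult SL_mult)
qed

lemma q_conj:
  assumes A: "A \<in> carrier G" and g: "g \<in> carrier G" "g' \<in> carrier G" "g * g' = 1\<^sub>m n" and c: "commute A g"
  shows "q (g * A * g') = q A"
proof -
  have "q (g * A * g') = q (g * A) \<otimes>\<^bsub>G Mod N\<^esub> q g'" using A g by (intro q_mult SL_mult)
  also have "q (g * A) = q (A * g)" using c by (simp add: commute_def)
  also have "q (A * g) \<otimes>\<^bsub>G Mod N\<^esub> q g' = q (A * g * g')" using A g by (intro q_mult[symmetric] SL_mult)
  also have "A * g * g' = A * (g * g')" using A g by (intro SL_assoc)
  also have "\<dots> = A" unfolding g(3) using A by (intro right_mult_one_mat[of A n n]) simp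
  finally show ?thesis .
qed

abbreviation Ab where "Ab \<equiv> abelianization (congruence_group d n)"

definition cls :: "int mat \<Rightarrow> int mat set abelian_product" where
  "cls A = inject_factor Ab (q A)"

lemma derived_congruence_group:
  "derived (congruence_group d n) (carrier (congruence_group d n)) = N"
  unfolding congruence_group_def using G.derived_consistent[OF subset_refl subgroup_congruence_subgroup] by simp

lemma Ab_eq: "Ab = congruence_group d n Mod N"
  unfolding abelianization_def derived_congruence_group ..

lemma Ab_comm_group: "comm_group Ab"
  unfolding abelianization_def by (rule group.derived_quot_is_comm_group[OF group_congruence_group])

lemma Ab_hom:
  "A \<in> \<Gamma> \<Longrightarrow> q A \<in> carrier Ab"
  "A \<in> \<Gamma> \<Longrightarrow> B \<in> \<Gamma> \<Longrightarrow> q (A * B) = q A \<otimes>\<^bsub>Ab\<^esub> q B"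
  "\<one>\<^bsub>Ab\<^esub> = N"
proof -
  interpret H: group "congruence_group d n" by (rule group_congruence_group)
  have nrm: "N \<lhd> congruence_group d n"
    using H.derived_is_normal[OF H.normal_self] unfolding derived_congruence_group .
  have q: "q A = N #>\<^bsub>congruence_group d n\<^esub> A" for A
    by (simp add: q_def r_coset_def congruence_group_def)
  have hom: "q \<in> hom (congruence_group d n) (congruence_group d n Mod N)"
    unfolding q using normal.r_coset_hom_Mod[OF nrm] by simp
  have carr: "carrier (congruence_group d n) = \<Gamma>" "A \<otimes>\<^bsub>congruence_group d n\<^esub> B = A * B" for A B
    by (simp_all add: congruence_group_def)
  show "A \<in> \<Gamma> \<Longrightarrow> q A \<in> carrier Ab" "A \<in> \<Gamma> \<Longrightarrow> B \<in> \<Gamma> \<Longrightarrow> q (A * B) = q A \<otimes>\<^bsub>Ab\<^esub> q B"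
    unfolding Ab_eq using hom_in_carrier[OF hom] hom_mult[OF hom] unfolding carr by blast+
  show "\<one>\<^bsub>Ab\<^esub> = N" unfolding Ab_eq by (simp add: FactGroup_def)
qed

lemma \<Gamma>_SL: "A \<in> \<Gamma> \<Longrightarrow> A \<in> carrier G"
  by (simp add: congruence_subgroup_def)

lemma cls_mult: "A \<in> \<Gamma> \<Longrightarrow> B \<in> \<Gamma> \<Longrightarrow> cls (A * B) = cls A + cls B"
  unfolding cls_def Ab_hom(2) by (intro inject_factor_mult Ab_comm_group Ab_hom)

lemma cls_eq_0_iff: "A \<in> \<Gamma> \<Longrightarrow> cls A = 0 \<longleftrightarrow> A \<in> N"
  unfolding cls_def inject_factor_eq_0_iff[OF Ab_comm_group Ab_hom(1)] Ab_hom(3) q_one_iff[OF \<Gamma>_SL, symmetric]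
  by (simp add: FactGroup_def)

definition S :: "int \<Rightarrow> int \<Rightarrow> int \<Rightarrow> int \<Rightarrow> int mat" where
  "S a b c e = corner n a b 0 c e 0 0 0 1"

definition S_valid :: "int \<Rightarrow> int \<Rightarrow> int \<Rightarrow> int \<Rightarrow> bool" where
  "S_valid a b c e \<longleftrightarrow> m dvd a - 1 \<and> m dvd b \<and> m dvd c \<and> m dvd e - 1 \<and> a * e - b * c = 1"

lemma S_carrier: "S_valid a b c e \<Longrightarrow> S a b c e \<in> carrier G"
  by (simp add: S_valid_def S_def det_corner[OF n3])

lemma S_\<Gamma>: assumes "S_valid a b c e" shows "S a b c e \<in> \<Gamma>"
proof -
  have "int d dvd m" by (simp add: power2_eq_square)
  then have "int d dvd a - 1" "int d dvd b" "int d dvd c" "int d dvd e - 1"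
    using assms unfolding S_valid_def by (blast intro: dvd_trans)+
  then show ?thesis using S_carrier[OF assms] less_3_cases n3
    unfolding congruence_subgroup_iff
    by (auto simp: S_def corner_def cong_iff_dvd_diff less_Suc_eq numeral_3_eq_3)
qed

lemmas E_corner = E_eq_corner[OF n3] and corner_product = corner_mult[OF n3]

lemma small_index: "0 < n" "1 < n" "2 < n" "Suc 0 < n"
  using n3 by auto

text \<open>
  The commutator is a product of elementary matrices with entries divisible by \<open>m\<close>, provided that exactly
  one of the two indices lies in the block of \<open>S\<close>. The remaining elementary matrices are commutators of these
  ones, which uses that \<open>n\<close> is at least 3.
\<close>

lemma S_commute_E:
  assumes v: "S_valid a b c e"
  shows "commute (S a b c e) (E n 0 2 t)" "commute (S a b c e) (E n 1 2 t)"
    "commute (S a b c e) (E n 2 0 t)" "commute (S a b c e) (E n 2 1 t)"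
proof -
  note sc = S_carrier[OF v]
  have dv: "m dvd (a - 1) * t" "m dvd c * t" "m dvd b * t" "m dvd (e - 1) * t"
    using v by (simp_all add: S_valid_def)
  have mem: "E n 0 2 ((a - 1) * t) * E n 1 2 (c * t) \<in> N" "E n 0 2 (b * t) * E n 1 2 ((e - 1) * t) \<in> N"
    "E n 2 0 ((a - 1) * t) * E n 2 1 (b * t) \<in> N" "E n 2 0 (c * t) * E n 2 1 ((e - 1) * t) \<in> N"
    by (intro N_mult E_mem_N; use dv small_index in simp)+
  have ec: "E n i j t * S a b c e \<in> carrier G" "S a b c e * E n i j t \<in> carrier G" if "i \<noteq> j" for i j
    by (rule SL_mult[OF E_mem_SL[OF that] sc], rule SL_mult[OF sc E_mem_SL[OF that]])
  have eq: "S a b c e * E n 0 2 t = (E n 0 2 ((a - 1) * t) * E n 1 2 (c * t)) * (E n 0 2 t * S a b c e)"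
    unfolding E_corner S_def corner_product by (rule corner_cong) (simp_all add: algebra_simps)
  show "commute (S a b c e) (E n 0 2 t)"
    unfolding commute_def eq by (rule q_absorb_left[OF mem(1) ec(1)]) simp
  have eq: "S a b c e * E n 1 2 t = (E n 0 2 (b * t) * E n 1 2 ((e - 1) * t)) * (E n 1 2 t * S a b c e)"
    unfolding E_corner S_def corner_product by (rule corner_cong) (simp_all add: algebra_simps)
  show "commute (S a b c e) (E n 1 2 t)"
    unfolding commute_def eq by (rule q_absorb_left[OF mem(2) ec(1)]) simp
  have eq: "E n 2 0 t * S a b c e = (S a b c e * E n 2 0 t) * (E n 2 0 ((a - 1) * t) * E n 2 1 (b * t))"
    unfolding E_corner S_def corner_product by (rule corner_cong) (simp_all add: algebra_simps)
  show "commute (S a b c e) (E n 2 0 t)"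
    unfolding commute_def eq by (rule q_absorb_right[OF ec(2) mem(3), symmetric]) simp
  have eq: "E n 2 1 t * S a b c e = (S a b c e * E n 2 1 t) * (E n 2 0 (c * t) * E n 2 1 ((e - 1) * t))"
    unfolding E_corner S_def corner_product by (rule corner_cong) (simp_all add: algebra_simps)
  show "commute (S a b c e) (E n 2 1 t)"
    unfolding commute_def eq by (rule q_absorb_right[OF ec(2) mem(4), symmetric]) simp
qed

lemma S_commute_E10:
  assumes v: "S_valid a b c e"
  shows "commute (S a b c e) (E n 1 0 t)"
proof -
  have "E n 1 2 t * E n 2 0 1 * E n 1 2 (- t) * E n 2 0 (- 1) = E n 1 0 (t * 1)"
    by (rule E_commutator) (use small_index in auto)
  then have "E n 1 0 t = E n 1 2 t * E n 2 0 1 * E n 1 2 (- t) * E n 2 0 (- 1)" by simp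
  then show ?thesis
    using S_commute_E[OF v] S_carrier[OF v] by (auto intro!: commute_mult SL_mult E_mem_SL)
qed

definition symbol :: "int \<Rightarrow> int \<Rightarrow> int mat set abelian_product" where
  "symbol a b = (SOME x. \<exists>c e. S_valid a b c e \<and> x = cls (S a b c e))"

lemma S_valid_exists:
  assumes "[a = 1] (mod m)" "m dvd b" "coprime a b"
  obtains c e where "S_valid a b c e"
proof -
  \<comment> \<open>adding multiples of the first row to the second makes the lower left entry divisible by \<open>m\<close>\<close>
  obtain e0 c0 where bz: "a * e0 + b * c0 = 1"
    using bezout_int[of a b] assms(3) by (metis coprime_imp_gcd_eq_1 mult.commute)
  have a1: "m dvd a - 1" using assms(1) by (simp add: cong_iff_dvd_diff)
  define c e where "c = (- c0) * (1 - a)" and "e = e0 + c0 * b"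
  have det: "a * e - b * c = 1" using bz unfolding c_def e_def by (simp add: algebra_simps)
  have mc: "m dvd c" unfolding c_def using a1 by (metis dvd_minus_iff dvd_mult minus_diff_eq)
  have "a * (e - 1) = b * c - (a - 1)" using det by (simp add: algebra_simps)
  then have "m dvd a * (e - 1)" using a1 mc assms(2) by simp
  moreover have "coprime m a" using coprime_of_cong_one[OF assms(1)] by (simp add: coprime_commute)
  ultimately have "m dvd e - 1" by (simp add: coprime_dvd_mult_right_iff)
  then show thesis using that a1 assms(2) mc det unfolding S_valid_def by blast
qed

lemma cls_cong: "q A = q B \<Longrightarrow> cls A = cls B"
  by (simp add: cls_def)

text \<open>
  Two completions of the same first row differ by a multiple of it in the second row, and the multiplier is
  divisible by \<open>m\<close>.
\<close>

lemma S_first_row: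
  assumes v: "S_valid a b c e" and w: "S_valid a b c' e'"
  shows "q (S a b c e) = q (S a b c' e')"
proof -
  have 1: "a * e - b * c = 1" "a * e' - b * c' = 1" using v w by (simp_all add: S_valid_def)
  define t where "t = c' * e - e' * c"
  have c': "c' = c + t * a" and e': "e' = e + t * b" 
  proof -
    have ae: "a * e = 1 + b * c" "a * e' = 1 + b * c'" using 1 by simp_all
    have "t * a = c' * (a * e) - c * (a * e')" "t * b = e * (b * c') - e' * (b * c)"
      unfolding t_def by (simp_all add: algebra_simps)
    moreover have "e * (b * c') - e' * (b * c) = e * (a * e' - 1) - e' * (a * e - 1)"
      using ae by simp
    then have "e * (b * c') - e' * (b * c) = e' - e" by (simp add: algebra_simps)
    ultimately show "c' = c + t * a" "e' = e + t * b" unfolding ae by (simp_all add: algebra_simps)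
  qed
  have "m dvd c' * e" "m dvd e' * c" using v w by (simp_all add: S_valid_def)
  then have "m dvd t" unfolding t_def by simp
  then have tN: "E n 1 0 t \<in> N" by (rule E_mem_N[OF small_index(2,1) one_neq_zero])
  have eq: "S a b c' e' = E n 1 0 t * S a b c e"
    unfolding E_corner S_def corner_product c' e' by (rule corner_cong) (simp_all add: algebra_simps)
  show ?thesis unfolding eq by (rule q_absorb_left[OF tN S_carrier[OF v], symmetric])
qed

lemma symbol_eq:
  assumes "S_valid a b c e"
  shows "symbol a b = cls (S a b c e)"
proof -
  have "\<exists>c e. S_valid a b c e \<and> symbol a b = cls (S a b c e)"
    unfolding symbol_def by (rule someI_ex) (use assms in blast)
  then show ?thesis using S_first_row[OF assms] cls_cong by metis
qed

end

context commutator_level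
begin

interpretation G: group "SL_int n" by (rule group_SL_int)
interpretation N: normal N "SL_int n" by (rule N_normal)

lemma symbol_shift_first:
  assumes "[a = 1] (mod m)" "m dvd b" "coprime a b"
  shows "symbol (a + t * b) b = symbol a b"
proof -
  obtain c e where v: "S_valid a b c e" using S_valid_exists[OF assms] .
  define c' e' where "c' = c + e * t - t * (a + t * b)" and "e' = e - t * b"
  have eq: "E n 1 0 (- t) * S a b c e * E n 1 0 t = S (a + t * b) b c' e'"
    unfolding E_corner S_def corner_product c'_def e'_def by (rule corner_cong) (simp_all add: algebra_simps)
  have "a * e - b * c = 1" using v by (simp add: S_valid_def)
  then have det: "(a + t * b) * e' - b * c' = 1" unfolding c'_def e'_def by (simp add: algebra_simps)
  have dv: "m dvd a - 1" "m dvd b" "m dvd c" "m dvd e - 1" using v by (simp_all add: S_valid_def)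
  have "m dvd (a - 1) + t * b" "m dvd c + (e - 1) * t - t * (a - 1) - t * (t * b)" "m dvd (e - 1) - t * b"
    using dv by (auto intro!: dvd_add dvd_diff)
  then have v': "S_valid (a + t * b) b c' e'"
    unfolding S_valid_def using det dv by (simp add: c'_def e'_def algebra_simps)
  have "q (E n 1 0 (- t) * S a b c e * E n 1 0 t) = q (S a b c e)"
    by (rule q_conj[OF S_carrier[OF v] E_mem_SL E_mem_SL E_inverse(2) S_commute_E10[OF v]])
      (use small_index in auto)
  then show ?thesis unfolding symbol_eq[OF v] symbol_eq[OF v'] eq by (rule cls_cong)
qed

lemma symbol_shift_second:
  assumes "[a = 1] (mod m)" "m dvd b" "coprime a b"
  shows "symbol a (b + t * m * a) = symbol a b"
proof -
  obtain c e where v: "S_valid a b c e" using S_valid_exists[OF assms] .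
  have eq: "S a b c e * E n 0 1 (t * m) = S a (b + t * m * a) c (e + t * m * c)"
    unfolding E_corner S_def corner_product by (rule corner_cong) (simp_all add: algebra_simps)
  have "a * e - b * c = 1" using v by (simp add: S_valid_def)
  then have det: "a * (e + t * m * c) - (b + t * m * a) * c = 1" by (simp add: algebra_simps)
  have dv: "m dvd a - 1" "m dvd b" "m dvd c" "m dvd e - 1" using v by (simp_all add: S_valid_def)
  have "m dvd (e - 1) + t * m * c" "m dvd b + t * m * a" using dv by (auto intro!: dvd_add)
  then have v': "S_valid a (b + t * m * a) c (e + t * m * c)"
    unfolding S_valid_def using det dv by (simp add: algebra_simps)
  have "q (S a b c e * E n 0 1 (t * m)) = q (S a b c e)"
    by (rule q_absorb_right[OF S_carrier[OF v] E_mem_N]) (use small_index in auto)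
  then show ?thesis unfolding symbol_eq[OF v] symbol_eq[OF v'] eq by (rule cls_cong)
qed

lemma symbol_neg_second:
  assumes "[a = 1] (mod m)" "m dvd b" "coprime a b"
  shows "symbol a (- b) = symbol a b"
proof -
  obtain c e where v: "S_valid a b c e" using S_valid_exists[OF assms] .
  define w where "w = E n 1 2 1 * E n 2 1 (- 1) * E n 1 2 1"
  have wc: "w \<in> carrier G" unfolding w_def by (intro SL_mult E_mem_SL) auto
  have cw: "commute (S a b c e) w"
    unfolding w_def by (intro commute_mult S_commute_E[OF v] S_carrier[OF v] SL_mult E_mem_SL) auto
  have ww: "w * w = corner n 1 0 0 0 (-1) 0 0 0 (-1)"
    unfolding w_def E_corner corner_product by (rule corner_cong) simp_all
  have inv: "(w * w) * (w * w) = 1\<^sub>m n"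
    unfolding ww one_corner[OF n3] corner_product by (rule corner_cong) simp_all
  have eq: "(w * w) * S a b c e * (w * w) = S a (- b) (- c) e"
    unfolding ww S_def corner_product by (rule corner_cong) simp_all
  have v': "S_valid a (- b) (- c) e" using v by (simp add: S_valid_def)
  have "q ((w * w) * S a b c e * (w * w)) = q (S a b c e)"
    by (rule q_conj[OF S_carrier[OF v] SL_mult[OF wc wc] SL_mult[OF wc wc] inv
          commute_mult[OF S_carrier[OF v] wc wc cw cw]])
  then show ?thesis unfolding symbol_eq[OF v] symbol_eq[OF v'] eq by (rule cls_cong)
qed

lemma lower_block_mem_N:
  assumes "m dvd a - 1" "m dvd v" "m dvd u"
  shows "E n 2 1 s * (E n 2 1 (-1) * (E n 2 1 v * E n 1 2 (a - 1)) * E n 2 1 1 * E n 1 2 u) * E n 2 1 (- s) \<in> N"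
proof -
  note i = small_index(3,2)
  have ne: "(1::nat) \<noteq> 2" "(2::nat) \<noteq> 1" by simp_all
  have 1: "E n 2 1 v * E n 1 2 (a - 1) \<in> N"
    by (rule N_mult[OF E_mem_N[OF i ne(2) assms(2)] E_mem_N[OF i(2,1) ne(1) assms(1)]])
  have 2: "E n 2 1 (-1) * (E n 2 1 v * E n 1 2 (a - 1)) * E n 2 1 1 \<in> N"
    using E_conj_N[OF 1 i ne(2), of "-1"] by (simp only: minus_minus)
  have 3: "E n 2 1 (-1) * (E n 2 1 v * E n 1 2 (a - 1)) * E n 2 1 1 * E n 1 2 u \<in> N"
    by (rule N_mult[OF 2 E_mem_N[OF i(2,1) ne(1) assms(3)]])
  show ?thesis by (rule E_conj_N[OF 3 i ne(2)])
qed

text \<open>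
  Put the two factors into the index pairs (0, 1) and (0, 2). After conjugation by an elementary matrix, their
  product has first row \<open>(a a', b, 0)\<close>, so up to elements of \<open>N\<close> it is the matrix of \<open>(a a', b)\<close> times a matrix
  \<open>Y\<close> in the index pair (1, 2). That matrix is built from elementary matrices in \<open>N\<close> by multiplications and conjugations.
\<close>

lemma symbol_mult_first:
  assumes a: "[a = 1] (mod m)" "[a' = 1] (mod m)" and b: "m dvd b" and ab: "coprime a b" "coprime a' b"
  shows "symbol (a * a') b = symbol a b + symbol a' b"
proof -
  obtain c e where v: "S_valid a b c e" using S_valid_exists[OF a(1) b ab(1)] .
  obtain c' e' where v': "S_valid a' b c' e'" using S_valid_exists[OF a(2) b ab(2)] .
  have aa: "[a * a' = 1] (mod m)" "coprime (a * a') b" using cong_mult[OF a] ab by simp_all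
  obtain h k where v'': "S_valid (a * a') b h k" using S_valid_exists[OF aa(1) b aa(2)] .
  let ?S = "S a b c e" and ?S' = "S a' b c' e'" and ?S'' = "S (a * a') b h k"
  note sc = S_carrier[OF v] S_carrier[OF v'] S_carrier[OF v'']
  define w w' where "w = E n 1 2 (-1) * E n 2 1 1 * E n 1 2 (-1)" and "w' = E n 1 2 1 * E n 2 1 (-1) * E n 1 2 1"
  have wB: "w = corner n 1 0 0 0 0 (-1) 0 1 0" "w' = corner n 1 0 0 0 0 1 0 (-1) 0"
    unfolding w_def w'_def E_corner corner_product by (rule corner_cong; simp)+
  have wc: "w \<in> carrier G" "w' \<in> carrier G" unfolding w_def w'_def by (intro SL_mult E_mem_SL; simp)+
  have ww: "w * w' = 1\<^sub>m n" unfolding wB one_corner[OF n3] corner_product by (rule corner_cong) simp_all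
  have cw: "commute ?S' w"
    unfolding w_def by (intro commute_mult S_commute_E[OF v'] sc SL_mult E_mem_SL) auto
  \<comment> \<open>the second factor, moved to rows and columns 0 and 2, where it does not overlap the first one\<close>
  define T where "T = w * ?S' * w'"
  have Tc: "T \<in> carrier G" unfolding T_def by (intro SL_mult wc sc)
  have qT: "q T = q ?S'" unfolding T_def by (rule q_conj[OF sc(2) wc ww cw])
  have TB: "T = corner n a' 0 b 0 1 0 c' 0 e'" unfolding T_def wB S_def corner_product by (rule corner_cong) simp_all
  let ?U = "E n 1 2 a" and ?U' = "E n 1 2 (- a)"
  have Uc: "?U \<in> carrier G" "?U' \<in> carrier G" by (intro E_mem_SL; simp)+
  have UU: "?U * ?U' = 1\<^sub>m n" by (rule E_inverse) (use small_index in auto)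
  have qST: "q (?S * T) = q (?S * ?S')" using qT sc Tc by (simp only: q_mult)
  have comm: "commute (?S * T) ?U"
  proof -
    have 1: "q (?S * ?U) = q (?U * ?S)" "q (?S' * ?U) = q (?U * ?S')"
      using S_commute_E(2)[OF v] S_commute_E(2)[OF v'] by (simp_all only: commute_def)
    interpret Q: group "SL_int n Mod N" by (rule N.factorgroup_is_group)
    have "q (?S * T * ?U) = q ?S \<otimes>\<^bsub>G Mod N\<^esub> (q ?S' \<otimes>\<^bsub>G Mod N\<^esub> q ?U)"
      using qT sc Tc Uc q_closed by (simp only: q_mult SL_mult Q.m_assoc)
    also have "q ?S' \<otimes>\<^bsub>G Mod N\<^esub> q ?U = q ?U \<otimes>\<^bsub>G Mod N\<^esub> q ?S'" using 1(2) sc Uc by (simp only: q_mult)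
    also have "q ?S \<otimes>\<^bsub>G Mod N\<^esub> (q ?U \<otimes>\<^bsub>G Mod N\<^esub> q ?S') = (q ?S \<otimes>\<^bsub>G Mod N\<^esub> q ?U) \<otimes>\<^bsub>G Mod N\<^esub> q ?S'"
      using sc Uc q_closed by (simp only: Q.m_assoc)
    also have "q ?S \<otimes>\<^bsub>G Mod N\<^esub> q ?U = q ?U \<otimes>\<^bsub>G Mod N\<^esub> q ?S" using 1(1) sc Uc by (simp only: q_mult)
    also have "q ?U \<otimes>\<^bsub>G Mod N\<^esub> q ?S \<otimes>\<^bsub>G Mod N\<^esub> q ?S' = q (?U * (?S * T))"
      using qT sc Tc Uc q_closed by (simp only: q_mult SL_mult Q.m_assoc)
    finally show ?thesis unfolding commute_def .
  qed
  define Y where "Y = E n 2 1 a' * (E n 2 1 (-1) * (E n 2 1 (1 - a') * E n 1 2 (a - 1)) * E n 2 1 1 * E n 1 2 (e' - 1)) * E n 2 1 (- a')"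
  define V where "V = E n 1 0 ((c * a' + a * c') * k - e * h) * E n 2 0 (c' * k)"
  have dv: "m dvd a - 1" "m dvd 1 - a'" "m dvd e' - 1" "m dvd c" "m dvd c'" "m dvd h"
    using v v' v'' by (simp_all add: S_valid_def dvd_diff_commute)
  have YN: "Y \<in> N" unfolding Y_def by (rule lower_block_mem_N[OF dv(1-3)])
  have "m dvd (c * a' + a * c') * k - e * h" "m dvd c' * k"
    by (rule dvd_diff[OF dvd_mult2[OF dvd_add[OF dvd_mult2[OF dv(4)] dvd_mult[OF dv(5)]]] dvd_mult[OF dv(6)]],
        rule dvd_mult2[OF dv(5)])
  then have VN: "V \<in> N" unfolding V_def by (intro N_mult E_mem_N small_index) simp_all
  have h: "a * e - b * c = 1" "a' * e' - b * c' = 1" "a * a' * k - b * h = 1"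
    using v v' v'' by (simp_all add: S_valid_def)
  have YB: "Y = corner n 1 0 0 0 (a + a' - a * a' * e') (a * e' - 1) 0 (1 - a' * e') e'"
    unfolding Y_def E_corner corner_product by (rule corner_cong) (simp_all add: algebra_simps)
  \<comment> \<open>the five entries of the product that need the determinant relations\<close>
  have e10: "((c * a' + a * c') * k - e * h) * (a * a') + (a + a' - a * a' * e') * h = c * a' + a * c'"
  proof -
    have "((c * a' + a * c') * k - e * h) * (a * a') + (a + a' - a * a' * e') * h - (c * a' + a * c')
      = (c * a' + a * c') * (a * a' * k - b * h - 1) - h * a' * (a * e - b * c - 1) - h * a * (a' * e' - b * c' - 1)"
      by (simp add: algebra_simps)
    then show ?thesis using h by simp
  qed
  have e11: "((c * a' + a * c') * k - e * h) * b + (a + a' - a * a' * e') * k = e"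
  proof -
    have "((c * a' + a * c') * k - e * h) * b + (a + a' - a * a' * e') * k - e
      = e * (a * a' * k - b * h - 1) - k * a' * (a * e - b * c - 1) - k * a * (a' * e' - b * c' - 1)"
      by (simp add: algebra_simps)
    then show ?thesis using h by simp
  qed
  have e12: "c * b + a * e' - e * a = a * e' - 1" using h(1) by (simp add: algebra_simps)
  have e20: "c' * k * (a * a') + (1 - a' * e') * h = c'"
  proof -
    have "c' * k * (a * a') + (1 - a' * e') * h - c' = c' * (a * a' * k - b * h - 1) - h * (a' * e' - b * c' - 1)"
      by (simp add: algebra_simps)
    then show ?thesis using h by simp
  qed
  have e21: "c' * k * b + (1 - a' * e') * k = 0"
  proof -
    have "c' * k * b + (1 - a' * e') * k = - k * (a' * e' - b * c' - 1)" by (simp add: algebra_simps)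
    then show ?thesis using h by simp
  qed
  have eq: "?U * (?S * T) * ?U' = V * Y * ?S''"
    unfolding TB YB V_def E_corner S_def corner_product
    by (rule corner_cong) (use e10 e11 e12 e20 e21 in simp_all)
  have "q (?S * T) = q (?U * (?S * T) * ?U')"
    by (rule q_conj[OF SL_mult[OF sc(1) Tc] Uc UU comm, symmetric])
  also have "\<dots> = q (V * Y * ?S'')" unfolding eq ..
  also have "\<dots> = q ?S''" by (rule q_absorb_left[OF N_mult[OF VN YN] sc(3)])
  finally have "q (?S * ?S') = q ?S''" unfolding qST .
  then have "cls ?S'' = cls (?S * ?S')" by (intro cls_cong) simp
  also have "\<dots> = cls ?S + cls ?S'" by (rule cls_mult[OF S_\<Gamma>[OF v] S_\<Gamma>[OF v']])
  finally show ?thesis unfolding symbol_eq[OF v] symbol_eq[OF v'] symbol_eq[OF v''] .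
qed

text \<open>
  The class of \<open>S\<close> in the abelianization is a Mennicke symbol, hence trivial.
\<close>

lemma S_mem_N:
  assumes v: "S_valid a b c e"
  shows "S a b c e \<in> N"
proof -
  have "symbol a b = 0"
  proof (rule mennicke_symbol_trivial[of m symbol])
    show "m > 0" using d1 by simp
    show "coprime a b"
    proof (rule coprimeI)
      fix k assume "k dvd a" "k dvd b"
      then have "k dvd a * e - b * c" by (intro dvd_diff dvd_mult2)
      then show "is_unit k" using v by (simp add: S_valid_def)
    qed
  qed (use v symbol_shift_first symbol_shift_second symbol_mult_first symbol_neg_second in
        \<open>auto simp: S_valid_def cong_iff_dvd_diff\<close>)
  then show ?thesis using symbol_eq[OF v] cls_eq_0_iff[OF S_\<Gamma>[OF v]] by simp
qed

end

section \<open>Reduction of congruence matrices to the corner\<close>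

context commutator_level
begin

interpretation G: group "SL_int n" by (rule group_SL_int)
interpretation N: normal N "SL_int n" by (rule N_normal)

abbreviation \<Lambda> where "\<Lambda> \<equiv> congruence_subgroup (d ^ 2) n"

interpretation L: normal \<Lambda> "SL_int n" by (rule congruence_subgroup_normal)

lemma \<Lambda>_SL: "A \<in> \<Lambda> \<Longrightarrow> A \<in> carrier G"
  by (simp add: congruence_subgroup_def)

lemma \<Lambda>_carrier: "A \<in> \<Lambda> \<Longrightarrow> A \<in> carrier_mat n n"
  using \<Lambda>_SL by simp

lemma E_\<Lambda>: "i \<noteq> j \<Longrightarrow> m dvd t \<Longrightarrow> E n i j t \<in> \<Lambda>"
  using E_congruence[of i j n "d ^ 2"] by (auto simp: of_nat_power)

lemma \<Lambda>_entry: "A \<in> \<Lambda> \<Longrightarrow> i < n \<Longrightarrow> j < n \<Longrightarrow> m dvd A $$ (i, j) - (if i = j then 1 else 0)"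
  by (simp add: congruence_subgroup_iff cong_iff_dvd_diff of_nat_power)

definition block :: "nat \<Rightarrow> int mat \<Rightarrow> bool" where
  "block k A \<longleftrightarrow> (\<forall>i<n. \<forall>j<n. k \<le> i \<or> k \<le> j \<longrightarrow> A $$ (i, j) = (if i = j then 1 else 0))"

lemma right_operation:
  assumes A: "A \<in> \<Lambda>" "block k A" and ij: "i < k" "j < k" "i \<noteq> j" "k \<le> n" and t: "m dvd t"
  shows "A * E n i j t \<in> \<Lambda>" "block k (A * E n i j t)" "A * E n i j t \<in> N \<Longrightarrow> A \<in> N"
proof -
  have ijn: "i < n" "j < n" using ij by simp_all
  note Ac = \<Lambda>_carrier[OF A(1)]
  show "A * E n i j t \<in> \<Lambda>" using L.m_closed[OF A(1) E_\<Lambda>[OF ij(3) t]] by simp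
  show "block k (A * E n i j t)"
    unfolding block_def
  proof (intro allI impI)
    fix r c assume rc: "r < n" "c < n" "k \<le> r \<or> k \<le> c"
    have "c \<noteq> j \<or> A $$ (r, i) = 0" using rc ij A(2) ijn unfolding block_def by auto
    then show "(A * E n i j t) $$ (r, c) = (if r = c then 1 else 0)"
      unfolding mult_E_right[OF Ac ijn(1) rc(1,2)] using A(2) rc unfolding block_def by auto
  qed
  assume "A * E n i j t \<in> N"
  then have "A * E n i j t * E n i j (- t) \<in> N"
    by (rule N_mult[OF _ E_mem_N[OF ijn ij(3)]]) (use t in simp)
  also have "A * E n i j t * E n i j (- t) = A * (E n i j t * E n i j (- t))"
    by (rule square_mult_assoc[OF Ac]) simp_all
  also have "\<dots> = A" unfolding E_inverse(1)[OF ijn ij(3)] using Ac by (rule right_mult_one_mat)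
  finally show "A \<in> N" .
qed

lemma left_operation:
  assumes A: "A \<in> \<Lambda>" "block k A" and ij: "i < k" "j < k" "i \<noteq> j" "k \<le> n" and t: "m dvd t"
  shows "E n i j t * A \<in> \<Lambda>" "block k (E n i j t * A)" "E n i j t * A \<in> N \<Longrightarrow> A \<in> N"
proof -
  have ijn: "i < n" "j < n" using ij by simp_all
  note Ac = \<Lambda>_carrier[OF A(1)]
  show "E n i j t * A \<in> \<Lambda>" using L.m_closed[OF E_\<Lambda>[OF ij(3) t] A(1)] by simp
  show "block k (E n i j t * A)"
    unfolding block_def
  proof (intro allI impI)
    fix r c assume rc: "r < n" "c < n" "k \<le> r \<or> k \<le> c"
    have "r \<noteq> i \<or> A $$ (j, c) = 0" using rc ij A(2) ijn unfolding block_def by auto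
    then show "(E n i j t * A) $$ (r, c) = (if r = c then 1 else 0)"
      unfolding mult_E_left[OF Ac ijn(2) rc(1,2)] using A(2) rc unfolding block_def by auto
  qed
  assume EA: "E n i j t * A \<in> N"
  have "m dvd - t" using t by simp
  from N_mult[OF E_mem_N[OF ijn ij(3) this] EA] have "E n i j (- t) * (E n i j t * A) \<in> N" .
  also have "E n i j (- t) * (E n i j t * A) = (E n i j (- t) * E n i j t) * A"
    by (rule square_mult_assoc[symmetric, OF _ _ Ac]) simp_all
  also have "\<dots> = A" unfolding E_inverse(2)[OF ijn ij(3)] using Ac by (rule left_mult_one_mat)
  finally show "A \<in> N" .
qed

text \<open>
  Conjugation changes the rows other than \<open>i\<close> by a column operation only, with an arbitrary integer \<open>t\<close>; by
  contrast one-sided operations need multiples of \<open>m\<close> to stay in the same class modulo \<open>N\<close>.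
\<close>

lemma conj_operation:
  fixes t :: int
  assumes A: "A \<in> \<Lambda>" "block k A" and ij: "i < k" "j < k" "i \<noteq> j" "k \<le> n"
  defines "A' \<equiv> E n i j (- t) * (A * E n i j t)"
  shows "A' \<in> \<Lambda>" "block k A'" "A' \<in> N \<Longrightarrow> A \<in> N"
    "\<And>r c. r < n \<Longrightarrow> c < n \<Longrightarrow> r \<noteq> i \<Longrightarrow> A' $$ (r, c) = A $$ (r, c) + (if c = j then t * A $$ (r, i) else 0)"
proof -
  have ijn: "i < n" "j < n" using ij by simp_all
  note Ac = \<Lambda>_carrier[OF A(1)]
  have Ec: "E n i j s \<in> carrier_mat n n" for s by simp
  have AEc: "A * E n i j t \<in> carrier_mat n n" by (rule square_mult_closed[OF Ac Ec])
  have A'_eq: "A' = E n i j (- t) * A * E n i j t"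
    unfolding A'_def by (rule square_mult_assoc[symmetric, OF Ec Ac Ec])
  show "A' \<in> \<Lambda>"
    using L.inv_op_closed2[OF E_mem_SL[OF ij(3)] A(1), of "- t"] inv_E[OF ijn ij(3), of "- t"]
    unfolding A'_eq by simp
  have entry: "A' $$ (r, c) = (A * E n i j t) $$ (r, c) + (if r = i then - t * (A * E n i j t) $$ (j, c) else 0)"
    if "r < n" "c < n" for r c
    unfolding A'_def by (rule mult_E_left[OF AEc ijn(2) that])
  show "A' $$ (r, c) = A $$ (r, c) + (if c = j then t * A $$ (r, i) else 0)"
    if "r < n" "c < n" "r \<noteq> i" for r c
    unfolding entry[OF that(1,2)] mult_E_right[OF Ac ijn(1) that(1,2)] using that(3) by simp
  show "block k A'"
    unfolding block_def
  proof (intro allI impI)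
    fix r c assume rc: "r < n" "c < n" "k \<le> r \<or> k \<le> c"
    have AE: "(A * E n i j t) $$ (p, c) = (if p = c then 1 else 0)" if p: "p < n" "k \<le> p \<or> k \<le> c" for p
    proof -
      have "c \<noteq> j \<or> A $$ (p, i) = 0" using p rc ij A(2) ijn unfolding block_def by auto
      then show ?thesis
        unfolding mult_E_right[OF Ac ijn(1) p(1) rc(2)] using A(2) rc p unfolding block_def by auto
    qed
    show "A' $$ (r, c) = (if r = c then 1 else 0)"
      unfolding entry[OF rc(1,2)] using AE[OF rc(1,3)] AE[OF ijn(2)] rc ij by auto
  qed
  assume "A' \<in> N"
  then have "E n i j t * A' * E n i j (- t) \<in> N" by (rule E_conj_N[OF _ ijn ij(3)])
  also have "E n i j t * A' * E n i j (- t) = (E n i j t * E n i j (- t)) * (A * (E n i j t * E n i j (- t)))"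
    unfolding A'_def by (simp only: square_mult_assoc[of _ n] square_mult_closed[of _ n] Ec Ac)
  also have "\<dots> = A" unfolding E_inverse(1)[OF ijn ij(3)] using Ac by simp
  finally show "A \<in> N" .
qed

lemma block_2_mem_N:
  assumes A: "A \<in> \<Lambda>" "block 2 A"
  shows "A \<in> N"
proof -
  have eq: "A = S (A $$ (0, 0)) (A $$ (0, 1)) (A $$ (1, 0)) (A $$ (1, 1))"
    unfolding S_def
  proof (rule square_eqI[OF \<Lambda>_carrier[OF A(1)] corner_carrier])
    show "A $$ (r, c) = corner n (A $$ (0, 0)) (A $$ (0, 1)) 0 (A $$ (1, 0)) (A $$ (1, 1)) 0 0 0 1 $$ (r, c)"
      if rc: "r < n" "c < n" for r c
    proof (cases "2 \<le> r \<or> 2 \<le> c")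
      case True
      then have "A $$ (r, c) = (if r = c then 1 else 0)" using A(2) rc unfolding block_def by blast
      then show ?thesis using True rc by (auto simp: corner_def less_Suc_eq numeral_3_eq_3)
    next
      case False
      then have "r = 0 \<or> r = 1" "c = 0 \<or> c = 1" by auto
      then show ?thesis using rc n3 by (auto simp: corner_def)
    qed
  qed
  have "det A = A $$ (0, 0) * A $$ (1, 1) - A $$ (0, 1) * A $$ (1, 0)"
    by (subst eq) (simp only: S_def det_corner[OF n3])
  then have "S_valid (A $$ (0, 0)) (A $$ (0, 1)) (A $$ (1, 0)) (A $$ (1, 1))"
    using \<Lambda>_entry[OF A(1), of 0 0] \<Lambda>_entry[OF A(1), of 0 1] \<Lambda>_entry[OF A(1), of 1 0] \<Lambda>_entry[OF A(1), of 1 1]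
      \<Lambda>_SL[OF A(1)] small_index unfolding S_valid_def by simp
  from S_mem_N[OF this] show ?thesis unfolding eq[symmetric] .
qed

text \<open>
  Row \<open>k\<close> is already a unit vector, so multiples of it clear column \<open>k\<close> without further damage; the entries from row \<open>j\<close>
  onwards have been cleared.
\<close>

lemma unit_row_mem_N:
  assumes k: "k < n" and IH: "\<And>A. A \<in> \<Lambda> \<Longrightarrow> block k A \<Longrightarrow> A \<in> N"
  shows "A \<in> \<Lambda> \<Longrightarrow> block (Suc k) A \<Longrightarrow> (\<And>c. c \<le> k \<Longrightarrow> A $$ (k, c) = (if c = k then 1 else 0)) \<Longrightarrow>
    (\<And>l. j \<le> l \<Longrightarrow> l < k \<Longrightarrow> A $$ (l, k) = 0) \<Longrightarrow> A \<in> N"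
proof (induction j arbitrary: A)
  case 0
  have "block k A"
    unfolding block_def
  proof (intro allI impI)
    fix r c assume rc: "r < n" "c < n" "k \<le> r \<or> k \<le> c"
    consider "Suc k \<le> r \<or> Suc k \<le> c" | "r = k" "c \<le> k" | "r < k" "c = k" using rc(3) by linarith
    then show "A $$ (r, c) = (if r = c then 1 else 0)"
    proof cases
      case 1 then show ?thesis using 0(2) rc unfolding block_def by blast
    next
      case 2 then show ?thesis using 0(3)[of c] by auto
    next
      case 3 then show ?thesis using 0(4)[of r] by simp
    qed
  qed
  then show ?case using IH 0(1) by blast
next
  case (Suc j)
  show ?case
  proof (cases "j < k")
    case False
    then show ?thesis using Suc by (intro Suc.IH) auto
  next
    case True
    define t where "t = - A $$ (j, k)"
    have t: "m dvd t" using \<Lambda>_entry[OF Suc.prems(1), of j k] True k by (simp add: t_def)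
    have op: "j < Suc k" "k < Suc k" "j \<noteq> k" "Suc k \<le> n" using True k by simp_all
    note L = left_operation[OF Suc.prems(1,2) op t]
    note entry = mult_E_left[OF \<Lambda>_carrier[OF Suc.prems(1)] k, where i = j and t = t]
    have "E n j k t * A \<in> N"
    proof (rule Suc.IH[OF L(1,2)])
      show "(E n j k t * A) $$ (k, c) = (if c = k then 1 else 0)" if "c \<le> k" for c
        using that k True Suc.prems(3)[OF that] by (simp add: entry del: index_mult_mat)
      show "(E n j k t * A) $$ (l, k) = 0" if "j \<le> l" "l < k" for l
      proof -
        have "(E n j k t * A) $$ (l, k) = A $$ (l, k) + (if l = j then t * A $$ (k, k) else 0)"
          by (rule entry) (use that k in simp_all)
        also have "\<dots> = 0" using that Suc.prems(3)[of k] Suc.prems(4)[of l] by (auto simp: t_def)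
        finally show ?thesis .
      qed
    qed
    then show ?thesis by (rule L(3))
  qed
qed

text \<open>
  Row \<open>k\<close> has the single off-diagonal entry \<open>g\<close>, prime to the diagonal entry. A second column \<open>j\<close> is
  needed as working space: this is where a block of size at least 3 is used.
\<close>

lemma two_entry_row_mem_N:
  assumes k: "k < n" and IH: "\<And>A. A \<in> \<Lambda> \<Longrightarrow> block k A \<Longrightarrow> A \<in> N"
    and A: "A \<in> \<Lambda>" "block (Suc k) A" and ij: "i < k" "j < k" "i \<noteq> j"
    and row: "\<And>l. l < k \<Longrightarrow> l \<noteq> i \<Longrightarrow> A $$ (k, l) = 0"
  shows "A \<in> N"
proof -
  have kk: "Suc k \<le> n" "i < Suc k" "j < Suc k" "k < Suc k" "i \<noteq> k" "j \<noteq> k" "k \<noteq> i" "k \<noteq> j" "j \<noteq> i"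
    "i < n" "j < n" using k ij by simp_all
  define g x where "g = A $$ (k, i)" and "x = A $$ (k, k)"
  have mg: "m dvd g" using \<Lambda>_entry[OF A(1) k kk(10)] kk by (simp add: g_def)
  have mx: "m dvd x - 1" using \<Lambda>_entry[OF A(1) k k] by (simp add: x_def)
  then obtain u where u: "x - 1 = m * u" by (elim dvdE)
  obtain p r where bez: "p * g + r * x = 1"
  proof -
    define C where "C = inv\<^bsub>G\<^esub> A"
    have C: "C \<in> carrier G" "A * C = 1\<^sub>m n"
      using G.inv_closed[OF \<Lambda>_SL[OF A(1)]] G.r_inv[OF \<Lambda>_SL[OF A(1)]] by (simp_all add: C_def)
    have Cc: "C \<in> carrier_mat n n" using C(1) by simp
    have "(A * C) $$ (k, k) = (\<Sum>l = 0..<n. A $$ (k, l) * C $$ (l, k))"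
      using k Cc \<Lambda>_carrier[OF A(1)] by (simp add: scalar_prod_def)
    also have "\<dots> = (\<Sum>l \<in> {i, k}. A $$ (k, l) * C $$ (l, k))"
    proof (rule sum.mono_neutral_right)
      show "\<forall>l \<in> {0..<n} - {i, k}. A $$ (k, l) * C $$ (l, k) = 0"
      proof
        fix l assume l: "l \<in> {0..<n} - {i, k}"
        then have "l < k \<or> Suc k \<le> l" by auto
        then have "A $$ (k, l) = 0" using row[of l] l A(2) k unfolding block_def by auto
        then show "A $$ (k, l) * C $$ (l, k) = 0" by simp
      qed
    qed (use kk k in auto)
    also have "\<dots> = C $$ (i, k) * g + C $$ (k, k) * x" using kk by (simp add: g_def x_def mult.commute)
    finally have "C $$ (i, k) * g + C $$ (k, k) * x = 1" using C(2) k by simp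
    then show thesis by (rule that)
  qed
  \<comment> \<open>the Bezout coefficients put the entry \<open>m\<close> into column \<open>j\<close>; as \<open>x = 1 + m u\<close>, subtracting
    \<open>u\<close> times that column turns \<open>x\<close> into 1, by a conjugation since \<open>u\<close> is arbitrary; the
    entry 1 then clears the row by operations with multiples of \<open>m\<close>\<close>
  define A1 where "A1 = A * E n i j (m * p)"
  note o1 = right_operation[OF A kk(2,3) ij(3) kk(1), of "m * p", folded A1_def, simplified]
  have e1: "A1 $$ (k, c) = A $$ (k, c) + (if c = j then m * p * g else 0)" if "c < n" for c
    unfolding A1_def g_def by (rule mult_E_right[OF \<Lambda>_carrier[OF A(1)] kk(10) k that])
  define A2 where "A2 = A1 * E n k j (m * r)"
  note o2 = right_operation[OF o1(1,2) kk(4,3,8,1), of "m * r", folded A2_def, simplified]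
  have e2: "A2 $$ (k, c) = A1 $$ (k, c) + (if c = j then m * r * A1 $$ (k, k) else 0)" if "c < n" for c
    unfolding A2_def by (rule mult_E_right[OF \<Lambda>_carrier[OF o1(1)] k k that])
  define A3 where "A3 = E n j k (- (- u)) * (A2 * E n j k (- u))"
  note o3 = conj_operation[OF o2(1,2) kk(3,4,6,1), where t = "- u", folded A3_def]
  have e3: "A3 $$ (k, c) = A2 $$ (k, c) + (if c = k then - u * A2 $$ (k, j) else 0)" if "c < n" for c
    by (rule o3(4)[OF k that kk(8)])
  define A4 where "A4 = A3 * E n k i (- g)"
  have mg': "m dvd - g" "m dvd - m" using mg by simp_all
  note o4 = right_operation[OF o3(1,2) kk(4,2,7,1) mg'(1), folded A4_def]
  have e4: "A4 $$ (k, c) = A3 $$ (k, c) + (if c = i then - g * A3 $$ (k, k) else 0)" if "c < n" for c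
    unfolding A4_def by (rule mult_E_right[OF \<Lambda>_carrier[OF o3(1)] k k that])
  define A5 where "A5 = A4 * E n k j (- m)"
  note o5 = right_operation[OF o4(1,2) kk(4,3,8,1) mg'(2), folded A5_def]
  have e5: "A5 $$ (k, c) = A4 $$ (k, c) + (if c = j then - m * A4 $$ (k, k) else 0)" if "c < n" for c
    unfolding A5_def by (rule mult_E_right[OF \<Lambda>_carrier[OF o4(1)] k k that])
  have k2: "A2 $$ (k, k) = x" using e1 e2 k kk by (simp add: x_def)
  have j2: "A2 $$ (k, j) = m"
  proof -
    have "A2 $$ (k, j) = m * (p * g + r * x)"
      using e1 e2 kk k row[OF ij(2)] by (simp add: x_def algebra_simps)
    then show ?thesis using bez by simp
  qed
  have k3: "A3 $$ (k, k) = 1" using e3[OF k] k2 j2 u by (simp add: algebra_simps)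
  have j3: "A3 $$ (k, j) = m" using e3[OF kk(11)] j2 kk by simp
  have i3: "A3 $$ (k, i) = g" using e1 e2 e3 kk by (simp add: g_def)
  have row5: "A5 $$ (k, c) = (if c = k then 1 else 0)" if c: "c \<le> k" for c
  proof -
    have cn: "c < n" using c k by simp
    have k4: "A4 $$ (k, k) = 1" using e4[OF k] k3 kk by simp
    consider "c = k" | "c = i" | "c = j" | "c < k" "c \<noteq> i" "c \<noteq> j" using c by linarith
    then show ?thesis
    proof cases
      case 1 then show ?thesis using e5[OF k] k4 kk by simp
    next
      case 2 then show ?thesis using e5[OF kk(10)] e4[OF kk(10)] i3 k3 kk by simp
    next
      case 3 then show ?thesis using e5[OF kk(11)] e4[OF kk(11)] j3 k4 kk by simp
    next
      case 4 then show ?thesis using e5[OF cn] e4[OF cn] e3[OF cn] e2[OF cn] e1[OF cn] row[of c] by simp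
    qed
  qed
  have "A5 \<in> N"
    by (rule unit_row_mem_N[where j = k, OF k IH o5(1,2) row5]) simp_all
  then show ?thesis using o1(3) o2(3) o3(3) o4(3) o5(3) by blast
qed

text \<open>
  Conjugation by elementary matrices performs the Euclidean algorithm on the off-diagonal entries of row \<open>k\<close>,
  until at most one of them is nonzero.
\<close>

lemma row_reduction_mem_N:
  assumes k: "2 \<le> k" "k < n" and IH: "\<And>A. A \<in> \<Lambda> \<Longrightarrow> block k A \<Longrightarrow> A \<in> N"
  shows "A \<in> \<Lambda> \<Longrightarrow> block (Suc k) A \<Longrightarrow> A \<in> N"
proof (induction "nat (\<Sum>l<k. \<bar>A $$ (k, l)\<bar>)" arbitrary: A rule: less_induct)
  case less
  show ?case
  proof (cases "\<exists>i j. i < k \<and> j < k \<and> i \<noteq> j \<and> A $$ (k, i) \<noteq> 0 \<and> A $$ (k, j) \<noteq> 0 \<and> \<bar>A $$ (k, j)\<bar> \<le> \<bar>A $$ (k, i)\<bar>")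
    case True
    then obtain i j where ij: "i < k" "j < k" "i \<noteq> j" and nz: "A $$ (k, i) \<noteq> 0" "A $$ (k, j) \<noteq> 0"
      and le: "\<bar>A $$ (k, j)\<bar> \<le> \<bar>A $$ (k, i)\<bar>" by blast
    \<comment> \<open>one step of the Euclidean algorithm on two entries of the row\<close>
    define t where "t = - sgn (A $$ (k, i)) * sgn (A $$ (k, j))"
    have smaller: "\<bar>A $$ (k, i) + t * A $$ (k, j)\<bar> < \<bar>A $$ (k, i)\<bar>"
      using nz le unfolding t_def by (auto simp: sgn_if abs_if split: if_splits)
    define A' where "A' = E n j i (- t) * (A * E n j i t)"
    have kk: "j < Suc k" "i < Suc k" "j \<noteq> i" "Suc k \<le> n" "k \<noteq> j" using ij k by simp_all
    note o = conj_operation[OF less.prems kk(1-4), where t = t, folded A'_def]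
    have entry: "A' $$ (k, c) = A $$ (k, c) + (if c = i then t * A $$ (k, j) else 0)" if "c < k" for c
      using o(4)[OF k(2) _ kk(5), of c] that k by simp
    have "(\<Sum>l<k. \<bar>A' $$ (k, l)\<bar>) < (\<Sum>l<k. \<bar>A $$ (k, l)\<bar>)"
    proof (rule sum_strict_mono_ex1)
      show "\<forall>l\<in>{..<k}. \<bar>A' $$ (k, l)\<bar> \<le> \<bar>A $$ (k, l)\<bar>" using entry smaller by auto
      show "\<exists>l\<in>{..<k}. \<bar>A' $$ (k, l)\<bar> < \<bar>A $$ (k, l)\<bar>" using entry[OF ij(1)] smaller ij(1) by (intro bexI[of _ i]) simp_all
    qed simp
    moreover have "(\<Sum>l<k. \<bar>A' $$ (k, l)\<bar>) \<ge> 0" by (intro sum_nonneg) simp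
    ultimately have "nat (\<Sum>l<k. \<bar>A' $$ (k, l)\<bar>) < nat (\<Sum>l<k. \<bar>A $$ (k, l)\<bar>)" by linarith
    then have "A' \<in> N" using o(1,2) by (rule less.hyps)
    then show ?thesis by (rule o(3))
  next
    case False
    have pair: "A $$ (k, i) = 0 \<or> A $$ (k, j) = 0" if "i < k" "j < k" "i \<noteq> j" for i j
    proof -
      have "\<bar>A $$ (k, j)\<bar> \<le> \<bar>A $$ (k, i)\<bar> \<or> \<bar>A $$ (k, i)\<bar> \<le> \<bar>A $$ (k, j)\<bar>" by linarith
      then show ?thesis using False that by blast
    qed
    obtain i where i: "i < k" "\<And>l. l < k \<Longrightarrow> l \<noteq> i \<Longrightarrow> A $$ (k, l) = 0"
    proof (cases "\<exists>i<k. A $$ (k, i) \<noteq> 0")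
      case True
      then obtain i where "i < k" "A $$ (k, i) \<noteq> 0" by blast
      then show thesis using that[of i] pair by blast
    next
      case False
      then show thesis using that[of 0] k by auto
    qed
    define j where "j = (if i = 0 then 1 else 0 :: nat)"
    have "j < k" "i \<noteq> j" using k by (auto simp: j_def)
    then show ?thesis by (intro two_entry_row_mem_N[OF k(2) IH less.prems i(1) _ _ i(2)])
  qed
qed

lemma block_mem_N: "2 \<le> k \<Longrightarrow> k \<le> n \<Longrightarrow> A \<in> \<Lambda> \<Longrightarrow> block k A \<Longrightarrow> A \<in> N"
proof (induction k arbitrary: A rule: nat_induct_at_least)
  case base
  then show ?case by (intro block_2_mem_N)
next
  case (Suc k)
  show ?case
  proof (rule row_reduction_mem_N[OF Suc.hyps _ _ Suc.prems(2,3)])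
    show "k < n" using Suc.prems by simp
    show "B \<in> N" if "B \<in> \<Lambda>" "block k B" for B using Suc.IH[of B] Suc.prems that by simp
  qed
qed

theorem \<Lambda>_subset_N: "\<Lambda> \<subseteq> N"
proof
  fix A assume "A \<in> \<Lambda>"
  then show "A \<in> N" using block_mem_N[of n A] n3 by (simp add: block_def)
qed

end

section \<open>The abelianization\<close>

lemma det_cong:
  fixes A B :: "int mat"
  assumes "A \<in> carrier_mat n n" "B \<in> carrier_mat n n"
    and "\<And>i j. i < n \<Longrightarrow> j < n \<Longrightarrow> [A $$ (i, j) = B $$ (i, j)] (mod m)"
  shows "[det A = det B] (mod m)"
  unfolding det_def'[OF assms(1)] det_def'[OF assms(2)]
proof (intro cong_sum cong_mult cong_refl cong_prod)
  fix p i assume "p \<in> {p. p permutes {0..<n}}" "i \<in> {0..<n}"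
  then have "i < n" "p i < n" using permutes_in_image[of p "{0..<n}" i] by auto
  then show "[A $$ (i, p i) = B $$ (i, p i)] (mod m)" by (rule assms(3))
qed

lemma matrix_index_less:
  fixes i j n :: nat
  assumes "i < n" "j < n" "i \<noteq> n - 1 \<or> j \<noteq> n - 1"
  shows "i * n + j < n ^ 2 - 1"
proof -
  have "i * n + j + 1 < n * n"
  proof (cases "i = n - 1")
    case True
    then have "j + 1 < n" using assms by auto
    then have "i * n + j + 1 < i * n + n" by simp
    also have "\<dots> = (i + 1) * n" by simp
    also have "\<dots> = n * n" using True assms by simp
    finally show ?thesis .
  next
    case False
    then have "i + 2 \<le> n" using assms by simp
    then have "(i + 2) * n \<le> n * n" by (rule mult_le_mono1)
    then have "i * n + 2 * n \<le> n * n" by (simp add: algebra_simps)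
    then show ?thesis using assms(2) by linarith
  qed
  then show ?thesis by (simp add: power2_eq_square)
qed

lemma matrix_index_pair:
  fixes k n :: nat
  assumes "k < n ^ 2 - 1"
  shows "k div n < n" "k mod n < n" "k div n \<noteq> n - 1 \<or> k mod n \<noteq> n - 1"
proof -
  have k: "k < n * n" "k \<noteq> n * n - 1" using assms by (auto simp: power2_eq_square)
  then have n: "n > 0" by (cases n) auto
  show "k div n < n" using k(1) by (rule less_mult_imp_div_less)
  show "k mod n < n" using n by simp
  show "k div n \<noteq> n - 1 \<or> k mod n \<noteq> n - 1"
  proof (rule ccontr)
    assume "\<not> ?thesis"
    then have "k = (n - 1) * n + (n - 1)" using div_mult_mod_eq[of k n] by simp
    also have "\<dots> = n * n - 1" using n by (cases n) auto
    finally show False using k(2) by simp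
  qed
qed

context commutator_level
begin

interpretation G: group "SL_int n" by (rule group_SL_int)
interpretation C: normal \<Gamma> "SL_int n" by (rule congruence_subgroup_normal)

text \<open>
  The entries of the matrix \<open>(A - 1) / d\<close>.
\<close>

definition digit :: "int mat \<Rightarrow> nat \<Rightarrow> nat \<Rightarrow> int" where
  "digit A i j = (A $$ (i, j) - (if i = j then 1 else 0)) div int d"

lemma digit_eq:
  assumes "A \<in> \<Gamma>" "i < n" "j < n"
  shows "A $$ (i, j) = (if i = j then 1 else 0) + int d * digit A i j"
proof -
  have "int d dvd A $$ (i, j) - (if i = j then 1 else 0)"
    using assms by (simp add: congruence_subgroup_iff cong_iff_dvd_diff)
  then show ?thesis unfolding digit_def by simp
qed

lemma digit_unique:
  assumes "A $$ (i, j) = (if i = j then 1 else 0) + int d * x"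
  shows "digit A i j = x"
  using assms d1 unfolding digit_def by simp

lemma digit_mult:
  assumes A: "A \<in> \<Gamma>" and B: "B \<in> \<Gamma>" and ij: "i < n" "j < n"
  shows "[digit (A * B) i j = digit A i j + digit B i j] (mod int d)"
proof -
  have c: "A \<in> carrier_mat n n" "B \<in> carrier_mat n n" using \<Gamma>_SL[OF A] \<Gamma>_SL[OF B] by simp_all
  have AB: "A * B \<in> \<Gamma>" using C.m_closed[OF A B] by simp
  let ?\<delta> = "\<lambda>i j. (if i = j then 1 else 0) :: int"
  have "(A * B) $$ (i, j) = (\<Sum>k = 0..<n. A $$ (i, k) * B $$ (k, j))"
    using c ij by (simp add: scalar_prod_def)
  also have "\<dots> = (\<Sum>k = 0..<n. (if k = i then ?\<delta> i j + int d * digit B i j else 0)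
      + (if k = j then int d * digit A i j else 0) + int d ^ 2 * (digit A i k * digit B k j))"
  proof (rule sum.cong[OF refl])
    fix k assume "k \<in> {0..<n}"
    then have k: "k < n" by simp
    show "A $$ (i, k) * B $$ (k, j) = (if k = i then ?\<delta> i j + int d * digit B i j else 0)
      + (if k = j then int d * digit A i j else 0) + int d ^ 2 * (digit A i k * digit B k j)"
      unfolding digit_eq[OF A ij(1) k] digit_eq[OF B k ij(2)]
      by (auto simp: algebra_simps power2_eq_square)
  qed
  also have "\<dots> = ?\<delta> i j + int d * digit B i j + int d * digit A i j
      + int d ^ 2 * (\<Sum>k = 0..<n. digit A i k * digit B k j)"
    using ij by (simp add: sum.distrib sum_distrib_left)
  also have "\<dots> = ?\<delta> i j + int d * (digit A i j + digit B i j + int d * (\<Sum>k = 0..<n. digit A i k * digit B k j))"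
    by (simp add: algebra_simps power2_eq_square)
  finally have "digit (A * B) i j = digit A i j + digit B i j + int d * (\<Sum>k = 0..<n. digit A i k * digit B k j)"
    by (rule digit_unique)
  then show ?thesis by (simp add: cong_def)
qed

text \<open>
  The last diagonal entry need not be inspected: if all other entries are those of the identity modulo \<open>d\<^sup>2\<close>,
  the determinant is that entry.
\<close>

lemma \<Lambda>_iff_digits:
  "A \<in> \<Lambda> \<longleftrightarrow> A \<in> \<Gamma> \<and> (\<forall>i<n. \<forall>j<n. i \<noteq> n - 1 \<or> j \<noteq> n - 1 \<longrightarrow> int d dvd digit A i j)"
proof
  assume A: "A \<in> \<Lambda>"
  then have "A \<in> N" using \<Lambda>_subset_N by blast
  then have A\<Gamma>: "A \<in> \<Gamma>" using N_subset by blast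
  moreover have "int d dvd digit A i j" if "i < n" "j < n" for i j
  proof -
    have "int d * int d dvd int d * digit A i j"
      using \<Lambda>_entry[OF A that] digit_eq[OF A\<Gamma> that] by (simp add: power2_eq_square)
    then show ?thesis using d1 by simp
  qed
  ultimately show "A \<in> \<Gamma> \<and> (\<forall>i<n. \<forall>j<n. i \<noteq> n - 1 \<or> j \<noteq> n - 1 \<longrightarrow> int d dvd digit A i j)" by blast
next
  assume asm: "A \<in> \<Gamma> \<and> (\<forall>i<n. \<forall>j<n. i \<noteq> n - 1 \<or> j \<noteq> n - 1 \<longrightarrow> int d dvd digit A i j)"
  then have A: "A \<in> \<Gamma>" by blast
  have entry: "[A $$ (i, j) = (if i = j then 1 else 0)] (mod m)" if "i < n" "j < n" "i \<noteq> n - 1 \<or> j \<noteq> n - 1" for i j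
  proof -
    have "int d dvd digit A i j" using asm that by blast
    then show ?thesis unfolding digit_eq[OF A that(1,2)] cong_iff_dvd_diff
      by (simp add: power2_eq_square mult_dvd_mono)
  qed
  \<comment> \<open>the last diagonal entry is controlled by the determinant\<close>
  let ?x = "A $$ (n - 1, n - 1)"
  have c: "A \<in> carrier_mat n n" "det A = 1" using \<Gamma>_SL[OF A] by simp_all
  have "[det A = det (multrow_mat n (n - 1) ?x)] (mod m)"
  proof (rule det_cong[OF c(1)])
    show "[A $$ (i, j) = multrow_mat n (n - 1) ?x $$ (i, j)] (mod m)" if "i < n" "j < n" for i j
    proof (cases "i = n - 1 \<and> j = n - 1")
      case True then show ?thesis using that by simp
    next
      case False
      then have "i \<noteq> n - 1 \<or> j \<noteq> n - 1" by blast
      from entry[OF that this] show ?thesis using that False by auto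
    qed
  qed simp
  also have "det (multrow_mat n (n - 1) ?x) = ?x" by (rule det_multrow_mat) (use n3 in simp)
  finally have "[?x = 1] (mod m)" using c(2) by (simp add: cong_sym)
  then have "[A $$ (i, j) = (if i = j then 1 else 0)] (mod m)" if "i < n" "j < n" for i j
    using entry[OF that] by (cases "i = n - 1 \<and> j = n - 1") auto
  then show "A \<in> \<Lambda>" using \<Gamma>_SL[OF A] by (simp add: congruence_subgroup_iff of_nat_power)
qed

text \<open>
  The last diagonal place is left out, because the determinant determines the digit there.
\<close>

definition digits_attained :: "(nat \<Rightarrow> nat \<Rightarrow> int) \<Rightarrow> bool" where
  "digits_attained F \<longleftrightarrow> (\<exists>A \<in> \<Gamma>. \<forall>i<n. \<forall>j<n. i \<noteq> n - 1 \<or> j \<noteq> n - 1 \<longrightarrow> [digit A i j = F i j] (mod int d))"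

lemma digits_attained_add:
  assumes "digits_attained F" "digits_attained H"
  shows "digits_attained (\<lambda>i j. F i j + H i j)"
proof -
  obtain A B where A: "A \<in> \<Gamma>" "\<forall>i<n. \<forall>j<n. i \<noteq> n - 1 \<or> j \<noteq> n - 1 \<longrightarrow> [digit A i j = F i j] (mod int d)"
    and B: "B \<in> \<Gamma>" "\<forall>i<n. \<forall>j<n. i \<noteq> n - 1 \<or> j \<noteq> n - 1 \<longrightarrow> [digit B i j = H i j] (mod int d)"
    using assms unfolding digits_attained_def by blast
  have "[digit (A * B) i j = F i j + H i j] (mod int d)" if ij: "i < n" "j < n" "i \<noteq> n - 1 \<or> j \<noteq> n - 1" for i j
  proof -
    have "[digit A i j = F i j] (mod int d)" "[digit B i j = H i j] (mod int d)" using A(2) B(2) ij by blast+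
    then show ?thesis using cong_trans[OF digit_mult[OF A(1) B(1) ij(1,2)] cong_add] by blast
  qed
  moreover have "A * B \<in> \<Gamma>" using C.m_closed[OF A(1) B(1)] by simp
  ultimately show ?thesis unfolding digits_attained_def by blast
qed

lemma digits_attained_zero: "digits_attained (\<lambda>i j. 0)"
proof -
  have "digit (1\<^sub>m n) i j = 0" if "i < n" "j < n" for i j
    by (rule digit_unique) (use that in simp)
  moreover have "1\<^sub>m n \<in> \<Gamma>" using C.one_closed by simp
  ultimately show ?thesis unfolding digits_attained_def by (intro bexI[of _ "1\<^sub>m n"]) auto
qed

lemma digits_attained_off_diagonal:
  assumes "p < n" "r < n" "p \<noteq> r"
  shows "digits_attained (\<lambda>i j. if i = p \<and> j = r then t else 0)"
proof -
  have "digit (E n p r (int d * t)) i j = (if i = p \<and> j = r then t else 0)" if "i < n" "j < n" for i j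
    by (rule digit_unique) (use that assms in \<open>auto simp: E_index simp del: index_mat_addrow_mat\<close>)
  then show ?thesis unfolding digits_attained_def
    by (intro bexI[OF _ E_congruence[OF assms(3), of n d t]]) auto
qed

text \<open>
  A conjugate of an elementary matrix of level \<open>d\<close> has digits \<open>t\<close> and \<open>-t\<close> at two diagonal places, one of
  which is the ignored last one; its off-diagonal digits are removed by elementary matrices.
\<close>

lemma digits_attained_diagonal:
  assumes r: "r < n - 1"
  shows "digits_attained (\<lambda>i j. if i = r \<and> j = r then t else 0)"
proof -
  define l where "l = n - 1"
  have rl: "r < n" "l < n" "r \<noteq> l" using r n3 by (auto simp: l_def)
  define A where "A = E n r l 1 * (E n l r (int d * t) * E n r l (- 1))"
  let ?F = "\<lambda>i j. (if i = r \<and> j = r then t else 0) + ((if i = l \<and> j = r then t else 0) +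
     ((if i = r \<and> j = l then - t else 0) + (if i = l \<and> j = l then - t else 0)))"
  have c: "E n l r (int d * t) * E n r l (- 1) \<in> carrier_mat n n" by (rule square_mult_closed) simp_all
  have "A = E n r l 1 * E n l r (int d * t) * E n r l (- 1)"
    unfolding A_def by (rule square_mult_assoc[of _ n, symmetric]) simp_all
  then have A\<Gamma>: "A \<in> \<Gamma>"
    using C.inv_op_closed2[OF E_mem_SL[OF rl(3)] E_congruence[of l r n d t], of 1] inv_E[OF rl, of 1] rl by simp
  have Y: "(E n l r (int d * t) * E n r l (- 1)) $$ (p, c) = (if p = c then 1 else if p = l \<and> c = r then int d * t else 0)
      + (if c = l then - (if p = r then 1 else if p = l then int d * t else 0) else 0)" if "p < n" "c < n" for p c
    using that rl by (subst mult_E_right) (auto simp: E_index simp del: index_mat_addrow_mat)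
  have "digit A i j = ?F i j" if ij: "i < n" "j < n" for i j
  proof (rule digit_unique)
    have "A $$ (i, j) = (E n l r (int d * t) * E n r l (- 1)) $$ (i, j)
        + (if i = r then 1 * (E n l r (int d * t) * E n r l (- 1)) $$ (l, j) else 0)"
      unfolding A_def by (rule mult_E_left[OF c rl(2) ij])
    then show "A $$ (i, j) = (if i = j then 1 else 0) + int d * ?F i j"
      unfolding Y[OF ij] Y[OF rl(2) ij(2)] using rl(3)
      by (cases "i = r"; cases "i = l"; cases "j = r"; cases "j = l") simp_all
  qed
  then have "digits_attained ?F" unfolding digits_attained_def by (intro bexI[OF _ A\<Gamma>]) auto
  from digits_attained_add[OF this digits_attained_add[OF
      digits_attained_off_diagonal[OF rl(2,1) rl(3)[symmetric], of "- t"]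
      digits_attained_off_diagonal[OF rl, of t]]]
  obtain B where B: "B \<in> \<Gamma>" "\<forall>i<n. \<forall>j<n. i \<noteq> n - 1 \<or> j \<noteq> n - 1 \<longrightarrow> [digit B i j = ?F i j +
      ((if i = l \<and> j = r then - t else 0) + (if i = r \<and> j = l then t else 0))] (mod int d)"
    unfolding digits_attained_def by blast
  have cancel: "?F i j + ((if i = l \<and> j = r then - t else 0) + (if i = r \<and> j = l then t else 0))
      = (if i = r \<and> j = r then t else 0)" if "i \<noteq> n - 1 \<or> j \<noteq> n - 1" for i j
  proof -
    have "\<not> (i = l \<and> j = l)" using that by (simp add: l_def)
    then show ?thesis using rl(3) by (cases "i = r"; cases "i = l"; cases "j = r"; cases "j = l") simp_all
  qed
  show ?thesis
    unfolding digits_attained_def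
  proof (intro bexI[OF _ B(1)] allI impI)
    fix i j assume ij: "i < n" "j < n" "i \<noteq> n - 1 \<or> j \<noteq> n - 1"
    from B(2) ij have "[digit B i j = ?F i j +
      ((if i = l \<and> j = r then - t else 0) + (if i = r \<and> j = l then t else 0))] (mod int d)" by blast
    then show "[digit B i j = (if i = r \<and> j = r then t else 0)] (mod int d)" unfolding cancel[OF ij(3)] .
  qed
qed

lemma digits_attained_all: "digits_attained F"
proof -
  let ?I = "{0..<n} \<times> {0..<n} - {(n - 1, n - 1)}"
  have "digits_attained (\<lambda>i j. if (i, j) \<in> K then F i j else 0)" if "finite K" "K \<subseteq> ?I" for K
    using that
  proof (induction K rule: finite_induct)
    case empty
    then show ?case using digits_attained_zero by simp
  next
    case (insert x K)
    obtain p r where x: "x = (p, r)" by (cases x)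
    have pr: "p < n" "r < n" "p \<noteq> n - 1 \<or> r \<noteq> n - 1" using insert.prems x by auto
    have "digits_attained (\<lambda>i j. if i = p \<and> j = r then F p r else 0)"
    proof (cases "p = r")
      case True
      then show ?thesis using digits_attained_diagonal[of r "F p r"] pr by auto
    next
      case False
      then show ?thesis using digits_attained_off_diagonal pr by blast
    qed
    moreover have "digits_attained (\<lambda>i j. if (i, j) \<in> K then F i j else 0)" using insert by blast
    ultimately have "digits_attained (\<lambda>i j. (if i = p \<and> j = r then F p r else 0) + (if (i, j) \<in> K then F i j else 0))"
      by (rule digits_attained_add)
    moreover have "(\<lambda>i j. (if i = p \<and> j = r then F p r else 0) + (if (i, j) \<in> K then F i j else 0))
      = (\<lambda>i j. if (i, j) \<in> insert x K then F i j else 0)"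
      using insert.hyps(2) x by (auto simp: fun_eq_iff)
    ultimately show ?case by simp
  qed
  from this[of ?I] have "digits_attained (\<lambda>i j. if (i, j) \<in> ?I then F i j else 0)" by simp
  then show ?thesis unfolding digits_attained_def by auto
qed

abbreviation Zd where "Zd \<equiv> product_group {..<n ^ 2 - 1} (\<lambda>_. integer_mod_group d)"

definition digits :: "int mat \<Rightarrow> nat \<Rightarrow> int" where
  "digits A = (\<lambda>k \<in> {..<n ^ 2 - 1}. digit A (k div n) (k mod n) mod int d)"

lemma Zd_simps:
  "carrier Zd = {..<n ^ 2 - 1} \<rightarrow>\<^sub>E {0..<int d}"
  "f \<otimes>\<^bsub>Zd\<^esub> g = (\<lambda>k \<in> {..<n ^ 2 - 1}. (f k + g k) mod int d)"
  "\<one>\<^bsub>Zd\<^esub> = (\<lambda>k \<in> {..<n ^ 2 - 1}. 0)"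
  using d1 by (simp_all add: carrier_integer_mod_group)

lemma digits_hom: "digits \<in> hom (congruence_group d n) Zd"
proof (rule homI)
  have carr: "carrier (congruence_group d n) = \<Gamma>" by (simp add: congruence_group_def)
  show "digits A \<in> carrier Zd" for A
    unfolding Zd_simps digits_def using d1 by auto
  fix A B assume "A \<in> carrier (congruence_group d n)" "B \<in> carrier (congruence_group d n)"
  then have AB: "A \<in> \<Gamma>" "B \<in> \<Gamma>" by (simp_all add: carr)
  have "digits (A * B) = digits A \<otimes>\<^bsub>Zd\<^esub> digits B"
    unfolding Zd_simps
  proof (rule ext)
    fix k
    show "digits (A * B) k = (\<lambda>k \<in> {..<n ^ 2 - 1}. (digits A k + digits B k) mod int d) k"
    proof (cases "k < n ^ 2 - 1")
      case True
      note k = matrix_index_pair[OF True]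
      show ?thesis using digit_mult[OF AB k(1,2)] True by (simp add: digits_def cong_def mod_add_eq)
    qed (simp add: digits_def)
  qed
  then show "digits (A \<otimes>\<^bsub>congruence_group d n\<^esub> B) = digits A \<otimes>\<^bsub>Zd\<^esub> digits B"
    by (simp add: congruence_group_def)
qed

lemma digits_surj: "digits ` carrier (congruence_group d n) = carrier Zd"
proof
  show "digits ` carrier (congruence_group d n) \<subseteq> carrier Zd" using digits_hom by (auto simp: hom_def)
  show "carrier Zd \<subseteq> digits ` carrier (congruence_group d n)"
  proof
    fix f assume f: "f \<in> carrier Zd"
    from digits_attained_all[of "\<lambda>i j. f (i * n + j)"] obtain A where A: "A \<in> \<Gamma>"
      "\<forall>i<n. \<forall>j<n. i \<noteq> n - 1 \<or> j \<noteq> n - 1 \<longrightarrow> [digit A i j = f (i * n + j)] (mod int d)"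
      unfolding digits_attained_def by blast
    have "f k = digits A k" for k
    proof (cases "k < n ^ 2 - 1")
      case True
      note k = matrix_index_pair[OF True]
      have "[digit A (k div n) (k mod n) = f (k div n * n + k mod n)] (mod int d)" using A(2) k by blast
      then have "digit A (k div n) (k mod n) mod int d = f k mod int d" by (simp add: cong_def)
      also have "f k \<in> {0..<int d}" using f True unfolding Zd_simps by (auto simp: PiE_iff)
      then have "f k mod int d = f k" by simp
      finally show ?thesis using True by (simp add: digits_def)
    next
      case False
      then show ?thesis using f unfolding Zd_simps by (auto simp: digits_def PiE_iff extensional_def)
    qed
    then have "f = digits A" by (rule ext)
    then show "f \<in> digits ` carrier (congruence_group d n)" using A(1) by (simp add: congruence_group_def)
  qed
qed

lemma digits_kernel: "kernel (congruence_group d n) Zd digits = \<Lambda>"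
proof (rule Set.set_eqI)
  fix A
  have "digits A = \<one>\<^bsub>Zd\<^esub> \<longleftrightarrow> (\<forall>k < n ^ 2 - 1. int d dvd digit A (k div n) (k mod n))"
  proof
    assume eq: "digits A = \<one>\<^bsub>Zd\<^esub>"
    show "\<forall>k < n ^ 2 - 1. int d dvd digit A (k div n) (k mod n)"
    proof (intro allI impI)
      fix k assume "k < n ^ 2 - 1"
      then show "int d dvd digit A (k div n) (k mod n)"
        using fun_cong[OF eq[unfolded Zd_simps], of k] by (simp add: digits_def mod_eq_0_iff_dvd)
    qed
  next
    assume "\<forall>k < n ^ 2 - 1. int d dvd digit A (k div n) (k mod n)"
    then show "digits A = \<one>\<^bsub>Zd\<^esub>"
      unfolding Zd_simps digits_def by (intro restrict_ext) (simp add: mod_eq_0_iff_dvd)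
  qed
  also have "\<dots> \<longleftrightarrow> (\<forall>i<n. \<forall>j<n. i \<noteq> n - 1 \<or> j \<noteq> n - 1 \<longrightarrow> int d dvd digit A i j)"
  proof (intro iffI allI impI)
    fix i j assume all: "\<forall>k < n ^ 2 - 1. int d dvd digit A (k div n) (k mod n)"
      and ij: "i < n" "j < n" "i \<noteq> n - 1 \<or> j \<noteq> n - 1"
    have "int d dvd digit A ((i * n + j) div n) ((i * n + j) mod n)"
      using all matrix_index_less[OF ij] by blast
    then show "int d dvd digit A i j" using ij by simp
  next
    fix k assume all: "\<forall>i<n. \<forall>j<n. i \<noteq> n - 1 \<or> j \<noteq> n - 1 \<longrightarrow> int d dvd digit A i j" and k: "k < n ^ 2 - 1"
    show "int d dvd digit A (k div n) (k mod n)"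
      using all[rule_format, OF matrix_index_pair[OF k]] .
  qed
  finally show "A \<in> kernel (congruence_group d n) Zd digits \<longleftrightarrow> A \<in> \<Lambda>"
    unfolding \<Lambda>_iff_digits kernel_def by (simp add: congruence_group_def)
qed

text \<open>
  The digits define a homomorphism onto a commutative group with kernel \<open>\<Lambda>\<close>; hence \<open>N\<close> lies in \<open>\<Lambda>\<close>. With
  \<open>\<Lambda>_subset_N\<close> this identifies \<open>N\<close> with the kernel.
\<close>

theorem abelianization_iso: "abelianization (congruence_group d n) \<cong> Zd"
proof -
  interpret h: group_hom "congruence_group d n" Zd digits
    by (intro group_hom.intro group_congruence_group group_hom_axioms.intro digits_hom product_group) simp
  interpret Z: comm_group Zd
    by (rule group.group_comm_groupI[OF h.H.is_group]) (simp add: add.commute fun_eq_iff)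
  have "N \<subseteq> \<Lambda>"
  proof
    fix A assume A: "A \<in> N"
    have "digits ` N = derived Zd (digits ` carrier (congruence_group d n))"
      using h.derived_img[OF subset_refl] unfolding derived_congruence_group by simp
    also have "\<dots> = {\<one>\<^bsub>Zd\<^esub>}" unfolding digits_surj by (rule Z.derived_eq_singleton[OF subset_refl])
    finally have "digits A = \<one>\<^bsub>Zd\<^esub>" using A by blast
    moreover have "A \<in> carrier (congruence_group d n)"
      using A N_subset by (auto simp: congruence_group_def)
    ultimately show "A \<in> \<Lambda>" unfolding digits_kernel[symmetric] kernel_def by blast
  qed
  then have "N = \<Lambda>" using \<Lambda>_subset_N by blast
  then have "Ab = congruence_group d n Mod kernel (congruence_group d n) Zd digits"
    unfolding Ab_eq digits_kernel by simp
  then show ?thesis using h.FactGroup_iso[OF digits_surj] by simp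
qed

end

theorem theorem1p1:
  fixes n d :: nat
  assumes "n \<ge> 3" and "d \<ge> 1"
  shows "abelianization (congruence_group d n) \<cong>
         product_group {..<n^2 - 1} (\<lambda>_. integer_mod_group d)"
  by (rule commutator_level.abelianization_iso) (use assms in unfold_locales)

end
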